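(* Let $k\ge 0$ be an integer and let $\Theta$ be the supremum of the real parts of the nontrivial zeros of $\zeta(s)$. Then for every $\varepsilon>0$, \[ E_k(x)=\Omega_{\pm}\left(x^{\Theta-1-\varepsilon}\right), \] i.e. $E_k(x)>x^{\Theta-1-\varepsilon}$ for arbitrarily large $x$, and $E_k(x)<-x^{\Theta-1-\varepsilon}$ for arbitrarily large $x$.
   Context: $\mu$ is the Möbius function and $\psi(n)=\sum_{d\mid n} d\,\mu^2(n/d)$ is the Dedekind totient function. $S_k(x)=\frac{1}{k!}\sum_{l\le x}\frac{l}{\psi(l)}\left(1-\frac{l}{x}\right)^k$ and $E_k(x)=S_k(x)-\frac{\zeta(4)h(1)}{(k+1)!\,\zeta(2)}x$ with $h(1)=\prod_p\left(1+\frac{1}{p^2(p+1)}-\frac{1}{p^3(p+1)}\right)$ (product over primes). *)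

theory Defs
  imports
    "HOL-Complex_Analysis.Complex_Analysis"
    "HOL-Computational_Algebra.Computational_Algebra"
begin

definition moebius_mu :: "nat \<Rightarrow> int" where
  "moebius_mu n = (if squarefree n then (-1) ^ card (prime_factors n) else 0)"

definition dedekind_psi :: "nat \<Rightarrow> int" where
  "dedekind_psi n = (\<Sum>d | d dvd n. int d * (moebius_mu (n div d))\<^sup>2)"

text \<open>
  The Riemann zeta function is the unique holomorphic continuation of the Dirichlet series
  to the plane without the point 1. The value at the pole is irrelevant;
  it is set to 0 only so that the description determines a total function.
\<close>

definition zeta :: "complex \<Rightarrow> complex" where
  "zeta = (THE f. f holomorphic_on (- {1}) \<and>
                  (\<forall>s. Re s > 1 \<longrightarrow> (\<lambda>n. 1 / of_nat (Suc n) powr s) sums f s) \<and>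
                  f 1 = 0)"

definition trivial_zeta_zeros :: "complex set" where
  "trivial_zeta_zeros = {- 2 * of_nat m | m. m \<ge> 1}"

text \<open>The point 1 is excluded because there \<open>zeta\<close> has a pole and only a dummy value.\<close>

definition nontrivial_zeta_zeros :: "complex set" where
  "nontrivial_zeta_zeros = {s. s \<noteq> 1 \<and> zeta s = 0} - trivial_zeta_zeros"

definition zeta_Theta :: real where
  "zeta_Theta = Sup (Re ` nontrivial_zeta_zeros)"

text \<open>Indices that are not prime contribute the factor 1.\<close>

definition h_one :: real where
  "h_one = (\<Prod>p. if prime p
                  then 1 + 1 / (real p ^ 2 * (real p + 1)) - 1 / (real p ^ 3 * (real p + 1))
                  else 1)"

definition S :: "nat \<Rightarrow> real \<Rightarrow> real" where
  "S k x = 1 / fact k *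
     (\<Sum>l | 1 \<le> l \<and> real l \<le> x. real l / of_int (dedekind_psi l) * (1 - real l / x) ^ k)"

definition E :: "nat \<Rightarrow> real \<Rightarrow> real" where
  "E k x = S k x - Re (zeta 4) * h_one / (fact (k + 1) * Re (zeta 2)) * x"

end

(*
  Put F(s) = sum_l (l / psi l) l^-s. By Euler products F(s) = zeta(s) Q(s) / zeta(s+1), where Q is
  holomorphic and zero-free for Re s > -1, and the Mellin transform of E_k is F(s) / (s (s+1) ... (s+k)) minus
  its principal part at 1, since Q(1) = zeta(4) h(1). If, say, E_k(x) <= x^c for all large x
  with c = Theta - 1 - epsilon, then Landau's theorem on Laplace transforms of nonnegative functions, applied
  to x^c - E_k(x), shows that this Mellin
  transform is holomorphic for Re s > c, because zeta has no zero on the positive real axis. Multiplying by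
  zeta(s+1) and evaluating at s = rho - 1 for a nontrivial zero rho with Re rho > Theta - epsilon gives
  zeta(rho - 1) Q(rho - 1) = 0, which contradicts the functional equation and the nonvanishing of zeta on
  Re s >= 1.

  The continuation and the functional equation come from the theta function, whose transformation law is
  proved by integrating a Gaussian against the Fejer-like kernel cos(pi u)^(2N) in two ways. Theta is a supremum
  over a nonempty set because a zero-free xi, being of order less than 2 and symmetric, would be constant.
*)

theory Submission
  imports Defs "HOL-Probability.Probability" "HOL-Real_Asymp.Real_Asymp"
begin

subsection \<open>Laplace transforms and Landau's theorem\<close>

text \<open>A single transform over an arbitrary measure covers both Mellin integrals (Lebesgue
  measure, exponent \<open>lnp\<close>) and Dirichlet series (counting measure, exponent
  \<open>ln\<close>). Identities between transforms are checked at real arguments, where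
  nonnegativity lets sums and integrals be exchanged, and are then spread by the identity theorem.
  The kernel cos(pi u)^(2N) does the work of Poisson summation: it is a nonnegative trigonometric
  polynomial, its normalised Fourier coefficients lie in [0, 1] and tend to 1, and its mass gathers
  at the integers, so both evaluations pass to the limit by domination. Two margins shape the end of
  the proof. Q is available only for Re s > -1, so the exponent Theta - 1 - epsilon has to exceed
  -1; a zero together with its mirror image gives Theta >= 1/2, and epsilon may be taken below 1/2.
  Landau's theorem needs a continuation only near a real ray, so zeros of zeta off the real axis do
  not obstruct it.\<close>

definition laplace :: "'a measure \<Rightarrow> ('a \<Rightarrow> real) \<Rightarrow> ('a \<Rightarrow> real) \<Rightarrow> complex \<Rightarrow> complex" where
  "laplace M \<phi> f s = (\<integral>x. of_real (f x) * exp (- s * of_real (\<phi> x)) \<partial>M)"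

lemma powser_coeffs_unique:
  fixes a b :: "nat \<Rightarrow> complex"
  assumes "r > 0"
    and "\<And>x. norm (x - z) < r \<Longrightarrow> (\<lambda>n. a n * (x - z) ^ n) sums f x"
    and "\<And>x. norm (x - z) < r \<Longrightarrow> (\<lambda>n. b n * (x - z) ^ n) sums f x"
  shows "a = b"
proof (rule ccontr)
  assume "a \<noteq> b"
  then obtain m where m: "a m - b m \<noteq> 0" by auto
  have d: "(\<lambda>n. (a n - b n) * (x - z) ^ n) sums 0" if "norm (x - z) < r" for x
    using sums_diff[OF assms(2)[OF that] assms(3)[OF that]] by (simp add: algebra_simps)
  have "(\<lambda>n. (a n - b n) * 0 ^ n) sums (a 0 - b 0)"
    using powser_sums_zero[of "\<lambda>n. a n - b n"] by simp
  with d[of z] \<open>r > 0\<close> have "a 0 - b 0 = 0"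
    by (metis diff_self norm_zero sums_unique2)
  with m have "m > 0" by (cases m) auto
  obtain s where "0 < s" and s: "\<And>x. x \<in> cball z s - {z} \<Longrightarrow> (0::complex) \<noteq> 0"
    by (rule powser_0_nonzero[of r z "\<lambda>n. a n - b n" "\<lambda>_. 0" m]) (use d m \<open>m > 0\<close> \<open>r > 0\<close> in auto)
  have "z + of_real s \<in> cball z s - {z}" using \<open>0 < s\<close> by (auto simp: dist_norm)
  from s[OF this] show False by simp
qed

lemma integrable_laplace:
  assumes [measurable]: "f \<in> borel_measurable M" "\<phi> \<in> borel_measurable M"
    and nonneg: "\<And>x. x \<in> space M \<Longrightarrow> \<phi> x \<ge> 0"
    and int: "integrable M (\<lambda>x. f x * exp (- c * \<phi> x))" and "c \<le> Re s"
  shows "integrable M (\<lambda>x. of_real (f x) * exp (- s * of_real (\<phi> x)) :: complex)"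
proof (rule Bochner_Integration.integrable_bound[OF int])
  show "AE x in M. norm (of_real (f x) * exp (- s * of_real (\<phi> x))) \<le> norm (f x * exp (- c * \<phi> x))"
    using assms(3,5) by (intro AE_I2) (simp add: norm_mult abs_mult mult_left_mono mult_right_mono)
qed measurable

text \<open>Expand the exponential in powers of \<open>s - s0\<close>. The norms of the terms add up
  to at most \<open>\<bar>f\<bar> exp ((norm (s - s0) - Re s0) \<phi>)\<close>, and the condition on
  \<open>s\<close> is exactly what keeps this below the integrable function
  \<open>\<bar>f\<bar> exp (- c \<phi>)\<close>.\<close>

lemma laplace_power_series:
  assumes [measurable]: "f \<in> borel_measurable M" "\<phi> \<in> borel_measurable M"
    and nonneg: "\<And>x. x \<in> space M \<Longrightarrow> \<phi> x \<ge> 0"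
    and int: "integrable M (\<lambda>x. f x * exp (- c * \<phi> x))"
    and s: "norm (s - s0) \<le> Re s0 - c"
  shows "(\<lambda>n. (\<integral>x. of_real (f x * (- \<phi> x) ^ n / fact n) * exp (- s0 * of_real (\<phi> x)) \<partial>M) * (s - s0) ^ n)
           sums laplace M \<phi> f s"
proof -
  define u :: "nat \<Rightarrow> 'a \<Rightarrow> complex" where
    "u = (\<lambda>n x. of_real (f x * (- \<phi> x) ^ n / fact n) * exp (- s0 * of_real (\<phi> x)) * (s - s0) ^ n)"
  have u_eq: "u n x = of_real (f x) * exp (- s0 * of_real (\<phi> x)) * (((s0 - s) * of_real (\<phi> x)) ^ n /\<^sub>R fact n)" for n x
  proof -
    have "((s0 - s) * of_real (\<phi> x)) ^ n = (of_real (- \<phi> x) * (s - s0)) ^ n"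
      by (rule arg_cong[of _ _ "\<lambda>t. t ^ n"]) (simp add: algebra_simps)
    also have "\<dots> = of_real ((- \<phi> x) ^ n) * (s - s0) ^ n"
      unfolding power_mult_distrib of_real_power ..
    finally show ?thesis by (simp add: u_def scaleR_conv_of_real field_simps)
  qed
  have [measurable]: "u n \<in> borel_measurable M" for n unfolding u_def by measurable
  have bnd: "(\<Sum>i<n. norm (u i x)) \<le> norm (f x * exp (- c * \<phi> x))" if x: "x \<in> space M" for n x
  proof -
    have nn: "norm (u i x) = \<bar>f x\<bar> * exp (- Re s0 * \<phi> x) * ((norm (s - s0) * \<phi> x) ^ i /\<^sub>R fact i)" for i
      unfolding u_eq using nonneg[OF x]
      by (simp add: norm_mult norm_power norm_minus_commute)
    have "(\<Sum>i<n. (norm (s - s0) * \<phi> x) ^ i /\<^sub>R fact i) \<le> exp (norm (s - s0) * \<phi> x)"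
      unfolding exp_def using nonneg[OF x]
      by (intro sum_le_suminf summable_exp_generic) auto
    also have "\<dots> \<le> exp ((Re s0 - c) * \<phi> x)"
      using nonneg[OF x] s by (auto intro: mult_right_mono)
    finally have "(\<Sum>i<n. norm (u i x)) \<le> \<bar>f x\<bar> * exp (- Re s0 * \<phi> x) * exp ((Re s0 - c) * \<phi> x)"
      unfolding nn sum_distrib_left[symmetric] by (intro mult_left_mono) auto
    also have "\<dots> = \<bar>f x\<bar> * exp (- c * \<phi> x)"
      by (simp add: mult.assoc exp_add[symmetric] algebra_simps)
    finally show ?thesis by (simp add: abs_mult)
  qed
  have int_u: "integrable M (u n)" for n
  proof (rule Bochner_Integration.integrable_bound[OF int])
    show "AE x in M. norm (u n x) \<le> norm (f x * exp (- c * \<phi> x))"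
    proof (rule AE_I2)
      fix x assume x: "x \<in> space M"
      have "norm (u n x) \<le> (\<Sum>i<Suc n. norm (u i x))" by (intro member_le_sum) auto
      also note bnd[OF x]
      finally show "norm (u n x) \<le> norm (f x * exp (- c * \<phi> x))" .
    qed
  qed measurable
  have "(\<lambda>n. \<integral>x. (\<Sum>i<n. u i x) \<partial>M) \<longlonglongrightarrow> laplace M \<phi> f s"
    unfolding laplace_def
  proof (rule integral_dominated_convergence[where w = "\<lambda>x. norm (f x * exp (- c * \<phi> x))"])
    show "AE x in M. (\<lambda>n. \<Sum>i<n. u i x) \<longlonglongrightarrow> of_real (f x) * exp (- s * of_real (\<phi> x))"
    proof (rule AE_I2)
      fix x
      have "(\<lambda>n. u n x) sums (of_real (f x) * exp (- s0 * of_real (\<phi> x)) * exp ((s0 - s) * of_real (\<phi> x)))"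
        unfolding u_eq by (intro sums_mult exp_converges)
      also have "of_real (f x) * exp (- s0 * of_real (\<phi> x)) * exp ((s0 - s) * of_real (\<phi> x)) =
           of_real (f x) * exp (- s * of_real (\<phi> x))"
        by (simp add: mult.assoc exp_add[symmetric] algebra_simps)
      finally show "(\<lambda>n. \<Sum>i<n. u i x) \<longlonglongrightarrow> of_real (f x) * exp (- s * of_real (\<phi> x))"
        by (simp add: sums_def)
    qed
    show "AE x in M. norm (\<Sum>i<n. u i x) \<le> norm (f x * exp (- c * \<phi> x))" for n
      using bnd by (intro AE_I2) (rule order_trans[OF norm_sum])
  qed (use int in auto)
  also have "(\<lambda>n. \<integral>x. (\<Sum>i<n. u i x) \<partial>M) = (\<lambda>n. \<Sum>i<n. \<integral>x. u i x \<partial>M)"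
    using int_u by (simp add: Bochner_Integration.integral_sum)
  finally have "(\<lambda>n. \<integral>x. u n x \<partial>M) sums laplace M \<phi> f s" by (simp add: sums_def)
  then show ?thesis unfolding u_def by simp
qed

lemma holomorphic_laplace:
  assumes "f \<in> borel_measurable M" "\<phi> \<in> borel_measurable M"
    and "\<And>x. x \<in> space M \<Longrightarrow> \<phi> x \<ge> 0"
    and int: "\<And>c. c > a \<Longrightarrow> integrable M (\<lambda>x. f x * exp (- c * \<phi> x))"
  shows "laplace M \<phi> f holomorphic_on {s. Re s > a}"
proof -
  have "laplace M \<phi> f holomorphic_on ball s0 ((Re s0 - a) / 2)" if "Re s0 > a" for s0
  proof (rule power_series_holomorphic)
    fix s assume s: "s \<in> ball s0 ((Re s0 - a) / 2)"
    show "(\<lambda>n. (\<integral>x. of_real (f x * (- \<phi> x) ^ n / fact n) * exp (- s0 * of_real (\<phi> x)) \<partial>M) * (s - s0) ^ n)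
           sums laplace M \<phi> f s"
      using laplace_power_series[OF assms(1-3) int, of "(Re s0 + a) / 2" s s0] that s
      by (simp add: dist_norm norm_minus_commute field_simps)
  qed
  then have "laplace M \<phi> f field_differentiable at s0" if "Re s0 > a" for s0
    using that by (auto intro!: holomorphic_on_imp_differentiable_at[of _ "ball s0 ((Re s0 - a) / 2)"])
  then show ?thesis
    by (auto simp: holomorphic_on_def intro: field_differentiable_at_within)
qed

lemma integrable_laplace_mono:
  fixes f \<phi> :: "'a \<Rightarrow> real"
  assumes [measurable]: "f \<in> borel_measurable M" "\<phi> \<in> borel_measurable M"
    and "\<And>x. x \<in> space M \<Longrightarrow> \<phi> x \<ge> 0"
    and int: "integrable M (\<lambda>x. f x * exp (- c * \<phi> x))" and "c \<le> d"
  shows "integrable M (\<lambda>x. f x * exp (- d * \<phi> x))"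
proof (rule Bochner_Integration.integrable_bound[OF int])
  show "AE x in M. norm (f x * exp (- d * \<phi> x)) \<le> norm (f x * exp (- c * \<phi> x))"
    using assms(3,5) by (intro AE_I2) (simp add: abs_mult mult_left_mono mult_right_mono)
qed measurable

text \<open>Writing \<open>exp (- s \<phi>)\<close> as
  \<open>exp (- c0 \<phi>) exp ((c0 - s) \<phi>)\<close> expands the integral at \<open>s\<close>
  into nonnegative terms. They are the terms of the Taylor series of \<open>H\<close> at
  \<open>c0\<close>, which converges as far left as the disc of holomorphy reaches.\<close>

lemma integrable_laplace_extend:
  assumes [measurable]: "f \<in> borel_measurable M" "\<phi> \<in> borel_measurable M"
    and nonneg: "\<And>x. x \<in> space M \<Longrightarrow> \<phi> x \<ge> 0" "\<And>x. x \<in> space M \<Longrightarrow> f x \<ge> 0"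
    and int: "integrable M (\<lambda>x. f x * exp (- c * \<phi> x))" and "c < c0"
    and H: "H holomorphic_on ball (of_real c0) r" "0 < e"
      "\<And>s. norm (s - of_real c0) < e \<Longrightarrow> H s = laplace M \<phi> f s"
    and s: "s < c0" "c0 - r < s"
  shows "integrable M (\<lambda>x. f x * exp (- s * \<phi> x))"
proof -
  let ?g = "\<lambda>n x. ennreal (f x * (\<phi> x) ^ n / fact n * exp (- c0 * \<phi> x) * (c0 - s) ^ n)"
  let ?h = "\<lambda>n x. f x * (\<phi> x) ^ n / fact n * exp (- c0 * \<phi> x)"
  define b :: "nat \<Rightarrow> real" where "b n = (\<integral>x. ?h n x \<partial>M)" for n
  define a :: "nat \<Rightarrow> complex" where "a = (\<lambda>n. \<integral>x. of_real (f x * (- \<phi> x) ^ n / fact n) * exp (- of_real c0 * of_real (\<phi> x)) \<partial>M)"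
  have a: "(\<lambda>n. a n * (z - of_real c0) ^ n) sums laplace M \<phi> f z" if "norm (z - of_real c0) \<le> c0 - c" for z
    unfolding a_def by (rule laplace_power_series[OF assms(1-3) int]) (use that in auto)
  have Hs: "(\<lambda>n. (deriv ^^ n) H (of_real c0) / fact n * (z - of_real c0) ^ n) sums H z" if "norm (z - of_real c0) < r" for z
    by (rule holomorphic_power_series[OF H(1)]) (use that in \<open>auto simp: dist_norm norm_minus_commute\<close>)
  have "r > 0" using s by simp
  have aH: "(\<lambda>n. a n * (z - of_real c0) ^ n) sums H z" if "norm (z - of_real c0) < min r (min e (c0 - c))" for z
    
  proof -
    have "H z = laplace M \<phi> f z" by (rule H(3)) (use that in linarith)
    then show ?thesis using a[of z] that by simp
  qed
  \<comment> \<open>\<open>H\<close> and the transform are known to agree only near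
    \<open>c0\<close>; equality of the coefficients carries the convergence over to the whole disc
    of \<open>H\<close>.\<close>
  have a_deriv: "a = (\<lambda>n. (deriv ^^ n) H (of_real c0) / fact n)"
  proof (rule powser_coeffs_unique[where r = "min r (min e (c0 - c))" and z = "of_real c0" and f = H])
    show "(\<lambda>n. a n * (z - of_real c0) ^ n) sums H z"
      if "norm (z - of_real c0) < min r (min e (c0 - c))" for z
      using that by (rule aH)
    show "0 < min r (min e (c0 - c))" using \<open>r > 0\<close> H(2) \<open>c < c0\<close> by simp
    show "(\<lambda>n. (deriv ^^ n) H (of_real c0) / fact n * (z - of_real c0) ^ n) sums H z"
      if "norm (z - of_real c0) < min r (min e (c0 - c))" for z
      by (rule Hs) (use that in simp)
  qed
  have "norm (complex_of_real s - of_real c0) < r"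
    using s by (simp flip: of_real_diff)
  then have "(\<lambda>n. a n * (of_real s - of_real c0) ^ n) sums H (of_real s)"
    unfolding a_deriv by (rule Hs)
  then have "summable (\<lambda>n. a n * (of_real s - of_real c0) ^ n)" by (rule sums_summable)
  \<comment> \<open>The sign from \<open>(- \<phi> x) ^ n\<close> cancels the sign of
    \<open>(s - c0) ^ n\<close>, which leaves a series of nonnegative terms.\<close>
  moreover have a_eq: "a n * (of_real s - of_real c0) ^ n = of_real (b n * (c0 - s) ^ n)" for n
  proof -
    have "a n = (\<integral>x. of_real ((-1) ^ n * (?h n x)) \<partial>M)"
      unfolding a_def
    proof (intro Bochner_Integration.integral_cong refl)
      fix x
      have 1: "(- \<phi> x) ^ n = (-1) ^ n * (\<phi> x) ^ n" by (rule power_minus)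
      show "complex_of_real (f x * (- \<phi> x) ^ n / fact n) * exp (- of_real c0 * of_real (\<phi> x)) =
          of_real ((-1) ^ n * (?h n x))"
        unfolding 1 by (simp add: exp_of_real flip: of_real_mult of_real_minus)
    qed
    also have "\<dots> = of_real ((-1) ^ n * b n)"
      unfolding integral_complex_of_real b_def by simp
    finally have "a n * (of_real s - of_real c0) ^ n = of_real ((-1) ^ n * b n * (s - c0) ^ n)"
      by simp
    also have "(-1) ^ n * b n * (s - c0) ^ n = b n * (c0 - s) ^ n"
      by (simp flip: power_mult_distrib)
    finally show ?thesis .
  qed
  ultimately have sb: "summable (\<lambda>n. b n * (c0 - s) ^ n)"
    unfolding a_eq by (simp only: summable_of_real_iff)
  \<comment> \<open>One term of the exponential series is at most its sum, so the factor
    \<open>\<phi> ^ n\<close> costs no more than moving the exponent from \<open>c0\<close> to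
    \<open>c\<close>.\<close>
  have int_b: "integrable M (\<lambda>x. ?h n x)" for n
  proof (rule Bochner_Integration.integrable_bound)
    show "integrable M (\<lambda>x. f x * exp (- c * \<phi> x) / (c0 - c) ^ n)" using int by simp
    show "AE x in M. norm (?h n x) \<le> norm (f x * exp (- c * \<phi> x) / (c0 - c) ^ n)"
    proof (rule AE_I2)
      fix x assume x: "x \<in> space M"
      have "((c0 - c) * \<phi> x) ^ n /\<^sub>R fact n = (\<Sum>i\<in>{n}. ((c0 - c) * \<phi> x) ^ i /\<^sub>R fact i)" by simp
      also have "\<dots> \<le> exp ((c0 - c) * \<phi> x)"
        unfolding exp_def using nonneg[OF x] \<open>c < c0\<close>
        by (intro sum_le_suminf summable_exp_generic) auto
      finally have "(\<phi> x) ^ n / fact n \<le> exp ((c0 - c) * \<phi> x) / (c0 - c) ^ n"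
        using \<open>c < c0\<close> unfolding power_mult_distrib by (simp add: divide_simps mult_ac)
      then have "(\<phi> x) ^ n / fact n * exp (- c0 * \<phi> x) \<le> exp ((c0 - c) * \<phi> x) / (c0 - c) ^ n * exp (- c0 * \<phi> x)"
        by (rule mult_right_mono) simp
      also have "\<dots> = exp (- c * \<phi> x) / (c0 - c) ^ n"
        by (simp add: exp_add[symmetric] algebra_simps)
      finally have "f x * ((\<phi> x) ^ n / fact n * exp (- c0 * \<phi> x)) \<le> f x * (exp (- c * \<phi> x) / (c0 - c) ^ n)"
        by (rule mult_left_mono) (use nonneg[OF x] in simp)
      then show "norm (?h n x) \<le> norm (f x * exp (- c * \<phi> x) / (c0 - c) ^ n)"
        using nonneg[OF x] \<open>c < c0\<close> by simp
    qed
  qed measurable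
  have "(\<integral>\<^sup>+x. f x * exp (- s * \<phi> x) \<partial>M) = (\<integral>\<^sup>+x. (\<Sum>n. ?g n x) \<partial>M)"
  proof (rule nn_integral_cong)
    fix x assume x: "x \<in> space M"
    have "(\<lambda>n. f x * exp (- c0 * \<phi> x) * (((c0 - s) * \<phi> x) ^ n /\<^sub>R fact n)) sums (f x * exp (- c0 * \<phi> x) * exp ((c0 - s) * \<phi> x))"
      by (intro sums_mult exp_converges)
    also have "f x * exp (- c0 * \<phi> x) * exp ((c0 - s) * \<phi> x) = f x * exp (- s * \<phi> x)"
      by (simp add: mult.assoc exp_add[symmetric] algebra_simps)
    finally have *: "(\<lambda>n. ?h n x * (c0 - s) ^ n) sums (f x * exp (- s * \<phi> x))"
      unfolding power_mult_distrib by (simp add: divide_inverse mult_ac)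
    show "ennreal (f x * exp (- s * \<phi> x)) = (\<Sum>n. ?g n x)"
      using nonneg[OF x] s by (subst suminf_ennreal_eq[OF _ *]) auto
  qed
  also have "\<dots> = (\<Sum>n. \<integral>\<^sup>+x. ?g n x \<partial>M)"
    by (rule nn_integral_suminf) measurable
  also have "\<dots> = (\<Sum>n. ennreal (b n * (c0 - s) ^ n))"
  proof (rule arg_cong[of _ _ suminf], rule ext)
    fix n
    show "(\<integral>\<^sup>+x. ?g n x \<partial>M) = ennreal (b n * (c0 - s) ^ n)"
      unfolding b_def using integrable_mult_left[OF int_b[of n], of "(c0 - s) ^ n"] nonneg s
      by (subst nn_integral_eq_integral) auto
  qed
  also have "\<dots> < \<infinity>"
  proof -
    have "b n \<ge> 0" for n unfolding b_def using nonneg by (intro integral_nonneg_AE AE_I2) auto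
    then show ?thesis using sb s by (subst suminf_ennreal2) auto
  qed
  finally show ?thesis
    by (intro integrableI_nonneg AE_I2) (use nonneg in auto)
qed

text \<open>The identity theorem needs an accumulation point, and identities are first established
  on real half-lines only.\<close>

lemma of_real_islimpt_greaterThan: "of_real (b + 1) islimpt (of_real ` {b<..} :: complex set)"
proof (rule islimpt_isCont_image)
  show "(b + 1) islimpt {b<..}" by (rule interior_limit_point) (simp add: interior_open)
  show "\<forall>\<^sub>F y in at (b + 1). complex_of_real y \<noteq> of_real (b + 1)"
    unfolding of_real_eq_iff eventually_at_filter by simp
qed (intro continuous_intros)

text \<open>If the abscissa of convergence were larger than \<open>a\<close>, then the Taylor series of \<open>H\<close> around a point
  slightly to the right of it would converge slightly to the left of it, and so would the integral,
  whose terms are nonnegative.\<close>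

theorem landau_laplace:
  assumes meas: "f \<in> borel_measurable M" "\<phi> \<in> borel_measurable M"
    and nonneg: "\<And>x. x \<in> space M \<Longrightarrow> \<phi> x \<ge> 0" "\<And>x. x \<in> space M \<Longrightarrow> f x \<ge> 0"
    and int: "\<And>c. c > c1 \<Longrightarrow> integrable M (\<lambda>x. f x * exp (- c * \<phi> x))"
    and H: "H holomorphic_on U" "open U" "\<And>x. x > a \<Longrightarrow> of_real x \<in> U"
      "\<And>x. x > c1 \<Longrightarrow> H (of_real x) = laplace M \<phi> f (of_real x)"
    and "c > a"
  shows "integrable M (\<lambda>x. f x * exp (- c * \<phi> x))"
proof (rule ccontr)
  assume nint: "\<not> integrable M (\<lambda>x. f x * exp (- c * \<phi> x))"
  define T where "T = {t. t > a \<and> integrable M (\<lambda>x. f x * exp (- t * \<phi> x))}"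
  define \<sigma> where "\<sigma> = Inf T"
  have Tne: "max a c1 + 1 \<in> T" unfolding T_def using int[of "max a c1 + 1"] by (auto simp: algebra_simps)
  have lb: "t \<ge> c" if "t \<in> T" for t
  proof (rule ccontr)
    assume "\<not> c \<le> t"
    then show False
      using integrable_laplace_mono[OF meas nonneg(1), of t c] that nint by (auto simp: T_def)
  qed
  have "\<sigma> \<ge> c" unfolding \<sigma>_def using Tne lb by (intro cInf_greatest) auto
  have T: "integrable M (\<lambda>x. f x * exp (- t * \<phi> x))" if t: "t > \<sigma>" for t
  proof -
    obtain t' where "t' \<in> T" "t' < t"
      using cInf_lessD[of T t] Tne t unfolding \<sigma>_def by auto
    then show ?thesis
      using integrable_laplace_mono[OF meas nonneg(1), of t' t] by (auto simp: T_def)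
  qed
  have below: False if "integrable M (\<lambda>x. f x * exp (- t * \<phi> x))" "t < \<sigma>" "t > a" for t
  proof -
    have "t \<in> T" using that by (auto simp: T_def)
    then have "\<sigma> \<le> t" unfolding \<sigma>_def using lb by (intro cInf_lower bdd_belowI[of _ c]) auto
    with that show False by simp
  qed
  have Lhol: "laplace M \<phi> f holomorphic_on {s. Re s > \<sigma>}"
    by (rule holomorphic_laplace[OF meas nonneg(1)]) (use T in auto)
  define R :: "complex set" where "R = of_real ` {\<sigma><..}"
  define W where "W = U \<inter> {s. Re s > \<sigma>}"
  \<comment> \<open>\<open>U\<close> is arbitrary apart from containing the real ray, so the
    identity theorem is applied on the component of \<open>W\<close> that contains the ray.\<close>
  define V where "V = connected_component_set W (of_real (max \<sigma> c1 + 1))"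
  have "open W" unfolding W_def using \<open>open U\<close> by (intro open_Int open_halfspace_Re_gt) auto
  then have "open V" unfolding V_def by (rule open_connected_component)
  have "V \<subseteq> W" unfolding V_def by (rule connected_component_subset)
  have "R \<subseteq> V" unfolding V_def
  proof (rule connected_component_maximal)
    show "R \<subseteq> W" using H(3) \<open>\<sigma> \<ge> c\<close> \<open>c > a\<close> by (auto simp: R_def W_def)
    show "connected R" unfolding R_def
      by (intro connected_continuous_image continuous_intros) auto
    show "of_real (max \<sigma> c1 + 1) \<in> R" unfolding R_def by (intro imageI) simp
  qed
  have eq: "H z = laplace M \<phi> f z" if "z \<in> V" for z
  proof -
    have "H z - laplace M \<phi> f z = 0"
    proof (rule analytic_continuation[of "\<lambda>z. H z - laplace M \<phi> f z" V "of_real ` {max \<sigma> c1<..}" "of_real (max \<sigma> c1 + 1)"])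
      show "(\<lambda>z. H z - laplace M \<phi> f z) holomorphic_on V"
        using H(1) Lhol \<open>V \<subseteq> W\<close>
        by (intro holomorphic_intros; elim holomorphic_on_subset) (auto simp: W_def)
      show "connected V" unfolding V_def by simp
      show "of_real ` {max \<sigma> c1<..} \<subseteq> V" using \<open>R \<subseteq> V\<close> by (auto simp: R_def)
      show "of_real (max \<sigma> c1 + 1) \<in> V" using \<open>R \<subseteq> V\<close> unfolding R_def by (rule subsetD) (intro imageI, simp)
      show "(of_real (max \<sigma> c1 + 1) :: complex) islimpt of_real ` {max \<sigma> c1<..}"
        by (rule of_real_islimpt_greaterThan)
    qed (use H(4) \<open>open V\<close> that in auto)
    then show ?thesis by simp
  qed
  have "of_real \<sigma> \<in> U" using H(3) \<open>\<sigma> \<ge> c\<close> \<open>c > a\<close> by simp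
  then obtain r0 where r0: "r0 > 0" "ball (of_real \<sigma>) r0 \<subseteq> U"
    using \<open>open U\<close> by (meson openE)
  define r where "r = min r0 (\<sigma> - a)"
  have r: "r > 0" "ball (of_real \<sigma>) r \<subseteq> U" "\<sigma> - r \<ge> a"
    using r0 \<open>\<sigma> \<ge> c\<close> \<open>c > a\<close> by (auto simp: r_def)
  \<comment> \<open>The disc of radius \<open>r / 2\<close> about this point stays inside the disc
    of radius \<open>r\<close> about \<open>\<sigma>\<close> and reaches down to
    \<open>\<sigma> - r / 4\<close>. It therefore contains \<open>\<sigma> - r / 8\<close>, where
    integrability contradicts the choice of \<open>\<sigma>\<close>.\<close>
  define c0 where "c0 = \<sigma> + r / 4"
  have "c0 > \<sigma>" using r by (simp add: c0_def)
  then have "of_real c0 \<in> V" using \<open>R \<subseteq> V\<close> unfolding R_def by blast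
  then obtain e where e: "e > 0" "ball (of_real c0) e \<subseteq> V"
    using \<open>open V\<close> by (meson openE)
  have sub: "ball (of_real c0) (r / 2) \<subseteq> ball (of_real \<sigma> :: complex) r"
  proof
    fix z assume "z \<in> ball (complex_of_real c0) (r / 2)"
    moreover have "dist (complex_of_real \<sigma>) z \<le> dist (complex_of_real \<sigma>) (of_real c0) + dist (of_real c0) z"
      by (rule dist_triangle)
    moreover have "dist (complex_of_real \<sigma>) (of_real c0) = r / 4"
      using r by (simp add: dist_norm c0_def)
    ultimately show "z \<in> ball (of_real \<sigma>) r" using r by simp
  qed
  have "integrable M (\<lambda>x. f x * exp (- (\<sigma> - r / 8) * \<phi> x))"
  proof (rule integrable_laplace_extend[OF meas nonneg, where c = "\<sigma> + r / 8" and ?c0.0 = c0 and H = H and r = "r / 2" and e = e])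
    show "H holomorphic_on ball (of_real c0) (r / 2)"
      using H(1) sub r(2) by (meson holomorphic_on_subset order_trans)
    show "H s = laplace M \<phi> f s" if "norm (s - of_real c0) < e" for s
      using e(2) that by (intro eq) (auto simp: dist_norm norm_minus_commute subset_iff)
    show "integrable M (\<lambda>x. f x * exp (- (\<sigma> + r / 8) * \<phi> x))" by (rule T) (use r in simp)
  qed (use r(1) e(1) in \<open>simp_all add: c0_def\<close>)
  with below[of "\<sigma> - r / 8"] r show False by simp
qed

subsection \<open>The transformation law of the theta function\<close>

text \<open>Jacobi's theta function is \<open>1 + 2 * theta_tail x\<close>; without the term of
  index 0 the sum decays exponentially.\<close>

definition theta_tail :: "real \<Rightarrow> real" where
  "theta_tail x = (\<Sum>n. exp (- pi * (real (Suc n))\<^sup>2 * x))"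

lemma exp_square_le_geometric:
  assumes "x > 0"
  shows "exp (- pi * (real (Suc n))\<^sup>2 * x) \<le> exp (- pi * x) ^ Suc n"
proof -
  have "real (Suc n) * 1 \<le> real (Suc n) * real (Suc n)" by (intro mult_left_mono) auto
  then have "pi * x * real (Suc n) \<le> pi * x * (real (Suc n))\<^sup>2"
    using assms by (intro mult_left_mono) (auto simp: power2_eq_square)
  then show ?thesis by (simp only: exp_of_nat_mult[symmetric] exp_le_cancel_iff) (simp add: algebra_simps)
qed

lemma summable_theta_geometric: "x > 0 \<Longrightarrow> summable (\<lambda>n. exp (- pi * x) ^ Suc n)"
  unfolding summable_Suc_iff by (intro summable_geometric) auto

lemma summable_theta_tail: "x > 0 \<Longrightarrow> summable (\<lambda>n. exp (- pi * (real (Suc n))\<^sup>2 * x))"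
  by (rule summable_comparison_test'[OF summable_theta_geometric[of x], of 0])
     (use exp_square_le_geometric[of x] in auto)

text \<open>This is the real part of the characteristic function of the standard normal
  distribution. The scale \<open>c\<close> is such that the density at \<open>c * u\<close> is a
  multiple of \<open>exp (- pi * x * u\<^sup>2)\<close>.\<close>

lemma gaussian_cosine_integral:
  assumes "x > 0"
  shows "has_bochner_integral lborel (\<lambda>u. exp (- pi * x * u\<^sup>2) * cos (2 * pi * j * u))
           (exp (- pi * j\<^sup>2 / x) / sqrt x)"
proof -
  define c where "c = sqrt (2 * pi * x)"
  have c: "c > 0" using assms by (simp add: c_def)
  have c2: "c\<^sup>2 = 2 * pi * x" using assms by (simp add: c_def)
  define t where "t = 2 * pi * j / c"
  have int_d: "integrable lborel std_normal_density" using integrable_normal_density by simp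
  have int: "complex_integrable lborel (\<lambda>y. std_normal_density y *\<^sub>R iexp (t * y))"
    by (rule Bochner_Integration.integrable_bound[OF int_d]) (auto simp: norm_mult)
  have "(\<integral>y. std_normal_density y *\<^sub>R iexp (t * y) \<partial>lborel) = char std_normal_distribution t"
    unfolding char_def by (subst integral_density) (auto simp: normal_density_nonneg)
  also have "\<dots> = complex_of_real (exp (- (t^2) / 2))" by (simp add: char_std_normal_distribution)
  finally have "has_bochner_integral lborel (\<lambda>y. std_normal_density y *\<^sub>R iexp (t * y)) (complex_of_real (exp (- (t^2) / 2)))"
    using int by (simp add: has_bochner_integral_iff)
  from has_bochner_integral_bounded_linear[OF bounded_linear_Re this]
  have "has_bochner_integral lborel (\<lambda>y. std_normal_density y * cos (t * y)) (exp (- (t^2) / 2))"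
    by (simp add: Re_exp)
  then have "has_bochner_integral lborel (\<lambda>u. std_normal_density (0 + c * u) * cos (t * (0 + c * u))) (exp (- (t^2) / 2) /\<^sub>R \<bar>c\<bar>)"
    by (subst (asm) lborel_has_bochner_integral_real_affine_iff[where c = c and t = 0]) (use c in auto)
  then have "has_bochner_integral lborel (\<lambda>u. sqrt (2 * pi) * (std_normal_density (0 + c * u) * cos (t * (0 + c * u))))
      (sqrt (2 * pi) * (exp (- (t^2) / 2) /\<^sub>R \<bar>c\<bar>))"
    by (rule has_bochner_integral_mult_right) 
  also have "(\<lambda>u. sqrt (2 * pi) * (std_normal_density (0 + c * u) * cos (t * (0 + c * u)))) =
      (\<lambda>u. exp (- pi * x * u\<^sup>2) * cos (2 * pi * j * u))"
    using c c2 by (auto simp: std_normal_density_def t_def power_mult_distrib fun_eq_iff mult.assoc)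
  also have "sqrt (2 * pi) * (exp (- (t^2) / 2) /\<^sub>R \<bar>c\<bar>) = exp (- pi * j\<^sup>2 / x) / sqrt x"
  proof -
    have "t\<^sup>2 / 2 = pi * j\<^sup>2 / x"
      using c c2 assms by (simp add: t_def power_divide power_mult_distrib power2_eq_square)
    then show ?thesis using c by (simp add: c_def real_sqrt_mult field_simps)
  qed
  finally show ?thesis .
qed

text \<open>Write the cosine by exponentials and expand binomially: the term of index
  \<open>m\<close> has frequency \<open>2 * m - 2 * N\<close>, and the indices \<open>N + j\<close>
  and \<open>N - j\<close> combine to a cosine.\<close>

lemma cos_power_expansion:
  "cos u ^ (2 * N) = (real (2 * N choose N) + 2 * (\<Sum>j=1..N. real (2 * N choose (N + j)) * cos (2 * real j * u))) / 4 ^ N"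
proof -
  let ?U = "{N} \<union> ((\<lambda>j. N + j) ` {1..N} \<union> (\<lambda>j. N - j) ` {1..N})"
  let ?C = "\<Sum>j=1..N. real (2 * N choose (N + j)) * cos (2 * real j * u)"
  have "complex_of_real (cos u) = (exp (\<i> * u) + exp (- (\<i> * u))) / 2"
    by (simp add: cos_of_real[symmetric] cos_exp_eq)
  then have "complex_of_real (cos u ^ (2 * N)) = (exp (\<i> * u) + exp (- (\<i> * u))) ^ (2 * N) / 4 ^ N"
    unfolding of_real_power by (simp only: power_divide) (simp add: power_mult[of 2])
  also have "(exp (\<i> * u) + exp (- (\<i> * u))) ^ (2 * N) =
      (\<Sum>m\<le>2*N. of_nat (2 * N choose m) * exp (\<i> * u) ^ m * exp (- (\<i> * u)) ^ (2 * N - m))"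
    by (rule binomial_ring)
  also have "\<dots> = (\<Sum>m\<le>2*N. of_nat (2 * N choose m) * exp (\<i> * of_real ((2 * real m - 2 * real N) * u)))"
  proof (rule sum.cong)
    fix m assume "m \<in> {..2 * N}"
    then have "exp (\<i> * u) ^ m * exp (- (\<i> * u)) ^ (2 * N - m) = exp (\<i> * of_real ((2 * real m - 2 * real N) * u))"
      by (simp add: exp_of_nat_mult[symmetric] exp_add[symmetric] of_nat_diff algebra_simps)
    then show "of_nat (2 * N choose m) * exp (\<i> * u) ^ m * exp (- (\<i> * u)) ^ (2 * N - m) =
      of_nat (2 * N choose m) * exp (\<i> * of_real ((2 * real m - 2 * real N) * u))" by (simp add: mult.assoc)
  qed simp
  finally have "cos u ^ (2 * N) = Re ((\<Sum>m\<le>2*N. of_nat (2 * N choose m) * exp (\<i> * of_real ((2 * real m - 2 * real N) * u))) / 4 ^ N)"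
    by (metis Re_complex_of_real)
  also have "\<dots> = (\<Sum>m\<le>2*N. real (2 * N choose m) * cos ((2 * real m - 2 * real N) * u)) / 4 ^ N"
  proof -
    have "Re (z / 4 ^ N) = Re z / 4 ^ N" for z
      by (metis Re_divide_of_real of_real_numeral of_real_power)
    then show ?thesis by (simp add: Re_exp)
  qed
  also have "(\<Sum>m\<le>2*N. real (2 * N choose m) * cos ((2 * real m - 2 * real N) * u)) =
      (\<Sum>m\<in>?U. real (2 * N choose m) * cos ((2 * real m - 2 * real N) * u))"
  proof (rule sum.cong)
    show "{..2 * N} = ?U"
    proof (intro equalityI subsetI)
      fix m assume m: "m \<in> {..2 * N}"
      consider "m = N" | "m > N" | "m < N" by linarith
      then show "m \<in> ?U"
      proof cases
        case 2 then show ?thesis using m by (intro UnI2 UnI1 image_eqI[of _ _ "m - N"]) auto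
      next
        case 3 then show ?thesis by (intro UnI2 UnI2 image_eqI[of _ _ "N - m"]) auto
      qed auto
    qed auto
  qed simp
  also have "\<dots> = real (2 * N choose N) + (?C +
       (\<Sum>j=1..N. real (2 * N choose (N - j)) * cos ((2 * real (N - j) - 2 * real N) * u)))"
    by (subst sum.union_disjoint; (subst sum.union_disjoint)?; (subst sum.reindex)?; (subst sum.reindex)?)
       (auto simp: inj_on_def algebra_simps)
  also have "(\<Sum>j=1..N. real (2 * N choose (N - j)) * cos ((2 * real (N - j) - 2 * real N) * u)) =
      ?C"
  proof (rule sum.cong)
    fix j assume j: "j \<in> {1..N}"
    have "(2 * N choose (N - j)) = (2 * N choose (2 * N - (N - j)))"
      by (rule binomial_symmetric) simp
    also have "2 * N - (N - j) = N + j" using j by simp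
    finally have 1: "(2 * N choose (N - j)) = (2 * N choose (N + j))" .
    have "cos ((2 * real (N - j) - 2 * real N) * u) = cos (- (2 * real j * u))"
      using j by (intro arg_cong[of _ _ cos]) (simp add: of_nat_diff algebra_simps)
    then show "real (2 * N choose (N - j)) * cos ((2 * real (N - j) - 2 * real N) * u) =
        real (2 * N choose (N + j)) * cos (2 * real j * u)" unfolding 1 by simp
  qed simp
  finally show ?thesis by simp
qed

text \<open>The probability of exactly \<open>N\<close> heads in \<open>2 * N\<close> tosses of a
  fair coin. It is also the mean of \<open>cos (pi * u) ^ (2 * N)\<close> over a period, hence its
  use as a normalising constant.\<close>

definition central_prob :: "nat \<Rightarrow> real" where
  "central_prob N = real (2 * N choose N) / 4 ^ N"

text \<open>The central coefficient is the largest of \<open>2 * N + 1\<close> coefficients with sum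
  \<open>4 ^ N\<close>. This crude bound is enough because it only competes with geometric
  decay.\<close>

lemma central_prob_lower: "1 / (2 * real N + 1) \<le> central_prob N"
proof -
  have "(2::nat) ^ (2 * N) = (\<Sum>m\<le>2 * N. 2 * N choose m)" by (rule choose_row_sum[symmetric])
  also have "\<dots> \<le> (\<Sum>m\<le>2 * N. 2 * N choose N)"
    by (intro sum_mono binomial_maximum')
  finally have "real (2 ^ (2 * N)) \<le> real ((2 * N + 1) * (2 * N choose N))"
    by (subst of_nat_le_iff) simp
  then have "4 ^ N \<le> (2 * real N + 1) * real (2 * N choose N)"
    using power_mult[of "2::real" 2 N] by (simp add: algebra_simps)
  then show ?thesis by (simp add: central_prob_def divide_simps mult.commute)
qed

lemma central_prob_pos: "central_prob N > 0"
  by (rule less_le_trans[OF _ central_prob_lower]) (simp add: add_nonneg_pos)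

definition cos_kernel :: "nat \<Rightarrow> real \<Rightarrow> real" where
  "cos_kernel N u = cos (pi * u) ^ (2 * N) / central_prob N"

text \<open>The Fourier coefficients of \<open>cos_kernel N\<close>: 1 at index 0, and 0 for
  \<open>j > N\<close>.\<close>

definition binom_ratio :: "nat \<Rightarrow> nat \<Rightarrow> real" where
  "binom_ratio N j = real (2 * N choose (N + j)) / real (2 * N choose N)"

lemma binom_ratio_bounds: "0 \<le> binom_ratio N j" "binom_ratio N j \<le> 1"
  using binomial_maximum'[of N "N + j"] by (auto simp: binom_ratio_def divide_le_eq_1)

lemma binom_ratio_Suc:
  assumes "j < N"
  shows "binom_ratio N (Suc j) = binom_ratio N j * ((real N - real j) / (real N + real j + 1))"
proof -
  have "Suc (N + j) * (2 * N choose Suc (N + j)) = (2 * N - (N + j)) * (2 * N choose (N + j))"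
    by (metis add.commute binomial_absorb_comp binomial_absorption mult.commute)
  then have "real (Suc (N + j)) * real (2 * N choose Suc (N + j)) = real (2 * N - (N + j)) * real (2 * N choose (N + j))"
    by (metis of_nat_mult)
  then have "real (2 * N choose (N + Suc j)) = real (2 * N choose (N + j)) * ((real N - real j) / (real N + real j + 1))"
    using assms by (simp add: of_nat_diff field_simps)
  then show ?thesis by (simp add: binom_ratio_def)
qed

lemma binom_ratio_tendsto: "(\<lambda>N. binom_ratio N j) \<longlonglongrightarrow> 1"
proof (induction j)
  case 0
  show ?case by (simp add: binom_ratio_def)
next
  case (Suc j)
  have "(\<lambda>N. (real N - real j) / (real N + real j + 1)) \<longlonglongrightarrow> 1" by real_asymp
  from tendsto_mult[OF Suc this]
  have "(\<lambda>N. binom_ratio N j * ((real N - real j) / (real N + real j + 1))) \<longlonglongrightarrow> 1" by simp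
  moreover have "\<forall>\<^sub>F N in sequentially. binom_ratio N j * ((real N - real j) / (real N + real j + 1)) = binom_ratio N (Suc j)"
    using eventually_gt_at_top[of j] by eventually_elim (simp add: binom_ratio_Suc)
  ultimately show ?case by (rule Lim_transform_eventually)
qed

lemma cos_kernel_expansion:
  "cos_kernel N u = 1 + 2 * (\<Sum>j=1..N. binom_ratio N j * cos (2 * pi * real j * u))"
proof -
  have "cos_kernel N u = (real (2 * N choose N) + 2 * (\<Sum>j=1..N. real (2 * N choose (N + j)) * cos (2 * real j * (pi * u)))) / real (2 * N choose N)"
    unfolding cos_kernel_def cos_power_expansion central_prob_def by simp
  also have "\<dots> = 1 + 2 * (\<Sum>j=1..N. binom_ratio N j * cos (2 * pi * real j * u))"
    by (simp add: add_divide_distrib binom_ratio_def mult_ac) (simp only: sum_divide_distrib[symmetric] times_divide_eq_right)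
  finally show ?thesis .
qed

text \<open>First evaluation of the kernel integral, termwise from the cosine expansion. The sum
  runs over all \<open>j\<close>, the coefficients being 0 beyond \<open>N\<close>, so that its
  limit can be taken by domination.\<close>

lemma gaussian_kernel_integral:
  assumes "x > 0"
  shows "has_bochner_integral lborel (\<lambda>u. exp (- pi * x * u\<^sup>2) * cos_kernel N u)
     ((1 + 2 * (\<Sum>j. binom_ratio N (Suc j) * exp (- pi * (real (Suc j))\<^sup>2 / x))) / sqrt x)"
proof -
  have 1: "has_bochner_integral lborel (\<lambda>u. exp (- pi * x * u\<^sup>2) * cos (2 * pi * real j * u))
           (exp (- pi * (real j)\<^sup>2 / x) / sqrt x)" for j
    by (rule gaussian_cosine_integral[OF assms])
  have "has_bochner_integral lborel (\<lambda>u. exp (- pi * x * u\<^sup>2) * cos (2 * pi * real 0 * u) +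
       (\<Sum>j=1..N. (2 * binom_ratio N j) * (exp (- pi * x * u\<^sup>2) * cos (2 * pi * real j * u))))
     (exp (- pi * (real 0)\<^sup>2 / x) / sqrt x + (\<Sum>j=1..N. (2 * binom_ratio N j) * (exp (- pi * (real j)\<^sup>2 / x) / sqrt x)))"
    by (intro has_bochner_integral_add has_bochner_integral_sum has_bochner_integral_mult_right 1)
  also have "(\<lambda>u. exp (- pi * x * u\<^sup>2) * cos (2 * pi * real 0 * u) +
       (\<Sum>j=1..N. (2 * binom_ratio N j) * (exp (- pi * x * u\<^sup>2) * cos (2 * pi * real j * u)))) =
       (\<lambda>u. exp (- pi * x * u\<^sup>2) * cos_kernel N u)"
    unfolding cos_kernel_expansion by (simp add: algebra_simps sum_distrib_left fun_eq_iff)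
  also have "(\<Sum>j=1..N. (2 * binom_ratio N j) * (exp (- pi * (real j)\<^sup>2 / x) / sqrt x)) =
      (\<Sum>j<N. (2 * binom_ratio N (Suc j)) * (exp (- pi * (real (Suc j))\<^sup>2 / x) / sqrt x))"
    by (rule sum.reindex_bij_witness[of _ Suc "\<lambda>j. j - 1"]) auto
  also have "\<dots> = (\<Sum>j. (2 * binom_ratio N (Suc j)) * (exp (- pi * (real (Suc j))\<^sup>2 / x) / sqrt x))"
    by (rule suminf_finite[symmetric]) (auto simp: binom_ratio_def binomial_eq_0)
  also have "\<dots> = (\<Sum>j. 2 / sqrt x * (binom_ratio N (Suc j) * exp (- pi * (real (Suc j))\<^sup>2 / x)))"
    by (simp add: mult_ac)
  also have "\<dots> = 2 / sqrt x * (\<Sum>j. binom_ratio N (Suc j) * exp (- pi * (real (Suc j))\<^sup>2 / x))"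
    by (rule suminf_mult, rule summable_finite[of "{..<N}"]) (auto simp: binom_ratio_def binomial_eq_0)
  finally show ?thesis by (simp add: add_divide_distrib)
qed

lemma binomial_side_tendsto:
  assumes "x > 0"
  shows "(\<lambda>N. \<Sum>j. binom_ratio N (Suc j) * exp (- pi * (real (Suc j))\<^sup>2 / x)) \<longlonglongrightarrow> theta_tail (1 / x)"
proof -
  have "(\<lambda>N. \<Sum>j. binom_ratio N (Suc j) * exp (- pi * (real (Suc j))\<^sup>2 / x)) \<longlonglongrightarrow> (\<Sum>j. exp (- pi * (real (Suc j))\<^sup>2 / x))"
  proof (rule tannerys_theorem[THEN conjunct2, THEN conjunct2])
    show "(\<lambda>N. binom_ratio N (Suc j) * exp (- pi * (real (Suc j))\<^sup>2 / x)) \<longlonglongrightarrow> exp (- pi * (real (Suc j))\<^sup>2 / x)" for j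
      using tendsto_mult[OF binom_ratio_tendsto[of "Suc j"] tendsto_const] by simp
    show "\<forall>\<^sub>F (j, N) in at_top \<times>\<^sub>F sequentially. norm (binom_ratio N (Suc j) * exp (- pi * (real (Suc j))\<^sup>2 / x)) \<le> exp (- pi * (real (Suc j))\<^sup>2 / x)"
      by (intro always_eventually) (auto simp: abs_mult mult_le_cancel_right1 binom_ratio_bounds)
    show "summable (\<lambda>j. exp (- pi * (real (Suc j))\<^sup>2 / x))"
      using summable_theta_tail[of "1 / x"] assms by simp
  qed simp
  then show ?thesis by (simp add: theta_tail_def)
qed

section \<open>The kernel as a periodic approximate identity\<close>

lemma cos_kernel_nonneg: "cos_kernel N u \<ge> 0"
  using central_prob_pos[of N] by (simp add: cos_kernel_def)

lemma cos_kernel_shift: "cos_kernel N (u + real n) = cos_kernel N u"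
proof -
  have "cos (pi * (u + real n)) = cos (pi * u) * (-1) ^ n"
    by (simp add: distrib_left cos_add cos_npi sin_npi mult.commute[of pi "real n"])
  moreover have "((- 1) ^ n)\<^sup>2 = (1::real)" using power_even_eq[of "- 1::real" n] by simp
  ultimately show ?thesis by (simp add: cos_kernel_def power_mult_distrib power_mult)
qed

lemma cos_kernel_even: "cos_kernel N (- u) = cos_kernel N u"
  by (simp add: cos_kernel_def)

lemma continuous_cos_kernel: "continuous_on A (cos_kernel N)"
  unfolding cos_kernel_def by (intro continuous_intros) (use central_prob_pos[of N] in auto)

lemma measurable_cos_kernel [measurable]: "cos_kernel N \<in> borel_measurable borel"
  by (intro borel_measurable_continuous_onI continuous_cos_kernel)

lemma cos_kernel_integral: "has_bochner_integral lborel (\<lambda>u. indicator {-1/2..1/2} u * cos_kernel N u) 1"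
proof -
  have 1: "((\<lambda>u. cos (2 * pi * real j * u)) has_integral 0) {-1/2..1/2}" if "j \<ge> 1" for j
  proof -
    have "((\<lambda>u. cos (2 * pi * real j * u)) has_integral
        (sin (2 * pi * real j * (1/2)) / (2 * pi * real j) - sin (2 * pi * real j * (-1/2)) / (2 * pi * real j))) {-1/2..1/2}"
      by (rule fundamental_theorem_of_calculus)
         (use that in \<open>auto intro!: derivative_eq_intros simp: has_real_derivative_iff_has_vector_derivative[symmetric]\<close>)
    also have "(sin (2 * pi * real j * (1/2)) / (2 * pi * real j) - sin (2 * pi * real j * (-1/2)) / (2 * pi * real j)) = 0"
      by (simp add: sin_npi2)
    finally show ?thesis .
  qed
  have "((\<lambda>u. 1 + 2 * (\<Sum>j=1..N. binom_ratio N j * cos (2 * pi * real j * u))) has_integral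
      (1 + 2 * (\<Sum>j=1..N. binom_ratio N j * 0))) {-1/2..1/2}"
    using has_integral_const_real[of "1::real" "-1/2" "1/2"]
    by (intro has_integral_add has_integral_mult_right has_integral_sum) (auto intro: 1[simplified])
  then have "(cos_kernel N has_integral 1) {-1/2..1/2}"
    by (simp add: cos_kernel_expansion[abs_def])
  moreover have "integrable lborel (\<lambda>u. indicator {-1/2..1/2} u *\<^sub>R cos_kernel N u)"
    by (rule borel_integrable_compact) (auto intro: continuous_cos_kernel)
  ultimately have "(\<integral>u. indicator {-1/2..1/2} u *\<^sub>R cos_kernel N u \<partial>lborel) = 1"
    using set_borel_integral_eq_integral(2)[of "{-1/2..1/2}" "cos_kernel N"] integral_unique
    unfolding set_integrable_def set_lebesgue_integral_def by metis
  with \<open>integrable _ _\<close> show ?thesis by (simp add: has_bochner_integral_iff)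
qed

text \<open>At distance at least \<open>\<delta>\<close> from the integers the cosine is at most
  \<open>cos (pi * \<delta>)\<close> in modulus. The geometric decay outweighs the factor
  \<open>2 * N + 1\<close> lost to \<open>central_prob_lower\<close>.\<close>

lemma cos_kernel_small:
  assumes "0 < \<delta>" "\<delta> \<le> \<bar>v\<bar>" "\<bar>v\<bar> \<le> 1/2"
  shows "cos_kernel N v \<le> (2 * real N + 1) * cos (pi * \<delta>) ^ (2 * N)"
proof -
  have "cos (pi * v) = cos (pi * \<bar>v\<bar>)" by (cases "v \<ge> 0") auto
  moreover have "0 \<le> cos (pi * \<bar>v\<bar>)"
    by (rule cos_ge_zero) (use assms mult_left_mono[of "\<bar>v\<bar>" "1/2" pi] mult_nonneg_nonneg[of pi "\<bar>v\<bar>"] pi_gt_zero in linarith)+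
  moreover have "cos (pi * \<bar>v\<bar>) \<le> cos (pi * \<delta>)" using assms by (intro cos_monotone_0_pi_le) auto
  ultimately have 1: "cos (pi * v) ^ (2 * N) \<le> cos (pi * \<delta>) ^ (2 * N)" by (simp add: power_mono)
  have "1 / central_prob N \<le> 2 * real N + 1"
    using central_prob_lower[of N] central_prob_pos[of N] by (simp add: field_simps)
  then have "(1 / central_prob N) * cos (pi * v) ^ (2 * N) \<le> (2 * real N + 1) * cos (pi * \<delta>) ^ (2 * N)"
    using 1 by (intro mult_mono) (auto simp: zero_le_power_eq)
  then show ?thesis by (simp add: cos_kernel_def)
qed

lemma cos_kernel_approximate_identity:
  fixes f :: "real \<Rightarrow> real"
  assumes cont: "isCont f 0" and [measurable]: "f \<in> borel_measurable borel" and bnd: "\<And>v. \<bar>f v\<bar> \<le> B"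
  shows "(\<lambda>N. \<integral>v. indicator {-1/2..1/2} v * cos_kernel N v * f v \<partial>lborel) \<longlonglongrightarrow> f 0"
proof (rule LIMSEQ_I)
  let ?I = "\<lambda>N. \<integral>v. indicator {-1/2..1/2} v * cos_kernel N v * f v \<partial>lborel"
  fix e :: real assume e: "e > 0"
  have "B \<ge> 0" using bnd[of 0] by simp
  have "\<exists>d>0. \<forall>v. dist v 0 < d \<longrightarrow> dist (f v) (f 0) < e / 2"
    using cont e unfolding continuous_at_eps_delta by (meson half_gt_zero)
  then obtain \<delta>0 where \<delta>0: "\<delta>0 > 0" "\<And>v. \<bar>v\<bar> < \<delta>0 \<Longrightarrow> \<bar>f v - f 0\<bar> < e / 2"
    unfolding dist_real_def diff_0_right by metis
  \<comment> \<open>The cap at 1/2 keeps \<open>pi * \<delta>\<close> in the range where the cosine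
    is nonnegative.\<close>
  define \<delta> where "\<delta> = min \<delta>0 (1/2)"
  have \<delta>: "0 < \<delta>" "\<delta> \<le> 1/2" "\<delta> \<le> \<delta>0" using \<delta>0(1) by (auto simp: \<delta>_def)
  define q where "q = (cos (pi * \<delta>))\<^sup>2"
  have "0 \<le> cos (pi * \<delta>)"
    by (rule cos_ge_zero) (use \<delta> mult_left_mono[of \<delta> "1/2" pi] mult_pos_pos[of pi \<delta>] pi_gt_zero in linarith)+
  moreover have "cos (pi * \<delta>) < cos 0"
    by (rule cos_monotone_0_pi) (use \<delta> in auto)
  ultimately have q: "0 \<le> q" "q < 1" by (auto simp: q_def abs_square_less_1)
  have "(\<lambda>N. 2 * B * ((2 * real N + 1) * q ^ N)) \<longlonglongrightarrow> 2 * B * 0"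
  proof (intro tendsto_mult tendsto_const)
    have "(\<lambda>N. 2 * (real N * q ^ N) + q ^ N) \<longlonglongrightarrow> 2 * 0 + 0"
      using q by (intro tendsto_add tendsto_mult tendsto_const powser_times_n_limit_0 LIMSEQ_power_zero) auto
    then show "(\<lambda>N. (2 * real N + 1) * q ^ N) \<longlonglongrightarrow> 0" by (simp add: algebra_simps)
  qed
  then have "\<forall>\<^sub>F N in sequentially. 2 * B * ((2 * real N + 1) * q ^ N) < e / 2"
    by (rule order_tendstoD(2)) (use e in simp)
  then obtain N0 where N0: "\<And>N. N \<ge> N0 \<Longrightarrow> 2 * B * ((2 * real N + 1) * q ^ N) < e / 2"
    unfolding eventually_sequentially by blast
  have "norm (?I N - f 0) < e" if N: "N \<ge> N0" for N
  proof -
    define k where "k = (\<lambda>v. indicator {-1/2..1/2} v * cos_kernel N v)"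
    define c where "c = 2 * B * ((2 * real N + 1) * q ^ N)"
    have k: "has_bochner_integral lborel k 1" unfolding k_def by (rule cos_kernel_integral)
    then have ki: "integrable lborel k" "(\<integral>v. k v \<partial>lborel) = 1" by (auto simp: has_bochner_integral_iff)
    have k0: "k v \<ge> 0" for v by (auto simp: k_def cos_kernel_nonneg)
    have [measurable]: "k \<in> borel_measurable borel" using borel_measurable_integrable[OF ki(1)] by simp
    have ki2: "integrable lborel (\<lambda>v. k v * f v)"
    proof (rule Bochner_Integration.integrable_bound)
      show "integrable lborel (\<lambda>v. k v * B)" using ki by simp
      show "AE v in lborel. norm (k v * f v) \<le> norm (k v * B)"
        using bnd k0 \<open>B \<ge> 0\<close> by (intro AE_I2) (auto simp: abs_mult intro!: mult_left_mono)
    qed measurable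
    have "(\<integral>v. k v * f v \<partial>lborel) - f 0 = (\<integral>v. k v * f v \<partial>lborel) - (\<integral>v. k v * f 0 \<partial>lborel)"
      using ki by simp
    also have "\<dots> = (\<integral>v. k v * (f v - f 0) \<partial>lborel)"
      using ki ki2 by (subst Bochner_Integration.integral_diff[symmetric]) (auto simp: algebra_simps)
    finally have "\<bar>(\<integral>v. k v * f v \<partial>lborel) - f 0\<bar> \<le> (\<integral>v. \<bar>k v * (f v - f 0)\<bar> \<partial>lborel)"
      using integral_abs_bound by metis
    \<comment> \<open>Within distance \<open>\<delta>\<close> of 0 the difference
      \<open>f v - f 0\<close> is small and the kernel has mass 1; beyond it the kernel is small and
      the difference is at most \<open>2 * B\<close>.\<close>
    also have "\<dots> \<le> (\<integral>v. k v * (e / 2) + c * indicator {-1/2..1/2} v \<partial>lborel)"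
    proof (rule integral_mono)
      have "integrable lborel (\<lambda>v. k v * f v - k v * f 0)"
        using ki ki2 by (intro Bochner_Integration.integrable_diff integrable_mult_left) auto
      then show "integrable lborel (\<lambda>v. \<bar>k v * (f v - f 0)\<bar>)"
        by (simp add: algebra_simps)
      show "integrable lborel (\<lambda>v. k v * (e / 2) + c * indicator {-1/2..1/2} v)"
        using ki by (intro Bochner_Integration.integrable_add integrable_mult_left integrable_mult_right) auto
      fix v :: real
      consider "\<bar>v\<bar> < \<delta>" | "\<delta> \<le> \<bar>v\<bar>" "\<bar>v\<bar> \<le> 1/2" | "\<bar>v\<bar> > 1/2" by linarith
      then show "\<bar>k v * (f v - f 0)\<bar> \<le> k v * (e / 2) + c * indicator {-1/2..1/2} v"
      proof cases
        case 1
        then have "\<bar>k v * (f v - f 0)\<bar> \<le> k v * (e / 2)"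
          using \<delta>0(2)[of v] \<delta> k0[of v] mult_left_mono[of "\<bar>f v - f 0\<bar>" "e / 2" "k v"] by (simp add: abs_mult)
        moreover have "c * indicator {-1/2..1/2} v \<ge> 0"
          using q \<open>B \<ge> 0\<close> by (auto simp: c_def)
        ultimately show ?thesis by linarith
      next
        case 2
        have "k v \<le> (2 * real N + 1) * q ^ N"
        proof -
          have "v \<in> {-1/2..1/2}" using 2(2) by (auto simp: abs_le_iff)
          then have "k v = cos_kernel N v" unfolding k_def by simp
          also have "\<dots> \<le> (2 * real N + 1) * cos (pi * \<delta>) ^ (2 * N)" by (rule cos_kernel_small[OF \<delta>(1) 2])
          finally show ?thesis by (simp add: q_def power_mult)
        qed
        moreover have "\<bar>f v - f 0\<bar> \<le> 2 * B" using bnd[of v] bnd[of 0] by linarith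
        ultimately have "k v * \<bar>f v - f 0\<bar> \<le> ((2 * real N + 1) * q ^ N) * (2 * B)"
          using k0 q by (intro mult_mono) auto
        moreover have "v \<in> {-1/2..1/2}" using 2(2) by (auto simp: abs_le_iff)
        moreover have "k v * (e / 2) \<ge> 0" using k0 e by simp
        ultimately show ?thesis using k0[of v] by (simp add: abs_mult c_def mult_ac)
      next
        case 3
        then have "v \<notin> {-1/2..1/2}" by (auto simp: abs_if split: if_splits)
        then show ?thesis by (simp add: k_def del: atLeastAtMost_iff)
      qed
    qed
    also have "\<dots> = e / 2 + c"
      using ki by (subst Bochner_Integration.integral_add) auto
    also have "\<dots> < e" using N0[OF N] by (simp add: c_def)
    finally show ?thesis by (simp add: k_def)
  qed
  then show "\<exists>no. \<forall>N\<ge>no. norm (?I N - f 0) < e"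
    by blast
qed

text \<open>The line is cut at the half-integers: the pieces right of 1/2 are translated to the
  central interval, and those left of -1/2 are their mirror images, whence the factor 2. With
  nonnegative integrals no integrability has to be shown.\<close>

lemma nn_integral_even_unfold:
  fixes h :: "real \<Rightarrow> ennreal"
  assumes [measurable]: "h \<in> borel_measurable borel" and even: "\<And>u. h (- u) = h u"
  shows "(\<integral>\<^sup>+u. h u \<partial>lborel) = (\<integral>\<^sup>+u. h u * indicator {-1/2..1/2} u \<partial>lborel) +
     2 * (\<Sum>n. \<integral>\<^sup>+v. h (v + real (Suc n)) * indicator {-1/2..1/2} v \<partial>lborel)"
proof -
  let ?W = "\<lambda>n. \<integral>\<^sup>+v. h (v + real (Suc n)) * indicator {-1/2..1/2} v \<partial>lborel"
  let ?R = "\<integral>\<^sup>+u. h u * indicator {1/2<..} u \<partial>lborel"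
  let ?L = "\<integral>\<^sup>+u. h u * indicator {..<-1/2} u \<partial>lborel"
  define A where "A n = {real n + 1/2<..real n + 3/2}" for n :: nat
  have "disjoint_family A"
  unfolding disjoint_family_on_def
  proof (intro ballI impI)
    fix m n :: nat assume "m \<noteq> n"
    then consider "real m + 1 \<le> real n" | "real n + 1 \<le> real m" by linarith
    then show "A m \<inter> A n = {}" by cases (auto simp: A_def)
  qed
  moreover have "(\<Union>n. A n) = {1/2<..}"
  proof (intro equalityI subsetI)
    fix u :: real assume u: "u \<in> {1/2<..}"
    \<comment> \<open>The least \<open>n\<close> with \<open>u \<le> n + 3/2\<close>; for
      \<open>u \<le> 3/2\<close> the ceiling is at most 0 and \<open>nat\<close> returns 0.\<close>
    define n where "n = nat \<lceil>u - 3/2\<rceil>"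
    have "u - 3/2 \<le> real n" unfolding n_def by linarith
    moreover have "real n < u - 1/2" unfolding n_def using u by (auto simp: nat_less_real_le) linarith
    ultimately show "u \<in> (\<Union>n. A n)" by (auto simp: A_def intro!: exI[of _ n])
  qed (auto simp: A_def)
  ultimately have ind: "(\<Sum>n. indicator (A n) u) = (indicator {1/2<..} u :: ennreal)" for u
    by (metis suminf_indicator)
  have shift: "(\<integral>\<^sup>+u. h u * indicator (A n) u \<partial>lborel) = ?W n" for n
  proof -
    have "(\<integral>\<^sup>+u. h u * indicator (A n) u \<partial>lborel) = (\<integral>\<^sup>+v. h (real (Suc n) + 1 * v) * indicator (A n) (real (Suc n) + 1 * v) \<partial>lborel)"
      by (subst nn_integral_real_affine[where c = 1 and t = "real (Suc n)"]) (auto simp: A_def)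
    also have "\<dots> = ?W n"
    \<comment> \<open>The translate of \<open>A n\<close> is open at -1/2 and the window is closed
      there, so the integrands may differ at that one point.\<close>
    proof (rule nn_integral_cong_AE)
      show "AE v in lborel. h (real (Suc n) + 1 * v) * indicator (A n) (real (Suc n) + 1 * v) =
          h (v + real (Suc n)) * indicator {-1/2..1/2} v"
        using AE_lborel_singleton[of "-1/2::real"]
        by eventually_elim (auto simp: A_def indicator_def add_ac)
    qed
    finally show ?thesis .
  qed
  have right: "?R = (\<Sum>n. \<integral>\<^sup>+v. h (v + real (Suc n)) * indicator {-1/2..1/2} v \<partial>lborel)"
    unfolding ind[symmetric] ennreal_suminf_cmult[symmetric] shift[symmetric]
    by (rule nn_integral_suminf) (auto simp: A_def)
  have left: "?L = ?R"
  proof -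
    have "?L = (\<integral>\<^sup>+u. h (0 + (-1) * u) * indicator {..<-1/2} (0 + (-1) * u) \<partial>lborel)"
      by (subst nn_integral_real_affine[where c = "-1" and t = 0]) auto
    also have "\<dots> = ?R"
      by (rule nn_integral_cong) (auto simp: even indicator_def)
    finally show ?thesis .
  qed
  have "(\<integral>\<^sup>+u. h u \<partial>lborel) = (\<integral>\<^sup>+u. h u * indicator {-1/2..1/2} u + (h u * indicator {..<-1/2} u + h u * indicator {1/2<..} u) \<partial>lborel)"
    by (rule nn_integral_cong) (auto simp: indicator_def)
  also have "\<dots> = (\<integral>\<^sup>+u. h u * indicator {-1/2..1/2} u \<partial>lborel) + (?L + ?R)"
    by (subst nn_integral_add; (subst nn_integral_add)?) auto
  finally show ?thesis unfolding left right by (simp add: mult_2)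
qed

text \<open>The share of the unit interval around \<open>n\<close> in the kernel integral of the
  Gaussian. The kernel has period 1 and appears unshifted; as \<open>N\<close> grows its mass
  gathers at \<open>v = 0\<close>, which picks out the value at \<open>n\<close>.\<close>

definition window :: "real \<Rightarrow> nat \<Rightarrow> nat \<Rightarrow> real" where
  "window x N n = (\<integral>v. indicator {-1/2..1/2} v * cos_kernel N v * exp (- pi * x * (v + real n)\<^sup>2) \<partial>lborel)"

lemma window_tendsto:
  assumes "x > 0"
  shows "(\<lambda>N. window x N n) \<longlonglongrightarrow> exp (- pi * (real n)\<^sup>2 * x)"
proof -
  have "(\<lambda>N. \<integral>v. indicator {-1/2..1/2} v * cos_kernel N v * exp (- pi * x * (v + real n)\<^sup>2) \<partial>lborel) \<longlonglongrightarrow> exp (- pi * x * (0 + real n)\<^sup>2)"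
  proof (rule cos_kernel_approximate_identity[where B = 1])
    show "isCont (\<lambda>v. exp (- pi * x * (v + real n)\<^sup>2)) 0" by (intro continuous_intros)
    show "\<bar>exp (- pi * x * (v + real n)\<^sup>2)\<bar> \<le> 1" for v using assms by simp
  qed measurable
  then show ?thesis by (simp add: window_def mult_ac)
qed

lemma window_integrable:
  assumes "x > 0"
  shows "integrable lborel (\<lambda>v. indicator {-1/2..1/2} v * cos_kernel N v * exp (- pi * x * (v + real n)\<^sup>2))"
proof (rule Bochner_Integration.integrable_bound)
  show "integrable lborel (\<lambda>u. indicator {-1/2..1/2} u * cos_kernel N u)"
    using cos_kernel_integral by (simp add: has_bochner_integral_iff)
  show "AE v in lborel. norm (indicator {-1/2..1/2} v * cos_kernel N v * exp (- pi * x * (v + real n)\<^sup>2))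
      \<le> norm (indicator {-1/2..1/2} v * cos_kernel N v)"
    using assms by (intro AE_I2) (auto simp: abs_mult mult_left_le)
qed measurable

lemma window_nonneg: "window x N n \<ge> 0"
  unfolding window_def by (intro integral_nonneg_AE AE_I2) (auto simp: cos_kernel_nonneg)

text \<open>Over the window around \<open>n + 1\<close> the argument is at least
  \<open>n + 1/2\<close>, whose square is at least \<open>n\<close>, and the kernel has mass 1. The
  bound does not involve \<open>N\<close>, as domination requires.\<close>

lemma window_le:
  assumes "x > 0"
  shows "window x N (Suc n) \<le> exp (- pi * x) ^ n"
proof -
  have "window x N (Suc n) \<le> (\<integral>v. (indicator {-1/2..1/2} v * cos_kernel N v) * exp (- pi * x) ^ n \<partial>lborel)"
    unfolding window_def
  proof (rule integral_mono)
    show "integrable lborel (\<lambda>v. (indicator {-1/2..1/2} v * cos_kernel N v) * exp (- pi * x) ^ n)"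
      using cos_kernel_integral by (intro integrable_mult_left) (simp add: has_bochner_integral_iff)
    fix v :: real
    show "indicator {-1/2..1/2} v * cos_kernel N v * exp (- pi * x * (v + real (Suc n))\<^sup>2) \<le> indicator {-1/2..1/2} v * cos_kernel N v * exp (- pi * x) ^ n"
    proof (cases "v \<in> {-1/2..1/2}")
      case True
      then have "real n + 1/2 \<le> v + real (Suc n)" by simp
      then have "(real n + 1/2)\<^sup>2 \<le> (v + real (Suc n))\<^sup>2" by (rule power_mono) simp
      moreover have "real n \<le> (real n + 1/2)\<^sup>2" by (simp add: power2_eq_square algebra_simps)
      ultimately have "pi * x * real n \<le> pi * x * (v + real (Suc n))\<^sup>2"
        using assms by (intro mult_left_mono) auto
      then have "exp (- pi * x * (v + real (Suc n))\<^sup>2) \<le> exp (- pi * x) ^ n"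
        by (simp only: exp_of_nat_mult[symmetric] exp_le_cancel_iff) (simp add: algebra_simps)
      then show ?thesis by (intro mult_left_mono mult_nonneg_nonneg cos_kernel_nonneg) auto
    qed auto
  qed (rule window_integrable[OF assms])
  also have "\<dots> = exp (- pi * x) ^ n"
    using cos_kernel_integral[of N] by (simp add: has_bochner_integral_iff)
  finally show ?thesis .
qed

text \<open>Second evaluation of the same kernel integral, by unfolding it into windows. The
  comparison takes place in the extended nonnegative reals and is pulled back at the end, both sides
  being nonnegative.\<close>

lemma gaussian_kernel_integral_windows:
  assumes "x > 0"
  shows "(1 + 2 * (\<Sum>j. binom_ratio N (Suc j) * exp (- pi * (real (Suc j))\<^sup>2 / x))) / sqrt x =
     window x N 0 + 2 * (\<Sum>n. window x N (Suc n))" (is "?L = ?R")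
proof -
  let ?W = "\<lambda>n. \<integral>\<^sup>+v. ennreal (exp (- pi * x * (v + real n)\<^sup>2) * cos_kernel N (v + real n)) * indicator {-1/2..1/2} v \<partial>lborel"
  have nn: "?W n = ennreal (window x N n)" for n
  proof -
    have "?W n =
      (\<integral>\<^sup>+v. ennreal (indicator {-1/2..1/2} v * cos_kernel N v * exp (- pi * x * (v + real n)\<^sup>2)) \<partial>lborel)"
      by (rule nn_integral_cong) (auto simp: cos_kernel_shift indicator_def mult_ac)
    also have "\<dots> = ennreal (window x N n)" unfolding window_def
      by (rule nn_integral_eq_integral[OF window_integrable[OF assms]]) (auto simp: cos_kernel_nonneg)
    finally show ?thesis .
  qed
  have sm: "summable (\<lambda>n. window x N (Suc n))"
  proof (rule summable_comparison_test'[of "\<lambda>n. exp (- pi * x) ^ n" 0])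
    show "summable (\<lambda>n. exp (- pi * x) ^ n)" using assms by (intro summable_geometric) auto
  qed (use window_le[OF assms] window_nonneg in auto)
  have R0: "?R \<ge> 0" using window_nonneg suminf_nonneg[OF sm] by (intro add_nonneg_nonneg) auto
  have L0: "?L \<ge> 0"
  proof -
    have "?L = (\<integral>u. exp (- pi * x * u\<^sup>2) * cos_kernel N u \<partial>lborel)"
      using gaussian_kernel_integral[OF assms] by (simp add: has_bochner_integral_iff)
    also have "\<dots> \<ge> 0" by (intro integral_nonneg_AE AE_I2) (auto simp: cos_kernel_nonneg)
    finally show ?thesis .
  qed
  have "ennreal ?L = (\<integral>\<^sup>+u. exp (- pi * x * u\<^sup>2) * cos_kernel N u \<partial>lborel)"
    using gaussian_kernel_integral[OF assms, of N] cos_kernel_nonneg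
    by (subst nn_integral_eq_integral) (auto simp: has_bochner_integral_iff)
  also have "\<dots> = (\<integral>\<^sup>+u. ennreal (exp (- pi * x * u\<^sup>2) * cos_kernel N u) * indicator {-1/2..1/2} u \<partial>lborel) +
     2 * (\<Sum>n. \<integral>\<^sup>+v. ennreal (exp (- pi * x * (v + real (Suc n))\<^sup>2) * cos_kernel N (v + real (Suc n))) * indicator {-1/2..1/2} v \<partial>lborel)"
    by (rule nn_integral_even_unfold) (auto simp: cos_kernel_even)
  also have "\<dots> = ennreal (window x N 0) + 2 * (\<Sum>n. ennreal (window x N (Suc n)))"
    unfolding nn using nn[of 0] by (simp only: of_nat_0 add_0_right)
  also have "\<dots> = ennreal ?R"
    using window_nonneg sm suminf_nonneg[OF sm]
    by (subst suminf_ennreal2) (auto simp: ennreal_plus ennreal_mult simp flip: ennreal_numeral)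
  finally show ?thesis using L0 R0 by simp
qed

text \<open>As \<open>N\<close> grows, the Fourier evaluation tends to the left side and the window
  evaluation to the right side; summable bounds independent of \<open>N\<close> dominate
  both.\<close>

theorem theta_inversion:
  assumes "x > 0"
  shows "(1 + 2 * theta_tail (1 / x)) / sqrt x = 1 + 2 * theta_tail x"
proof (rule LIMSEQ_unique)
  show "(\<lambda>N. (1 + 2 * (\<Sum>j. binom_ratio N (Suc j) * exp (- pi * (real (Suc j))\<^sup>2 / x))) / sqrt x) \<longlonglongrightarrow> (1 + 2 * theta_tail (1 / x)) / sqrt x"
    using assms by (intro tendsto_intros binomial_side_tendsto) auto
  have "(\<lambda>N. \<Sum>n. window x N (Suc n)) \<longlonglongrightarrow> (\<Sum>n. exp (- pi * (real (Suc n))\<^sup>2 * x))"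
  proof (rule tannerys_theorem[THEN conjunct2, THEN conjunct2])
    show "(\<lambda>N. window x N (Suc n)) \<longlonglongrightarrow> exp (- pi * (real (Suc n))\<^sup>2 * x)" for n
      by (rule window_tendsto[OF assms])
    show "\<forall>\<^sub>F (n, N) in at_top \<times>\<^sub>F sequentially. norm (window x N (Suc n)) \<le> exp (- pi * x) ^ n"
      using window_le[OF assms] window_nonneg by (intro always_eventually) auto
    show "summable (\<lambda>n. exp (- pi * x) ^ n)" using assms by (intro summable_geometric) auto
  qed simp
  then have "(\<lambda>N. window x N 0 + 2 * (\<Sum>n. window x N (Suc n))) \<longlonglongrightarrow> exp (- pi * (real 0)\<^sup>2 * x) + 2 * theta_tail x"
    unfolding theta_tail_def by (intro tendsto_intros window_tendsto[OF assms])
  then show "(\<lambda>N. (1 + 2 * (\<Sum>j. binom_ratio N (Suc j) * exp (- pi * (real (Suc j))\<^sup>2 / x))) / sqrt x) \<longlonglongrightarrow> 1 + 2 * theta_tail x"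
    unfolding gaussian_kernel_integral_windows[OF assms] by simp
qed

subsection \<open>The completed zeta function\<close>

text \<open>Cut off at 1 because the lemmas on \<open>laplace\<close> ask for a nonnegative exponent
  on the whole space; the functions transformed with it vanish below 1.\<close>

definition lnp :: "real \<Rightarrow> real" where
  "lnp x = ln (max 1 x)"

lemma lnp_nonneg: "lnp x \<ge> 0"
  by (simp add: lnp_def)

lemma measurable_lnp [measurable]: "lnp \<in> borel_measurable borel"
  unfolding lnp_def by measurable

lemma exp_lnp: "x \<ge> 1 \<Longrightarrow> exp (c * lnp x) = x powr c"
  by (simp add: lnp_def powr_def max_def)

lemma measurable_theta_tail [measurable]: "theta_tail \<in> borel_measurable borel"
  unfolding theta_tail_def[abs_def] by measurable

lemma theta_tail_nonneg: "x > 0 \<Longrightarrow> theta_tail x \<ge> 0"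
  unfolding theta_tail_def by (intro suminf_nonneg summable_theta_tail) auto

lemma theta_tail_le:
  assumes "x \<ge> 1"
  shows "theta_tail x \<le> 2 * exp (- pi * x)"
proof -
  have "pi * x \<ge> 1 * 1" using assms pi_gt3 by (intro mult_mono) auto
  then have "0 < pi * x" "2 \<le> exp (pi * x)" using exp_ge_add_one_self[of "pi * x"] by linarith+
  then have q: "exp (- pi * x) \<le> 1 / 2"
    by (simp add: exp_minus divide_simps)
  have "theta_tail x \<le> (\<Sum>n. exp (- pi * x) ^ Suc n)"
    unfolding theta_tail_def using assms
    by (intro suminf_le exp_square_le_geometric summable_theta_tail summable_theta_geometric) auto
  also have "\<dots> = exp (- pi * x) * (1 / (1 - exp (- pi * x)))"
    using assms by (simp add: suminf_mult suminf_geometric)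
  also have "\<dots> \<le> exp (- pi * x) * 2"
    using q \<open>0 < pi * x\<close> divide_left_mono[of "1 / 2" "1 - exp (- pi * x)" 1] by (intro mult_left_mono) auto
  finally show ?thesis by simp
qed

lemma power_integral_atLeast:
  fixes a l :: real
  assumes "a > 0" "l > 0"
  shows "has_bochner_integral lborel (\<lambda>x. indicator {l..} x * x powr (- a - 1)) (l powr (- a) / a)"
proof (rule has_bochner_integral_nn_integral)
  have "(\<integral>\<^sup>+x. ennreal (x powr (- a - 1)) * indicator {l..} x \<partial>lborel) = 0 - (- (l powr (- a) / a))"
  proof (rule nn_integral_FTC_atLeast)
    show "DERIV (\<lambda>x. - (x powr (- a) / a)) x :> x powr (- a - 1)" if "l \<le> x" for x
      using assms that by (auto intro!: derivative_eq_intros)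
    show "((\<lambda>x. - (x powr (- a) / a)) \<longlongrightarrow> 0) at_top" using assms by real_asymp
  qed auto
  also have "(\<integral>\<^sup>+x. ennreal (x powr (- a - 1)) * indicator {l..} x \<partial>lborel) = (\<integral>\<^sup>+x. ennreal (indicator {l..} x * x powr (- a - 1)) \<partial>lborel)"
    by (rule nn_integral_cong) (simp add: indicator_def)
  finally show "(\<integral>\<^sup>+x. ennreal (indicator {l..} x * x powr (- a - 1)) \<partial>lborel) = ennreal (l powr (- a) / a)"
    by simp
qed (use assms in auto)

text \<open>With \<open>y = x powr (1 / 3)\<close> one has \<open>m * ln x \<le> 3 * m * y\<close>.
  This is at most \<open>y ^ 3\<close> once \<open>y\<^sup>2 \<ge> 3 * m\<close>, and otherwise at
  most the constant. The constant grows like \<open>m powr (3 / 2)\<close>, and an exponent below 2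
  is what the growth of \<open>xi\<close> needs.\<close>

lemma ln_mult_le:
  fixes x m :: real
  assumes "x \<ge> 1" "m \<ge> 0"
  shows "m * ln x \<le> x + 3 * m * sqrt (3 * m)"
proof -
  define y where "y = x powr (1 / 3)"
  have y: "y \<ge> 1" using assms by (simp add: y_def ge_one_powr_ge_zero)
  have x: "x = y ^ 3" using assms by (simp add: y_def powr_realpow[symmetric] powr_powr)
  have "ln x = 3 * ln y" unfolding x using y by (simp add: ln_realpow)
  also have "\<dots> \<le> 3 * y" using ln_le_minus_one[of y] y by simp
  finally have "m * ln x \<le> m * (3 * y)" using assms by (intro mult_left_mono) auto
  also have "m * (3 * y) \<le> y ^ 3 + 3 * m * sqrt (3 * m)"
  proof (cases "y \<le> sqrt (3 * m)")
    case True
    then have "m * (3 * y) \<le> m * (3 * sqrt (3 * m))" using assms by (intro mult_left_mono) auto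
    moreover have "y ^ 3 \<ge> 0" using y by simp
    ultimately show ?thesis by linarith
  next
    case False
    then have "(sqrt (3 * m))\<^sup>2 \<le> y\<^sup>2" using assms by (intro power_mono) auto
    then have "3 * m * y \<le> y\<^sup>2 * y" using assms y by (intro mult_right_mono) auto
    moreover have "3 * m * sqrt (3 * m) \<ge> 0" using assms by simp
    ultimately show ?thesis by (simp add: power3_eq_cube power2_eq_square)
  qed
  finally show ?thesis by (simp add: x)
qed

definition theta_weight :: "real \<Rightarrow> real" where
  "theta_weight x = indicator {1..} x * theta_tail x / x"

lemma measurable_theta_weight [measurable]: "theta_weight \<in> borel_measurable borel"
  unfolding theta_weight_def by measurable

lemma theta_weight_nonneg: "theta_weight x \<ge> 0"
  unfolding theta_weight_def using theta_tail_nonneg[of x] by (auto simp: indicator_def)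

lemma exp_tail_integral: "has_bochner_integral lborel (\<lambda>x. indicator {1..} x * exp (- x)) (exp (- 1 :: real))"
proof (rule has_bochner_integral_nn_integral)
  have "(\<integral>\<^sup>+x. ennreal (exp (- x)) * indicator {1..} x \<partial>lborel) = 0 - (- exp (- 1 :: real))"
  proof (rule nn_integral_FTC_atLeast)
    show "DERIV (\<lambda>x. - exp (- x)) x :> exp (- x)" for x :: real
      by (auto intro!: derivative_eq_intros)
    show "((\<lambda>x::real. - exp (- x)) \<longlongrightarrow> 0) at_top" by real_asymp
  qed auto
  also have "(\<integral>\<^sup>+x. ennreal (exp (- x)) * indicator {1..} x \<partial>lborel) = (\<integral>\<^sup>+x. ennreal (indicator {1..} x * exp (- x)) \<partial>lborel)"
    by (rule nn_integral_cong) (simp add: indicator_def)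
  finally show "(\<integral>\<^sup>+x. ennreal (indicator {1..} x * exp (- x)) \<partial>lborel) = ennreal (exp (- 1))"
    by simp
qed auto

text \<open>The decay \<open>exp (- 2 * x)\<close> is shared out: one factor
  \<open>exp (- x)\<close> pays for the power of \<open>x\<close> by \<open>ln_mult_le\<close>, the
  other keeps the bound integrable.\<close>

lemma theta_weight_bound:
  assumes "m \<ge> 0" "c \<le> m"
  shows "theta_weight x * exp (c * lnp x) \<le> 2 * exp (3 * m * sqrt (3 * m)) * (indicator {1..} x * exp (- x))"
proof (cases "x \<ge> 1")
  case True
  have "theta_weight x \<le> theta_tail x"
    using True theta_tail_nonneg[of x] by (simp add: theta_weight_def divide_le_eq mult_le_cancel_left1)
  also have "\<dots> \<le> 2 * exp (- pi * x)" by (rule theta_tail_le[OF True])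
  also have "\<dots> \<le> 2 * exp (- 2 * x)" using True pi_gt3 by simp
  finally have 1: "theta_weight x \<le> 2 * exp (- 2 * x)" .
  have "c * lnp x \<le> m * lnp x" using assms lnp_nonneg by (intro mult_right_mono) auto
  also have "\<dots> \<le> x + 3 * m * sqrt (3 * m)" using ln_mult_le[OF True assms(1)] True by (simp add: lnp_def)
  finally have "exp (c * lnp x) \<le> exp (x + 3 * m * sqrt (3 * m))" by simp
  with 1 have "theta_weight x * exp (c * lnp x) \<le> (2 * exp (- 2 * x)) * exp (x + 3 * m * sqrt (3 * m))"
    by (intro mult_mono) auto
  also have "\<dots> = 2 * exp (3 * m * sqrt (3 * m)) * exp (- x)"
    by (simp add: exp_add[symmetric])
  finally show ?thesis using True by simp
qed (simp add: theta_weight_def)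

lemma integrable_theta_weight: "integrable lborel (\<lambda>x. theta_weight x * exp (c * lnp x))"
proof (rule Bochner_Integration.integrable_bound)
  show "integrable lborel (\<lambda>x. 2 * exp (3 * \<bar>c\<bar> * sqrt (3 * \<bar>c\<bar>)) * (indicator {1..} x * exp (- x)))"
    using exp_tail_integral by (intro integrable_mult_right) (simp add: has_bochner_integral_iff)
  show "AE x in lborel. norm (theta_weight x * exp (c * lnp x)) \<le> norm (2 * exp (3 * \<bar>c\<bar> * sqrt (3 * \<bar>c\<bar>)) * (indicator {1..} x * exp (- x)))"
    using theta_weight_bound[of "\<bar>c\<bar>" c] theta_weight_nonneg by (intro AE_I2) (auto simp: abs_mult)
qed measurable

text \<open>The Mellin integral of \<open>theta_tail\<close>, with integrand
  \<open>theta_tail x\<close> times x^(s - 1), over the half-line from 1 only, so that it converges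
  for every \<open>s\<close>.\<close>

definition theta_mellin :: "complex \<Rightarrow> complex" where
  "theta_mellin s = laplace lborel lnp theta_weight (- s)"

lemma holomorphic_theta_mellin: "theta_mellin holomorphic_on UNIV"
proof -
  have "laplace lborel lnp theta_weight holomorphic_on {s. Re s > a}" for a
    by (rule holomorphic_laplace) (auto intro: integrable_theta_weight[of "- _", simplified] lnp_nonneg)
  then have "laplace lborel lnp theta_weight field_differentiable (at s)" for s
    by (rule holomorphic_on_imp_differentiable_at[of _ "{z. Re z > Re s - 1}"]) (auto simp: open_halfspace_Re_gt)
  then have "laplace lborel lnp theta_weight holomorphic_on UNIV"
    by (simp add: holomorphic_on_def)
  then have "(laplace lborel lnp theta_weight \<circ> (\<lambda>s. - s)) holomorphic_on UNIV"
    by (intro holomorphic_on_compose_gen[of _ UNIV _ UNIV] holomorphic_intros) auto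
  then show ?thesis by (simp add: theta_mellin_def[abs_def] o_def)
qed

lemma norm_theta_mellin_le:
  assumes "m \<ge> 0" "Re s \<le> m"
  shows "norm (theta_mellin s) \<le> 2 * exp (3 * m * sqrt (3 * m))"
proof -
  have "norm (theta_mellin s) \<le> (\<integral>x. theta_weight x * exp (Re s * lnp x) \<partial>lborel)"
    unfolding theta_mellin_def laplace_def
    by (rule order_trans[OF integral_norm_bound]) (simp add: norm_mult theta_weight_nonneg)
  also have "\<dots> \<le> (\<integral>x. 2 * exp (3 * m * sqrt (3 * m)) * (indicator {1..} x * exp (- x)) \<partial>lborel)"
    using exp_tail_integral theta_weight_bound[OF assms]
    by (intro integral_mono integrable_theta_weight) (auto simp: has_bochner_integral_iff)
  also have "\<dots> = 2 * exp (3 * m * sqrt (3 * m)) * exp (-1)"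
    using exp_tail_integral by (simp add: has_bochner_integral_iff)
  also have "\<dots> \<le> 2 * exp (3 * m * sqrt (3 * m)) * 1" by (intro mult_left_mono) auto
  finally show ?thesis by simp
qed

definition theta_moment :: "real \<Rightarrow> real" where
  "theta_moment c = (\<integral>x. theta_weight x * exp (c * lnp x) \<partial>lborel)"

lemma theta_moment_integral: "has_bochner_integral lborel (\<lambda>x. theta_weight x * exp (c * lnp x)) (theta_moment c)"
  unfolding theta_moment_def has_bochner_integral_iff using integrable_theta_weight by simp

lemma theta_moment_nonneg: "theta_moment c \<ge> 0"
  unfolding theta_moment_def using theta_weight_nonneg by (intro integral_nonneg_AE AE_I2) auto

lemma theta_mellin_of_real: "theta_mellin (of_real c) = of_real (theta_moment c)"
proof -
  have "complex_of_real (theta_weight x) * exp (- (- of_real c) * of_real (lnp x)) = of_real (theta_weight x * exp (c * lnp x))" for x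
    by (simp add: exp_of_real[symmetric])
  then show ?thesis unfolding theta_mellin_def laplace_def theta_moment_def
    by (simp only: integral_complex_of_real)
qed

text \<open>Twice Riemann's xi, that is, s (s - 1) pi^(-s/2) Gamma(s/2) zeta(s). Written through the
  theta integral it is visibly entire and symmetric under \<open>s \<mapsto> 1 - s\<close>.\<close>

definition xi :: "complex \<Rightarrow> complex" where
  "xi s = 1 + s * (s - 1) * (theta_mellin (s / 2) + theta_mellin ((1 - s) / 2))"

lemma xi_reflect: "xi (1 - s) = xi s"
  by (simp add: xi_def algebra_simps)

lemma holomorphic_xi: "xi holomorphic_on UNIV"
proof -
  have "(theta_mellin \<circ> (\<lambda>s. s / 2)) holomorphic_on UNIV" "(theta_mellin \<circ> (\<lambda>s. (1 - s) / 2)) holomorphic_on UNIV"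
    by (intro holomorphic_on_compose_gen[of _ UNIV _ UNIV] holomorphic_intros holomorphic_theta_mellin; simp)+
  then show ?thesis unfolding xi_def[abs_def] o_def by (intro holomorphic_intros)
qed

section \<open>The Mellin integral of the theta tail over the positive half-line, split at 1\<close>

lemma nn_integral_Gamma_scaled:
  assumes "a > 0" "c > 0"
  shows "(\<integral>\<^sup>+x. ennreal (indicator {0<..} x * (exp (- c * x) * x powr (a - 1))) \<partial>lborel) = ennreal (Gamma a * c powr (- a))"
proof -
  let ?I = "\<integral>\<^sup>+x. ennreal (indicator {0<..} x * (exp (- c * x) * x powr (a - 1))) \<partial>lborel"
  have "ennreal (Gamma a) = (\<integral>\<^sup>+t. ennreal (indicator {0..} t * t powr (a - 1) / exp t) \<partial>lborel)"
    using Gamma_conv_nn_integral_real[OF assms(1)] by simp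
  also have "\<dots> = ennreal \<bar>c\<bar> * (\<integral>\<^sup>+x. ennreal (indicator {0..} (0 + c * x) * (0 + c * x) powr (a - 1) / exp (0 + c * x)) \<partial>lborel)"
    by (rule nn_integral_real_affine) (use assms in auto)
  also have "(\<integral>\<^sup>+x. ennreal (indicator {0..} (0 + c * x) * (0 + c * x) powr (a - 1) / exp (0 + c * x)) \<partial>lborel) =
     (\<integral>\<^sup>+x. ennreal (c powr (a - 1)) * ennreal (indicator {0<..} x * (exp (- c * x) * x powr (a - 1))) \<partial>lborel)"
    using assms by (intro nn_integral_cong)
      (auto simp: indicator_def zero_le_mult_iff powr_mult exp_minus divide_inverse ennreal_mult[symmetric] mult_ac)
  also have "\<dots> = ennreal (c powr (a - 1)) * ?I"
    by (rule nn_integral_cmult) measurable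
  finally have eq: "ennreal (Gamma a) = ennreal (c powr a) * ?I"
    using assms by (simp add: mult.assoc[symmetric] ennreal_mult[symmetric] powr_mult_base)
  have "ennreal (Gamma a * c powr (- a)) = ennreal (c powr (- a)) * ennreal (Gamma a)"
    using assms by (simp add: ennreal_mult[symmetric] Gamma_real_nonneg mult.commute)
  also have "\<dots> = (ennreal (c powr (- a)) * ennreal (c powr a)) * ?I"
    unfolding eq by (simp only: mult.assoc)
  also have "ennreal (c powr (- a)) * ennreal (c powr a) = 1"
    using assms by (simp add: ennreal_mult[symmetric] powr_add[symmetric])
  finally show ?thesis by simp
qed

text \<open>The substitution \<open>x = 1 / u\<close> reverses orientation, so \<open>x\<close> is
  first replaced by \<open>- x\<close>, which makes \<open>u \<mapsto> - (1 / u)\<close> increasing.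
  It is carried out on compact intervals, which exhaust both ranges by monotone convergence.\<close>

lemma nn_integral_inversion:
  fixes f :: "real \<Rightarrow> ennreal"
  assumes [measurable]: "f \<in> borel_measurable borel"
  shows "(\<integral>\<^sup>+x. f x * indicator {0<..1} x \<partial>lborel) = (\<integral>\<^sup>+u. f (1 / u) * ennreal (1 / u\<^sup>2) * indicator {1..} u \<partial>lborel)"
proof (rule LIMSEQ_unique)
  let ?A = "\<lambda>n. \<integral>\<^sup>+x. f x * indicator {1 / real (Suc n)..1} x \<partial>lborel"
  let ?B = "\<lambda>n. \<integral>\<^sup>+u. f (1 / u) * ennreal (1 / u\<^sup>2) * indicator {1..real (Suc n)} u \<partial>lborel"
  have eq: "?A n = ?B n" if "n > 0" for n
  proof -
    have "?A n = (\<integral>\<^sup>+x. f (0 + (-1) * x) * indicator {1 / real (Suc n)..1} (0 + (-1) * x) \<partial>lborel)"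
      by (subst nn_integral_real_affine[where c = "-1" and t = 0]) auto
    also have "\<dots> = (\<integral>\<^sup>+x. f (- x) * indicator {- (1 / 1)..- (1 / real (Suc n))} x \<partial>lborel)"
      by (rule nn_integral_cong) (auto simp: indicator_def)
    also have "\<dots> = (\<integral>\<^sup>+u. f (- (- (1 / u))) * ennreal (1 / u\<^sup>2) * indicator {1..real (Suc n)} u \<partial>lborel)"
    proof (rule nn_integral_substitution_aux)
      show "((\<lambda>u. - (1 / u)) has_real_derivative 1 / u\<^sup>2) (at u)" if "u \<in> {1..real (Suc n)}" for u
        using that by (auto intro!: derivative_eq_intros simp: power2_eq_square)
      show "continuous_on {1..real (Suc n)} (\<lambda>u. 1 / u\<^sup>2)" by (intro continuous_intros) auto
    qed (use that in auto)
    finally show ?thesis by simp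
  qed
  show "(\<lambda>n. \<integral>\<^sup>+x. f x * indicator {1 / real (Suc n)..1} x \<partial>lborel) \<longlonglongrightarrow> (\<integral>\<^sup>+x. f x * indicator {0<..1} x \<partial>lborel)"
  proof (rule nn_integral_LIMSEQ)
    show "incseq (\<lambda>n x. f x * indicator {1 / real (Suc n)..1} x)"
    proof (intro incseq_SucI le_funI mult_left_mono)
      fix n x
      have "1 / real (Suc (Suc n)) \<le> 1 / real (Suc n)" by (intro divide_left_mono) auto
      then show "indicator {1 / real (Suc n)..1} x \<le> (indicator {1 / real (Suc (Suc n))..1} x :: ennreal)"
        by (auto simp: indicator_def)
    qed auto
    fix x :: real
    show "(\<lambda>n. f x * indicator {1 / real (Suc n)..1} x) \<longlonglongrightarrow> f x * indicator {0<..1} x"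
    proof (cases "0 < x \<and> x \<le> 1")
      case True
      then obtain N where N: "1 / real (Suc N) < x" using nat_approx_posE by blast
      show ?thesis
      proof (rule tendsto_eventually, rule eventually_sequentiallyI[of N])
        fix n assume "N \<le> n"
        then have "1 / real (Suc n) \<le> 1 / real (Suc N)" by (intro divide_left_mono) auto
        then show "f x * indicator {1 / real (Suc n)..1} x = f x * indicator {0<..1} x"
          using N True by (auto simp: indicator_def)
      qed
    next
      case False
      have "x \<notin> {1 / real (Suc n)..1}" for n
        using False less_le_trans[of 0 "1 / real (Suc n)" x] by auto
      then show ?thesis using False by simp
    qed
  qed measurable
  show "(\<lambda>n. \<integral>\<^sup>+x. f x * indicator {1 / real (Suc n)..1} x \<partial>lborel) \<longlonglongrightarrow> (\<integral>\<^sup>+u. f (1 / u) * ennreal (1 / u\<^sup>2) * indicator {1..} u \<partial>lborel)"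
  proof (rule Lim_transform_eventually)
    show "\<forall>\<^sub>F n in sequentially. ?B n = ?A n"
      using eventually_gt_at_top[of 0] by eventually_elim (simp only: eq)
    show "(\<lambda>n. \<integral>\<^sup>+u. f (1 / u) * ennreal (1 / u\<^sup>2) * indicator {1..real (Suc n)} u \<partial>lborel) \<longlonglongrightarrow> (\<integral>\<^sup>+u. f (1 / u) * ennreal (1 / u\<^sup>2) * indicator {1..} u \<partial>lborel)"
    proof (rule nn_integral_LIMSEQ)
      show "incseq (\<lambda>n u. f (1 / u) * ennreal (1 / u\<^sup>2) * indicator {1..real (Suc n)} u)"
        by (intro incseq_SucI le_funI mult_left_mono) (auto simp: indicator_def)
      fix u :: real
      obtain N where N: "u \<le> real N" using real_arch_simple by blast
      show "(\<lambda>n. f (1 / u) * ennreal (1 / u\<^sup>2) * indicator {1..real (Suc n)} u) \<longlonglongrightarrow> f (1 / u) * ennreal (1 / u\<^sup>2) * indicator {1..} u"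
        by (rule tendsto_eventually, rule eventually_sequentiallyI[of N]) (use N in \<open>auto simp: indicator_def\<close>)
    qed measurable
  qed
qed

lemma summable_zeta_real: "s > 1 \<Longrightarrow> summable (\<lambda>n. real (Suc n) powr (- s))"
  using summable_real_powr_iff[of "- s"] by (subst summable_Suc_iff) auto

text \<open>Every Gaussian of the series yields a Gamma integral with scale
  \<open>pi * (Suc n)\<^sup>2\<close>, whose power \<open>- s / 2\<close> produces the Dirichlet
  term; positivity permits the exchange of sum and integral.\<close>

lemma theta_series_integral:
  assumes "s > 1"
  shows "(\<integral>\<^sup>+x. ennreal (indicator {0<..} x * (theta_tail x * x powr (s / 2 - 1))) \<partial>lborel) =
     ennreal (Gamma (s / 2) * pi powr (- (s / 2)) * (\<Sum>n. real (Suc n) powr (- s)))"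
proof -
  define a where "a = s / 2"
  have a: "a > 0" using assms by (simp add: a_def)
  have "(\<integral>\<^sup>+x. ennreal (indicator {0<..} x * (theta_tail x * x powr (a - 1))) \<partial>lborel) =
     (\<integral>\<^sup>+x. (\<Sum>n. ennreal (indicator {0<..} x * (exp (- (pi * (real (Suc n))\<^sup>2) * x) * x powr (a - 1)))) \<partial>lborel)"
  proof (rule nn_integral_cong)
    fix x :: real
    show "ennreal (indicator {0<..} x * (theta_tail x * x powr (a - 1))) =
      (\<Sum>n. ennreal (indicator {0<..} x * (exp (- (pi * (real (Suc n))\<^sup>2) * x) * x powr (a - 1))))"
    proof (cases "x > 0")
      case True
      have "(\<lambda>n. exp (- pi * (real (Suc n))\<^sup>2 * x)) sums theta_tail x"
        unfolding theta_tail_def by (intro summable_sums summable_theta_tail True)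
      then have *: "(\<lambda>n. indicator {0<..} x * (exp (- (pi * (real (Suc n))\<^sup>2) * x) * x powr (a - 1))) sums
          (indicator {0<..} x * (theta_tail x * x powr (a - 1)))"
        by (intro sums_mult sums_mult2) simp
      show ?thesis by (rule suminf_ennreal_eq[OF _ *, symmetric]) auto
    qed auto
  qed
  also have "\<dots> = (\<Sum>n. \<integral>\<^sup>+x. ennreal (indicator {0<..} x * (exp (- (pi * (real (Suc n))\<^sup>2) * x) * x powr (a - 1))) \<partial>lborel)"
    by (rule nn_integral_suminf) measurable
  also have "\<dots> = (\<Sum>n. ennreal (Gamma a * pi powr (- a) * real (Suc n) powr (- s)))"
  proof (rule arg_cong[of _ _ suminf], rule ext)
    fix n
    have "(pi * (real (Suc n))\<^sup>2) powr (- a) = pi powr (- a) * real (Suc n) powr (- s)"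
      by (simp add: powr_mult powr_powr a_def flip: powr_numeral)
    then show "(\<integral>\<^sup>+x. ennreal (indicator {0<..} x * (exp (- (pi * (real (Suc n))\<^sup>2) * x) * x powr (a - 1))) \<partial>lborel) =
      ennreal (Gamma a * pi powr (- a) * real (Suc n) powr (- s))"
      by (subst nn_integral_Gamma_scaled[OF a]) (simp_all add: mult.assoc)
  qed
  also have "\<dots> = ennreal (Gamma a * pi powr (- a) * (\<Sum>n. real (Suc n) powr (- s)))"
    using a by (intro suminf_ennreal_eq sums_mult summable_sums summable_zeta_real assms) (auto simp: Gamma_real_nonneg)
  finally show ?thesis by (simp only: a_def)
qed

text \<open>After \<open>x = 1 / u\<close> the law \<open>theta_inversion\<close> writes
  \<open>theta_tail (1 / u)\<close> as \<open>sqrt u * theta_tail u + (sqrt u - 1) / 2\<close>. The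
  first part gives the moment at the reflected exponent \<open>(1 - s) / 2\<close>, the elementary
  part gives \<open>1 / (s - 1) - 1 / s\<close>.\<close>

lemma theta_lower_integral:
  assumes "s > 1"
  shows "(\<integral>\<^sup>+x. ennreal (theta_tail x * x powr (s / 2 - 1)) * indicator {0<..1} x \<partial>lborel) =
     ennreal (theta_moment ((1 - s) / 2) + 1 / (s * (s - 1)))"
proof -
  define a where "a = s / 2"
  have a: "a > 1 / 2" using assms by (simp add: a_def)
  define h where "h = (\<lambda>u. theta_weight u * exp (((1 - s) / 2) * lnp u) +
      (indicator {1..} u * u powr (- (a - 1/2) - 1) - indicator {1..} u * u powr (- a - 1)) / 2)"
  have h: "has_bochner_integral lborel h (theta_moment ((1 - s) / 2) + (1 powr (- (a - 1/2)) / (a - 1/2) - 1 powr (- a) / a) / 2)"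
    unfolding h_def using a
    by (intro has_bochner_integral_add has_bochner_integral_divide has_bochner_integral_diff
        theta_moment_integral power_integral_atLeast) auto
  have val: "(1 powr (- (a - 1/2)) / (a - 1/2) - 1 powr (- a) / a) / 2 = 1 / (s * (s - 1))"
    using assms by (simp add: a_def field_simps)
  have h_eq: "theta_tail (1 / u) * (1 / u) powr (a - 1) * (1 / u\<^sup>2) = h u" if u: "u \<ge> 1" for u
  proof -
    have "theta_tail (1 / u) = (u powr (1/2) * (1 + 2 * theta_tail u) - 1) / 2"
      using theta_inversion[of u] u by (simp add: powr_half_sqrt field_simps)
    moreover have "(1 / u) powr (a - 1) * (1 / u\<^sup>2) = u powr (- a - 1)"
    proof -
      have "(1 / u) powr (a - 1) * (1 / u\<^sup>2) = u powr (- (a - 1)) * u powr (- 2)"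
        unfolding powr_minus_divide[of u] using u by (simp add: powr_divide)
      also have "\<dots> = u powr (- (a - 1) + - 2)" by (rule powr_add[symmetric])
      also have "- (a - 1) + - 2 = - a - 1" by simp
      finally show ?thesis .
    qed
    moreover have "u powr (1/2) * u powr (- a - 1) = u powr (- (a - 1/2) - 1)"
      by (simp flip: powr_add)
    moreover have "u powr (- (a - 1/2) - 1) = u powr ((1 - s) / 2) / u"
    proof -
      have "u powr (- (a - 1/2) - 1) = u powr ((1 - s) / 2 - 1)" by (simp add: a_def field_simps)
      then show ?thesis using u by (simp add: powr_diff)
    qed
    moreover have "exp ((1 - s) / 2 * lnp u) = u powr ((1 - s) / 2)" by (rule exp_lnp[OF u])
    ultimately have eqs: "theta_tail (1 / u) = (u powr (1/2) * (1 + 2 * theta_tail u) - 1) / 2"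
      "(1 / u) powr (a - 1) * (1 / u\<^sup>2) = u powr (- a - 1)"
      "u powr (- (a - 1/2) - 1) = u powr (1/2) * u powr (- a - 1)"
      "exp ((1 - s) / 2 * lnp u) / u = u powr (1/2) * u powr (- a - 1)" by simp_all
    have "h u = theta_tail u * (exp ((1 - s) / 2 * lnp u) / u) + (u powr (- (a - 1/2) - 1) - u powr (- a - 1)) / 2"
      using u by (simp add: h_def theta_weight_def)
    then show ?thesis unfolding mult.assoc eqs by (simp add: field_simps)
  qed
  have "(\<integral>\<^sup>+x. ennreal (theta_tail x * x powr (a - 1)) * indicator {0<..1} x \<partial>lborel) =
     (\<integral>\<^sup>+u. ennreal (theta_tail (1 / u) * (1 / u) powr (a - 1)) * ennreal (1 / u\<^sup>2) * indicator {1..} u \<partial>lborel)"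
    by (rule nn_integral_inversion) measurable
  also have "\<dots> = (\<integral>\<^sup>+u. ennreal (h u) \<partial>lborel)"
  proof (rule nn_integral_cong)
    fix u :: real
    show "ennreal (theta_tail (1 / u) * (1 / u) powr (a - 1)) * ennreal (1 / u\<^sup>2) * indicator {1..} u = ennreal (h u)"
    proof (cases "u \<ge> 1")
      case True
      then have "theta_tail (1 / u) \<ge> 0" by (intro theta_tail_nonneg) auto
      then have "ennreal (theta_tail (1 / u) * (1 / u) powr (a - 1)) * ennreal (1 / u\<^sup>2) = ennreal (h u)"
        by (subst ennreal_mult[symmetric]) (auto simp only: h_eq[OF True, symmetric] intro!: mult_nonneg_nonneg, auto)
      with True show ?thesis by simp
    qed (simp add: h_def theta_weight_def)
  qed
  also have "\<dots> = ennreal (theta_moment ((1 - s) / 2) + 1 / (s * (s - 1)))"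
  proof -
    have "h u \<ge> 0" for u
    proof (cases "u \<ge> 1")
      case True
      then show ?thesis unfolding h_eq[OF True, symmetric]
        by (intro mult_nonneg_nonneg theta_tail_nonneg) auto
    qed (simp add: h_def theta_weight_def)
    then show ?thesis using h unfolding val
      by (subst nn_integral_eq_integral) (auto simp: has_bochner_integral_iff)
  qed
  finally show ?thesis by (simp only: a_def)
qed

text \<open>Riemann's argument: the Mellin integral of the theta tail is split at 1 and its lower
  part inverted. Real \<open>s > 1\<close> keeps everything nonnegative; other arguments follow by
  the identity theorem.\<close>

lemma completed_zeta_real:
  assumes "s > 1"
  shows "Gamma (s / 2) * pi powr (- (s / 2)) * (\<Sum>n. real (Suc n) powr (- s)) =
     1 / (s * (s - 1)) + theta_moment (s / 2) + theta_moment ((1 - s) / 2)" (is "?L = ?R")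
proof -
  have upper: "(\<integral>\<^sup>+x. ennreal (theta_tail x * x powr (s / 2 - 1)) * indicator {1..} x \<partial>lborel) = ennreal (theta_moment (s / 2))"
  proof -
    have "(\<integral>\<^sup>+x. ennreal (theta_tail x * x powr (s / 2 - 1)) * indicator {1..} x \<partial>lborel) =
        (\<integral>\<^sup>+x. ennreal (theta_weight x * exp ((s / 2) * lnp x)) \<partial>lborel)"
      by (rule nn_integral_cong) (auto simp: theta_weight_def exp_lnp indicator_def powr_diff simp del: times_divide_eq_left; simp)
    also have "\<dots> = ennreal (theta_moment (s / 2))"
      using theta_moment_integral[of "s / 2"] theta_weight_nonneg
      by (subst nn_integral_eq_integral) (auto simp: has_bochner_integral_iff)
    finally show ?thesis .
  qed
  have "ennreal ?L = (\<integral>\<^sup>+x. ennreal (indicator {0<..} x * (theta_tail x * x powr (s / 2 - 1))) \<partial>lborel)"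
    by (rule theta_series_integral[OF assms, symmetric])
  also have "\<dots> = (\<integral>\<^sup>+x. ennreal (theta_tail x * x powr (s / 2 - 1)) * indicator {0<..1} x +
       ennreal (theta_tail x * x powr (s / 2 - 1)) * indicator {1..} x \<partial>lborel)"
  \<comment> \<open>Both ranges contain the point 1, so the equality is claimed only almost
    everywhere.\<close>
  proof (rule nn_integral_cong_AE)
    show "AE x in lborel. ennreal (indicator {0<..} x * (theta_tail x * x powr (s / 2 - 1))) =
      ennreal (theta_tail x * x powr (s / 2 - 1)) * indicator {0<..1} x + ennreal (theta_tail x * x powr (s / 2 - 1)) * indicator {1..} x"
      using AE_lborel_singleton[of "1::real"] by eventually_elim (auto simp: indicator_def)
  qed
  also have "\<dots> = ennreal (theta_moment ((1 - s) / 2) + 1 / (s * (s - 1))) + ennreal (theta_moment (s / 2))"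
    by (subst nn_integral_add) (simp_all only: theta_lower_integral[OF assms] upper, measurable)
  also have "\<dots> = ennreal ?R"
    using assms theta_moment_nonneg by (subst ennreal_plus[symmetric]) (auto intro!: add_nonneg_nonneg simp: add_ac)
  finally show ?thesis
    using assms theta_moment_nonneg
    by (subst (asm) ennreal_inj)
       (auto intro!: add_nonneg_nonneg mult_nonneg_nonneg Gamma_real_nonneg suminf_nonneg summable_zeta_real[simplified])
qed

subsection \<open>The zeta function\<close>

lemma holomorphic_halfplane_eq_0:
  assumes "f holomorphic_on {s. Re s > a}" and "\<And>x. x > b \<Longrightarrow> f (of_real x) = 0" and "Re s > a"
  shows "f s = 0"
proof (rule analytic_continuation[OF assms(1)])
  show "open {s. Re s > a}" by (rule open_halfspace_Re_gt)
  show "connected {s. Re s > a}" by (intro convex_connected convex_halfspace_Re_gt)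
  show "of_real ` {max a b<..} \<subseteq> {s. Re s > a}" by auto
  show "of_real (max a b + 1) \<in> {s. Re s > a}" by simp
  show "(of_real (max a b + 1) :: complex) islimpt of_real ` {max a b<..}"
    by (rule of_real_islimpt_greaterThan)
qed (use assms in auto)

text \<open>The index is shifted so that the exponent \<open>ln (Suc n)\<close> is nonnegative
  throughout; the series starts with \<open>a 1\<close>.\<close>

definition dirichlet :: "(nat \<Rightarrow> real) \<Rightarrow> complex \<Rightarrow> complex" where
  "dirichlet a = laplace (count_space UNIV) (\<lambda>n. ln (real (Suc n))) (\<lambda>n. a (Suc n))"

lemma dirichlet_term:
  fixes s :: complex
  shows "of_real a * exp (- s * of_real (ln (real (Suc n)))) = of_real a / of_nat (Suc n) powr s"
proof -
  have "of_nat (Suc n) powr s = exp (s * of_real (ln (real (Suc n))))"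
  proof -
    have "of_nat (Suc n) \<noteq> (0 :: complex)" by (simp only: of_nat_eq_0_iff)
    moreover have "Ln (of_nat (Suc n)) = of_real (ln (real (Suc n)))" using Ln_of_nat[of "Suc n"] by simp
    ultimately show ?thesis unfolding powr_def by (simp only: if_False)
  qed
  then show ?thesis by (simp add: exp_minus divide_inverse)
qed

lemma integrable_dirichlet:
  assumes "\<And>n. \<bar>a n\<bar> \<le> 1" and "c > 1"
  shows "integrable (count_space UNIV) (\<lambda>n. a (Suc n) * exp (- c * ln (real (Suc n))))"
  unfolding integrable_count_space_nat_iff
proof (rule summable_comparison_test'[OF summable_zeta_real[OF assms(2)]])
  show "norm (norm (a (Suc n) * exp (- c * ln (real (Suc n))))) \<le> real (Suc n) powr (- c)" for n
    using assms(1)[of "Suc n"] by (simp add: abs_mult powr_def mult_le_cancel_right1)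
qed

lemma holomorphic_dirichlet:
  assumes "\<And>n. \<bar>a n\<bar> \<le> 1"
  shows "dirichlet a holomorphic_on {s. Re s > 1}"
  unfolding dirichlet_def by (rule holomorphic_laplace) (use integrable_dirichlet[OF assms] in auto)

lemma dirichlet_sums:
  assumes "\<And>n. \<bar>a n\<bar> \<le> 1" and "Re s > 1"
  shows "summable (\<lambda>n. norm (of_real (a (Suc n)) / of_nat (Suc n) powr s :: complex))"
    and "(\<lambda>n. of_real (a (Suc n)) / of_nat (Suc n) powr s) sums dirichlet a s"
proof -
  define c where "c = (1 + Re s) / 2"
  have c: "c > 1" "c \<le> Re s" using assms by (auto simp: c_def)
  have int: "integrable (count_space UNIV) (\<lambda>n. of_real (a (Suc n)) * exp (- s * of_real (ln (real (Suc n)))) :: complex)"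
    by (rule integrable_laplace[OF _ _ _ integrable_dirichlet[OF assms(1) c(1)] c(2)]) auto
  then show "summable (\<lambda>n. norm (of_real (a (Suc n)) / of_nat (Suc n) powr s :: complex))"
    unfolding dirichlet_term integrable_count_space_nat_iff .
  show "(\<lambda>n. of_real (a (Suc n)) / of_nat (Suc n) powr s) sums dirichlet a s"
    unfolding dirichlet_def laplace_def using sums_integral_count_space_nat[OF int] unfolding dirichlet_term .
qed

lemma dirichlet_real:
  assumes bnd: "\<And>n. \<bar>a n\<bar> \<le> 1" and x: "x > 1"
  shows "summable (\<lambda>n. a (Suc n) * real (Suc n) powr (- x))"
    and "dirichlet a (of_real x) = of_real (\<Sum>n. a (Suc n) * real (Suc n) powr (- x))"
proof -
  show sm: "summable (\<lambda>n. a (Suc n) * real (Suc n) powr (- x))"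
    by (rule summable_comparison_test'[OF summable_zeta_real[OF x], of 0])
       (use bnd in \<open>auto simp: abs_mult intro!: mult_left_le_one_le\<close>)
  have "(\<lambda>n. complex_of_real (a (Suc n) * real (Suc n) powr (- x))) sums of_real (\<Sum>n. a (Suc n) * real (Suc n) powr (- x))"
    unfolding sums_of_real_iff by (intro summable_sums sm)
  moreover have "complex_of_real (a (Suc n) * real (Suc n) powr (- x)) = of_real (a (Suc n)) / of_nat (Suc n) powr of_real x" for n
    using powr_of_real[of "real (Suc n)" x] by (simp add: powr_minus divide_inverse)
  ultimately show "dirichlet a (of_real x) = of_real (\<Sum>n. a (Suc n) * real (Suc n) powr (- x))"
    using dirichlet_sums(2)[of a "of_real x", OF bnd] x by (simp add: sums_unique2)
qed

text \<open>The entire function \<open>(s - 1) \<zeta>(s)\<close>.\<close>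

definition zeta_entire :: "complex \<Rightarrow> complex" where
  "zeta_entire s = of_real pi powr (s / 2) * rGamma (s / 2 + 1) * xi s / 2"

lemma holomorphic_zeta_entire: "zeta_entire holomorphic_on A"
proof -
  have "zeta_entire holomorphic_on UNIV"
    unfolding zeta_entire_def[abs_def] by (intro holomorphic_intros holomorphic_xi) auto
  then show ?thesis by (rule holomorphic_on_subset) simp
qed

text \<open>This is the residue of zeta at 1. The factor \<open>s - 1\<close> in \<open>xi\<close>
  removes the theta integrals, and \<open>Gamma (3 / 2) = sqrt pi / 2\<close> cancels the remaining
  constants.\<close>

lemma zeta_entire_1: "zeta_entire 1 = 1"
proof -
  have "rGamma (1 / 2 + 1 :: complex) = of_real (rGamma (1 / 2 + 1))"
    using rGamma_complex_of_real[of "1 / 2 + 1"] by simp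
  also have "rGamma (1 / 2 + 1 :: real) = 2 / sqrt pi"
  proof -
    have "(1 / 2 :: real) \<notin> \<int>\<^sub>\<le>\<^sub>0" by (auto dest: nonpos_Ints_nonpos)
    then have "Gamma (1 / 2 + 1 :: real) = sqrt pi / 2"
      using Gamma_plus1[of "1 / 2 :: real"] by (simp add: Gamma_one_half_real)
    then show ?thesis by (simp only: rGamma_inverse_Gamma) simp
  qed
  finally have "rGamma (1 / 2 + 1 :: complex) = of_real (2 / sqrt pi)" .
  moreover have "complex_of_real pi powr (1 / 2) = of_real (sqrt pi)"
    using powr_of_real[of pi "1 / 2"] by (simp add: powr_half_sqrt)
  ultimately show ?thesis by (simp add: zeta_entire_def xi_def)
qed

text \<open>By \<open>Gamma (s / 2 + 1) = s / 2 * Gamma (s / 2)\<close> the reciprocal Gamma factor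
  cancels \<open>Gamma (s / 2)\<close> together with the factor \<open>s\<close> of
  \<open>xi\<close>.\<close>

lemma zeta_entire_real:
  assumes "s > 1"
  shows "zeta_entire (of_real s) = (of_real s - 1) * dirichlet (\<lambda>_. 1) (of_real s)"
proof -
  define D where "D = (\<Sum>n. real (Suc n) powr (- s))"
  have D: "dirichlet (\<lambda>_. 1) (of_real s) = of_real D"
    using dirichlet_real(2)[of "\<lambda>_. 1" s] assms by (simp add: D_def)
  have "xi (of_real s) = of_real (1 + s * (s - 1) * (theta_moment (s / 2) + theta_moment ((1 - s) / 2)))"
    unfolding xi_def using theta_mellin_of_real[of "s / 2"] theta_mellin_of_real[of "(1 - s) / 2"] by simp
  also have "1 + s * (s - 1) * (theta_moment (s / 2) + theta_moment ((1 - s) / 2)) =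
      s * (s - 1) * (Gamma (s / 2) * pi powr (- (s / 2)) * D)"
    unfolding D_def completed_zeta_real[OF assms] using assms by (simp add: distrib_left add.assoc)
  finally have xi: "xi (of_real s) = of_real (s * (s - 1) * (Gamma (s / 2) * pi powr (- (s / 2)) * D))" .
  have "zeta_entire (of_real s) = of_real (pi powr (s / 2) * rGamma (s / 2 + 1) * (s * (s - 1) * (Gamma (s / 2) * pi powr (- (s / 2)) * D)) / 2)"
    unfolding zeta_entire_def xi using powr_of_real[of pi "s / 2"] rGamma_complex_of_real[of "s / 2 + 1"] by simp
  also have "pi powr (s / 2) * rGamma (s / 2 + 1) * (s * (s - 1) * (Gamma (s / 2) * pi powr (- (s / 2)) * D)) / 2 = (s - 1) * D"
  proof -
    have "Gamma (s / 2) > 0" using assms by (intro Gamma_real_pos) auto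
    then have "rGamma (s / 2 + 1) * (s * Gamma (s / 2)) = 2"
    proof -
      have "s / 2 \<notin> \<int>\<^sub>\<le>\<^sub>0" using assms by (auto dest: nonpos_Ints_nonpos)
      then have "Gamma (s / 2 + 1) = s / 2 * Gamma (s / 2)" by (rule Gamma_plus1)
      moreover have "Gamma (s / 2) \<noteq> 0" using \<open>Gamma (s / 2) > 0\<close> by linarith
      ultimately show ?thesis using assms by (simp only: rGamma_inverse_Gamma) simp
    qed
    moreover have "pi powr (s / 2) * pi powr (- (s / 2)) = 1"
      by (simp flip: powr_add)
    ultimately have "(pi powr (s / 2) * pi powr (- (s / 2))) * (rGamma (s / 2 + 1) * (s * Gamma (s / 2))) * ((s - 1) * D) / 2 = (s - 1) * D"
      by simp
    then show ?thesis by (simp add: mult_ac)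
  qed
  finally show ?thesis by (simp add: D)
qed

lemma zeta_entire_eq:
  assumes "Re s > 1"
  shows "zeta_entire s = (s - 1) * dirichlet (\<lambda>_. 1) s"
proof -
  have "zeta_entire s - (s - 1) * dirichlet (\<lambda>_. 1) s = 0"
  proof (rule holomorphic_halfplane_eq_0[of "\<lambda>s. zeta_entire s - (s - 1) * dirichlet (\<lambda>_. 1) s" 1 1])
    show "(\<lambda>s. zeta_entire s - (s - 1) * dirichlet (\<lambda>_. 1) s) holomorphic_on {s. Re s > 1}"
      by (intro holomorphic_intros holomorphic_zeta_entire holomorphic_dirichlet) auto
  qed (use assms zeta_entire_real in auto)
  then show ?thesis by simp
qed

text \<open>This resolves the definite description: the quotient has the defining properties, and
  two continuations agree because the punctured plane is connected.\<close>

lemma zeta_conv_entire: "zeta = (\<lambda>s. if s = 1 then 0 else zeta_entire s / (s - 1))"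
  unfolding zeta_def
proof (rule the_equality)
  let ?f = "\<lambda>s. if s = 1 then 0 else zeta_entire s / (s - 1)"
  have hol: "?f holomorphic_on - {1}"
  proof (rule holomorphic_transform[of "\<lambda>s. zeta_entire s / (s - 1)"])
    show "(\<lambda>s. zeta_entire s / (s - 1)) holomorphic_on - {1}"
      by (intro holomorphic_intros holomorphic_zeta_entire) auto
  qed auto
  have sums: "(\<lambda>n. 1 / of_nat (Suc n) powr s) sums ?f s" if "Re s > 1" for s
    using dirichlet_sums(2)[of "\<lambda>_. 1" s] zeta_entire_eq[OF that] that by (cases "s = 1") auto
  show "?f holomorphic_on - {1} \<and> (\<forall>s. Re s > 1 \<longrightarrow> (\<lambda>n. 1 / of_nat (Suc n) powr s) sums ?f s) \<and> ?f 1 = 0"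
    using hol sums by auto
  fix f assume f: "f holomorphic_on - {1} \<and> (\<forall>s. Re s > 1 \<longrightarrow> (\<lambda>n. 1 / of_nat (Suc n) powr s) sums f s) \<and> f 1 = 0"
  show "f = ?f"
  proof
    fix s
    show "f s = ?f s"
    proof (cases "s = 1")
      case False
      show ?thesis
      proof (rule analytic_continuation_open[of "{s. Re s > 1}" "- {1}" f ?f])
        show "{s. Re s > 1} \<noteq> {}" by (auto intro: exI[of _ "2 :: complex"])
        show "connected (- {1 :: complex})" by (rule connected_punctured_universe) simp
        show "f z = ?f z" if "z \<in> {s. Re s > 1}" for z
          using f sums[of z] that sums_unique2 by blast
      qed (use f hol False in \<open>auto simp: open_halfspace_Re_gt\<close>)
    qed (use f in auto)
  qed
qed

lemma zeta_conv_dirichlet: "Re s > 1 \<Longrightarrow> zeta s = dirichlet (\<lambda>_. 1) s"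
  using zeta_entire_eq[of s] by (auto simp: zeta_conv_entire)

subsection \<open>Euler products\<close>

definition smooth_numbers :: "nat set \<Rightarrow> nat set" where
  "smooth_numbers A = {n. n > 0 \<and> (\<forall>p. prime p \<longrightarrow> p dvd n \<longrightarrow> p \<in> A)}"

lemma smooth_numbers_empty: "smooth_numbers {} = {1}"
  using prime_factor_nat by (auto simp: smooth_numbers_def)

lemma bij_betw_smooth_numbers:
  assumes p: "prime p" "p \<notin> A"
  shows "bij_betw (\<lambda>(n, k). n * p ^ k) (smooth_numbers A \<times> UNIV) (smooth_numbers (insert p A))"
proof (rule bij_betwI')
  have mult: "multiplicity p (n * p ^ k) = k" if "n \<in> smooth_numbers A" for n k
  proof -
    have "\<not> p dvd n" "n \<noteq> 0" using that p by (auto simp: smooth_numbers_def)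
    then show ?thesis using p
      by (subst prime_elem_multiplicity_mult_distrib) (auto simp: not_dvd_imp_multiplicity_0)
  qed
  fix x y assume x: "x \<in> smooth_numbers A \<times> (UNIV :: nat set)" and y: "y \<in> smooth_numbers A \<times> (UNIV :: nat set)"
  obtain n k m l where xy: "x = (n, k)" "y = (m, l)" by (cases x, cases y)
  show "((\<lambda>(n, k). n * p ^ k) x = (\<lambda>(n, k). n * p ^ k) y) = (x = y)"
  proof
    assume "(\<lambda>(n, k). n * p ^ k) x = (\<lambda>(n, k). n * p ^ k) y"
    then have eq: "n * p ^ k = m * p ^ l" by (simp add: xy)
    then have "k = l" using mult[of n k] mult[of m l] x y by (auto simp: xy)
    then show "x = y" using eq p by (simp add: xy)
  qed simp
next
  fix x assume "x \<in> smooth_numbers A \<times> (UNIV :: nat set)"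
  then show "(\<lambda>(n, k). n * p ^ k) x \<in> smooth_numbers (insert p A)"
    using p prime_gt_0_nat[of p] by (auto simp: smooth_numbers_def prime_dvd_mult_iff) (metis prime_dvd_power primes_dvd_imp_eq)
next
  fix m assume m: "m \<in> smooth_numbers (insert p A)"
  then have "m \<noteq> 0" by (auto simp: smooth_numbers_def)
  then obtain y where y: "m = p ^ multiplicity p m * y" "\<not> p dvd y"
    using p by (elim multiplicity_decompose'[of m p]) auto
  have "y dvd m" using y(1) by (metis dvd_triv_right)
  then have "y \<in> smooth_numbers A"
    using m y(2) by (auto simp: smooth_numbers_def intro!: Nat.gr0I dest: dvd_trans)
  then show "\<exists>x\<in>smooth_numbers A \<times> UNIV. m = (\<lambda>(n, k). n * p ^ k) x"
    using y(1) by (intro bexI[of _ "(y, multiplicity p m)"]) (auto simp: mult.commute)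
qed

text \<open>By unique factorisation, adding a prime to \<open>A\<close> multiplies the sum by the
  local series at that prime. Unordered sums suit the reindexing by pairs, and absolute convergence
  makes them available.\<close>

lemma infsum_smooth_numbers:
  fixes f :: "nat \<Rightarrow> complex"
  assumes sm: "summable (\<lambda>n. norm (f n))" and f1: "f 1 = 1"
    and mult: "\<And>p n k. prime p \<Longrightarrow> n > 0 \<Longrightarrow> \<not> p dvd n \<Longrightarrow> f (n * p ^ k) = f n * f (p ^ k)"
    and A: "finite A" "\<And>p. p \<in> A \<Longrightarrow> prime p"
  shows "infsum f (smooth_numbers A) = (\<Prod>p\<in>A. \<Sum>k. f (p ^ k))"
  using A
proof (induction A rule: finite_induct)
  case empty
  then show ?case using f1 by (simp add: smooth_numbers_empty)
next
  case (insert p A)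
  then have p: "prime p" "p \<notin> A" by auto
  have sf: "f summable_on B" for B
    using norm_summable_imp_summable_on[OF sm] by (rule summable_on_subset_banach) simp
  have bij: "bij_betw (\<lambda>(n, k). n * p ^ k) (smooth_numbers A \<times> UNIV) (smooth_numbers (insert p A))"
    by (rule bij_betw_smooth_numbers[OF p])
  have eq: "f ((\<lambda>(n, k). n * p ^ k) x) = f (fst x) * f (p ^ snd x)" if "x \<in> smooth_numbers A \<times> UNIV" for x
    using that p mult[of p "fst x" "snd x"] by (auto simp: smooth_numbers_def)
  have "(\<lambda>x. f ((\<lambda>(n, k). n * p ^ k) x)) summable_on (smooth_numbers A \<times> UNIV)"
    using sf by (subst summable_on_reindex_bij_betw[OF bij]) 
  then have s2: "(\<lambda>x. f (fst x) * f (p ^ snd x)) summable_on (smooth_numbers A \<times> UNIV)"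
    using eq by (subst (asm) summable_on_cong) auto
  have "infsum f (smooth_numbers (insert p A)) = infsum (\<lambda>x. f ((\<lambda>(n, k). n * p ^ k) x)) (smooth_numbers A \<times> UNIV)"
    by (rule infsum_reindex_bij_betw[OF bij, symmetric])
  also have "\<dots> = infsum (\<lambda>x. f (fst x) * f (p ^ snd x)) (smooth_numbers A \<times> UNIV)"
    by (rule infsum_cong) (rule eq)
  also have "\<dots> = infsum (\<lambda>n. infsum (\<lambda>k. f n * f (p ^ k)) UNIV) (smooth_numbers A)"
    using infsum_Sigma_banach[OF s2] by simp
  also have "\<dots> = infsum (\<lambda>n. infsum (\<lambda>k. f (p ^ k)) UNIV * f n) (smooth_numbers A)"
    by (simp add: infsum_cmult_right' mult.commute)
  also have "\<dots> = infsum (\<lambda>k. f (p ^ k)) UNIV * infsum f (smooth_numbers A)"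
    by (rule infsum_cmult_right')
  also have "infsum (\<lambda>k. f (p ^ k)) UNIV = (\<Sum>k. f (p ^ k))"
  proof -
    have inj: "inj (\<lambda>k. p ^ k)" using p prime_gt_1_nat[of p] by (intro injI) simp
    have "summable (\<lambda>k. norm (f (p ^ k)))"
      using summable_reindex[OF sm, of "\<lambda>k. p ^ k"] inj by (simp add: o_def)
    then have "((\<lambda>k. f (p ^ k)) has_sum (\<Sum>k. f (p ^ k))) UNIV"
      by (metis norm_summable_imp_has_sum summable_sums summable_norm_cancel)
    then show ?thesis by (rule infsumI)
  qed
  finally show ?case using insert by simp
qed

text \<open>The product over primes below \<open>N\<close> sums \<open>f\<close> over the integers
  composed of such primes, and every \<open>n > 0\<close> is among them once \<open>N > n\<close>.
  Domination by \<open>norm (f n)\<close> gives the limit; 0 is never reached, whence the condition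
  \<open>f 0 = 0\<close>.\<close>

theorem euler_product_tendsto:
  fixes f :: "nat \<Rightarrow> complex"
  assumes sm: "summable (\<lambda>n. norm (f n))" and f0: "f 0 = 0" and f1: "f 1 = 1"
    and mult: "\<And>p n k. prime p \<Longrightarrow> n > 0 \<Longrightarrow> \<not> p dvd n \<Longrightarrow> f (n * p ^ k) = f n * f (p ^ k)"
  shows "(\<lambda>N. \<Prod>p<N. if prime p then \<Sum>k. f (p ^ k) else 1) \<longlonglongrightarrow> (\<Sum>n. f n)"
proof -
  define A where "A N = {p. prime p \<and> p < N}" for N :: nat
  have finA: "finite (A N)" for N unfolding A_def by simp
  define g where "g N n = (if n \<in> smooth_numbers (A N) then f n else 0)" for N n
  have "(\<Prod>p<N. if prime p then \<Sum>k. f (p ^ k) else 1) = (\<Sum>n. g N n)" for N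
  proof -
    have "(\<Prod>p<N. if prime p then \<Sum>k. f (p ^ k) else 1) = (\<Prod>p\<in>A N. \<Sum>k. f (p ^ k))"
      by (rule prod.mono_neutral_cong_right) (auto simp: A_def)
    also have "\<dots> = infsum f (smooth_numbers (A N))"
      by (rule infsum_smooth_numbers[OF sm f1 mult finA, symmetric]) (auto simp: A_def)
    also have "\<dots> = infsum (g N) UNIV"
      by (rule infsum_cong_neutral) (auto simp: g_def)
    also have "\<dots> = (\<Sum>n. g N n)"
    proof -
      have "summable (\<lambda>n. norm (g N n))"
        by (rule summable_comparison_test'[OF sm, of 0]) (auto simp: g_def)
      then have "(g N has_sum (\<Sum>n. g N n)) UNIV"
        by (metis norm_summable_imp_has_sum summable_sums summable_norm_cancel)
      then show ?thesis by (rule infsumI)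
    qed
    finally show ?thesis .
  qed
  moreover have "(\<lambda>N. \<Sum>n. g N n) \<longlonglongrightarrow> (\<Sum>n. f n)"
  proof (rule tannerys_theorem[THEN conjunct2, THEN conjunct2])
    show "(\<lambda>N. g N n) \<longlonglongrightarrow> f n" for n
    proof (cases "n = 0")
      case False
      have "n \<in> smooth_numbers (A N)" if "N > n" for N
        using that False by (auto simp: smooth_numbers_def A_def dest: dvd_imp_le)
      then show ?thesis
        by (intro tendsto_eventually eventually_mono[OF eventually_gt_at_top[of n]]) (auto simp: g_def)
    qed (simp add: g_def f0 cong: if_cong)
    show "\<forall>\<^sub>F (n, N) in at_top \<times>\<^sub>F sequentially. norm (g N n) \<le> norm (f n)"
      by (intro always_eventually) (auto simp: g_def)
  qed (use sm in auto)
  ultimately show ?thesis by simp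
qed

subsection \<open>The Dedekind function\<close>

definition squarefree_divisors :: "nat \<Rightarrow> nat set" where
  "squarefree_divisors n = {e. e dvd n \<and> squarefree e}"

lemma moebius_mu_squared: "(moebius_mu n)\<^sup>2 = of_bool (squarefree n)"
  by (simp add: moebius_mu_def flip: power_mult)

text \<open>Substitute \<open>e = n div d\<close>: the squared Moebius value becomes the condition
  that \<open>e\<close> is squarefree.\<close>

lemma dedekind_psi_eq_sum:
  assumes "n > 0"
  shows "real_of_int (dedekind_psi n) = (\<Sum>e\<in>squarefree_divisors n. real n / real e)"
proof -
  have "real_of_int (dedekind_psi n) = (\<Sum>d | d dvd n. real d * of_bool (squarefree (n div d)))"
    by (simp add: dedekind_psi_def moebius_mu_squared)
  also have "\<dots> = (\<Sum>e | e dvd n. real (n div e) * of_bool (squarefree e))"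
    by (rule sum.reindex_bij_witness[of _ "\<lambda>d. n div d" "\<lambda>d. n div d"])
       (use assms in \<open>auto simp: div_dvd_iff_mult elim!: dvdE\<close>)
  also have "\<dots> = (\<Sum>e\<in>squarefree_divisors n. real n / real e)"
    by (rule sum.mono_neutral_cong_right) (use assms in \<open>auto simp: squarefree_divisors_def real_of_nat_div\<close>)
  finally show ?thesis .
qed

lemma finite_squarefree_divisors: "n > 0 \<Longrightarrow> finite (squarefree_divisors n)"
  unfolding squarefree_divisors_def by (rule finite_subset[of _ "{d. d dvd n}"]) auto

text \<open>A squarefree number contains \<open>p\<close> at most once, so all positive exponents
  \<open>k\<close> give the same set.\<close>

lemma squarefree_divisors_mult_prime_power:
  assumes p: "prime p" "\<not> p dvd n" and k: "k > 0"
  shows "squarefree_divisors (n * p ^ k) = squarefree_divisors n \<union> (\<lambda>e. p * e) ` squarefree_divisors n"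
proof (intro equalityI subsetI)
  have cop: "e dvd n" if "e dvd n * p ^ k" "\<not> p dvd e" for e
  proof -
    have "coprime e (p ^ k)" using that p
      by (metis coprime_commute coprime_power_right_iff prime_imp_coprime)
    then show ?thesis using that by (simp add: coprime_dvd_mult_left_iff)
  qed
  fix e assume "e \<in> squarefree_divisors (n * p ^ k)"
  then have e: "e dvd n * p ^ k" "squarefree e" by (auto simp: squarefree_divisors_def)
  show "e \<in> squarefree_divisors n \<union> (\<lambda>e. p * e) ` squarefree_divisors n"
  proof (cases "p dvd e")
    case False
    then show ?thesis using cop e by (auto simp: squarefree_divisors_def)
  next
    case True
    then obtain e' where e': "e = p * e'" by (elim dvdE)
    have "\<not> p dvd e'"
    proof
      assume "p dvd e'"
      then have "p\<^sup>2 dvd e" by (simp add: e' power2_eq_square)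
      then have "p dvd 1" using e(2) unfolding squarefree_def by blast
      then show False using p by auto
    qed
    moreover have "e' dvd n * p ^ k" using e(1) unfolding e' by (rule dvd_mult_right)
    moreover have "squarefree e'" using e(2) unfolding e' by (rule squarefree_multD)
    ultimately show ?thesis using cop by (auto simp: squarefree_divisors_def e')
  qed
next
  fix e assume "e \<in> squarefree_divisors n \<union> (\<lambda>e. p * e) ` squarefree_divisors n"
  then show "e \<in> squarefree_divisors (n * p ^ k)"
  proof
    assume "e \<in> (\<lambda>e. p * e) ` squarefree_divisors n"
    then obtain d where d: "e = p * d" "d dvd n" "squarefree d" by (auto simp: squarefree_divisors_def)
    have "\<not> p dvd d" using d p by (meson dvd_trans)
    then have "coprime p d" using p by (simp add: prime_imp_coprime)
    then have "squarefree (p * d)" using p(1) d(3) by (rule squarefree_mult_coprime[OF _ squarefree_prime])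
    moreover have "p dvd p ^ k" using k by (simp add: dvd_power)
    then have "p * d dvd n * p ^ k" using d by (subst mult.commute) (rule mult_dvd_mono)
    ultimately show ?thesis by (simp add: squarefree_divisors_def d)
  qed (auto simp: squarefree_divisors_def)
qed

definition psi_ratio :: "nat \<Rightarrow> real" where
  "psi_ratio n = real n / of_int (dedekind_psi n)"

lemma dedekind_psi_ge:
  assumes "n > 0"
  shows "real n \<le> of_int (dedekind_psi n)"
proof -
  have "(\<Sum>e\<in>{1}. real n / real e) \<le> (\<Sum>e\<in>squarefree_divisors n. real n / real e)"
    by (rule sum_mono2) (use finite_squarefree_divisors[OF assms] in \<open>auto simp: squarefree_divisors_def\<close>)
  then show ?thesis using assms by (simp add: dedekind_psi_eq_sum)
qed

lemma psi_ratio_bounds: "0 \<le> psi_ratio n" "psi_ratio n \<le> 1" "\<bar>psi_ratio n\<bar> \<le> 1"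
  using dedekind_psi_ge[of n] by (cases "n = 0"; simp add: psi_ratio_def divide_le_eq_1)+

lemma psi_ratio_1: "psi_ratio 1 = 1"
proof -
  have "squarefree_divisors 1 = {1}" by (auto simp: squarefree_divisors_def)
  then show ?thesis using dedekind_psi_eq_sum[of 1] by (simp add: psi_ratio_def)
qed

text \<open>The divisors containing \<open>p\<close> repeat the sum for \<open>n\<close> with a
  factor \<open>1 / p\<close>. Thus psi acquires the factor \<open>p ^ k * (1 + 1 / p)\<close>, and
  the ratio does not depend on \<open>k\<close>.\<close>

lemma psi_ratio_mult_prime_power:
  assumes p: "prime p" "\<not> p dvd n" and k: "k > 0" and n: "n > 0"
  shows "psi_ratio (n * p ^ k) = psi_ratio n * (real p / (real p + 1))"
proof -
  have p0: "real p > 0" using p prime_gt_0_nat by simp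
  define D where "D = squarefree_divisors n"
  have finD: "finite D" unfolding D_def by (rule finite_squarefree_divisors[OF n])
  have disj: "D \<inter> (\<lambda>e. p * e) ` D = {}"
    using p by (auto simp: D_def squarefree_divisors_def dest: dvd_mult_left)
  have inj: "inj_on (\<lambda>e. p * e) D" using p0 by (auto simp: inj_on_def)
  have N0: "n * p ^ k > 0" using n p prime_gt_0_nat by simp
  have "real_of_int (dedekind_psi (n * p ^ k)) = (\<Sum>e\<in>D \<union> (\<lambda>e. p * e) ` D. real (n * p ^ k) / real e)"
    unfolding dedekind_psi_eq_sum[OF N0] squarefree_divisors_mult_prime_power[OF p k] D_def ..
  also have "\<dots> = (\<Sum>e\<in>D. real (n * p ^ k) / real e) + (\<Sum>e\<in>D. real (n * p ^ k) / real (p * e))"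
    using finD disj by (subst sum.union_disjoint) (auto simp: sum.reindex[OF inj])
  also have "(\<Sum>e\<in>D. real (n * p ^ k) / real e) = real p ^ k * (\<Sum>e\<in>D. real n / real e)"
    by (simp add: sum_distrib_left mult_ac)
  also have "(\<Sum>e\<in>D. real (n * p ^ k) / real (p * e)) = (real p ^ k / real p) * (\<Sum>e\<in>D. real n / real e)"
    by (simp add: sum_distrib_left mult_ac)
  also have "(\<Sum>e\<in>D. real n / real e) = of_int (dedekind_psi n)"
    unfolding D_def by (rule dedekind_psi_eq_sum[OF n, symmetric])
  finally have "real_of_int (dedekind_psi (n * p ^ k)) = real p ^ k * of_int (dedekind_psi n) * ((real p + 1) / real p)"
    using p0 by (simp add: field_simps)
  then show ?thesis using p0 by (simp add: psi_ratio_def)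
qed

lemma psi_ratio_prime_power: "prime p \<Longrightarrow> k > 0 \<Longrightarrow> psi_ratio (p ^ k) = real p / (real p + 1)"
  using psi_ratio_mult_prime_power[of p 1 k] psi_ratio_1 prime_gt_1_nat[of p] by auto

subsection \<open>Factorisation of the Dirichlet series\<close>

lemma of_nat_powr_mult: "(of_nat (m * n) :: complex) powr s = of_nat m powr s * of_nat n powr s"
  using powr_times_real[of "of_nat m" "of_nat n" s] by simp

lemma of_nat_powr_power: "(of_nat (p ^ k) :: complex) powr s = (of_nat p powr s) ^ k"
proof (induction k)
  case (Suc k)
  then show ?case using of_nat_powr_mult[of p "p ^ k" s] by simp
qed simp

lemma norm_of_nat_powr: "p > 0 \<Longrightarrow> norm ((of_nat p :: complex) powr s) = real p powr Re s"
  using norm_powr_real_powr[of "of_nat p" s] by simp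

lemma norm_prime_powr_less_1:
  assumes "prime p" "Re s > 0"
  shows "norm ((of_nat p :: complex) powr (- s)) < 1"
  using assms prime_gt_1_nat[of p] powr_less_mono[of "- Re s" 0 "real p"]
  by (simp add: norm_of_nat_powr prime_gt_0_nat)

lemma dirichlet_euler:
  assumes bnd: "\<And>n. \<bar>a n\<bar> \<le> 1" and a1: "a 1 = 1" and s: "Re s > 1"
    and mult: "\<And>p n k. prime p \<Longrightarrow> n > 0 \<Longrightarrow> \<not> p dvd n \<Longrightarrow> a (n * p ^ k) = a n * a (p ^ k)"
  shows "(\<lambda>N. \<Prod>p<N. if prime p then \<Sum>k. of_real (a (p ^ k)) * (of_nat p powr (- s)) ^ k else 1)
           \<longlonglongrightarrow> dirichlet a s"
proof -
  define f where "f n = of_real (a n) / of_nat n powr s" for n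
  \<comment> \<open>\<open>0 powr s\<close> is 0, and division by 0 gives 0.\<close>
  have f0: "f 0 = 0" by (simp add: f_def)
  have sm: "summable (\<lambda>n. norm (f n))"
    using dirichlet_sums(1)[OF bnd s] by (subst summable_Suc_iff[symmetric]) (simp only: f_def)
  have "f sums dirichlet a s"
    using dirichlet_sums(2)[of a s, OF bnd s] sums_Suc_iff[of f "dirichlet a s"] f0 by (simp only: f_def add_0_right)
  then have "(\<Sum>n. f n) = dirichlet a s" by (rule sums_unique[symmetric])
  moreover have "(\<lambda>N. \<Prod>p<N. if prime p then \<Sum>k. f (p ^ k) else 1) \<longlonglongrightarrow> (\<Sum>n. f n)"
  proof (rule euler_product_tendsto[OF sm f0])
    show "f (n * p ^ k) = f n * f (p ^ k)" if "prime p" "n > 0" "\<not> p dvd n" for p n k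
      unfolding f_def of_nat_powr_mult mult[OF that] by simp
  qed (simp add: f_def a1[simplified])
  moreover have "f (p ^ k) = of_real (a (p ^ k)) * (of_nat p powr (- s)) ^ k" for p k
    unfolding f_def of_nat_powr_power powr_minus by (simp add: divide_inverse power_inverse)
  ultimately show ?thesis by (simp cong: if_cong)
qed

lemma zeta_euler:
  assumes "Re s > 1"
  shows "(\<lambda>N. \<Prod>p<N. if prime p then 1 / (1 - of_nat p powr (- s)) else 1) \<longlonglongrightarrow> zeta s"
proof -
  have "(\<Sum>k. (of_nat p powr (- s)) ^ k) = 1 / (1 - of_nat p powr (- s) :: complex)" if "prime p" for p
    using norm_prime_powr_less_1[OF that, of s] assms by (intro suminf_geometric) auto
  moreover have "(\<lambda>N. \<Prod>p<N. if prime p then \<Sum>k. of_real 1 * (of_nat p powr (- s)) ^ k else 1) \<longlonglongrightarrow> dirichlet (\<lambda>_. 1) s"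
    by (rule dirichlet_euler) (use assms in auto)
  ultimately show ?thesis using zeta_conv_dirichlet[OF assms] by (simp cong: if_cong)
qed

text \<open>As the ratio is \<open>p / (p + 1)\<close> at every positive power of \<open>p\<close>,
  the local series is geometric apart from its first term.\<close>

lemma psi_dirichlet_euler:
  assumes "Re s > 1"
  shows "(\<lambda>N. \<Prod>p<N. if prime p then 1 + of_real (real p / (real p + 1)) * (of_nat p powr (- s) / (1 - of_nat p powr (- s))) else 1)
    \<longlonglongrightarrow> dirichlet psi_ratio s"
proof -
  have local: "(\<Sum>k. of_real (psi_ratio (p ^ k)) * (of_nat p powr (- s)) ^ k) =
      1 + of_real (real p / (real p + 1)) * (of_nat p powr (- s) / (1 - of_nat p powr (- s)))" (is "?L = ?R")
    if "prime p" for p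
  proof -
    define w where "w = (of_nat p :: complex) powr (- s)"
    define c where "c = complex_of_real (real p / (real p + 1))"
    have "(\<lambda>k. w ^ k) sums (1 / (1 - w))"
      using norm_prime_powr_less_1[OF that, of s] assms by (intro geometric_sums) (auto simp: w_def)
    then have "(\<lambda>k. c * (w * w ^ k)) sums (c * (w * (1 / (1 - w))))"
      by (intro sums_mult)
    then have "(\<lambda>k. of_real (psi_ratio (p ^ Suc k)) * w ^ Suc k) sums (c * (w / (1 - w)))"
      using that by (simp only: psi_ratio_prime_power c_def zero_less_Suc power_Suc[of w]) simp
    then have "(\<lambda>k. of_real (psi_ratio (p ^ k)) * w ^ k) sums (c * (w / (1 - w)) + of_real (psi_ratio (p ^ 0)) * w ^ 0)"
      by (rule sums_Suc)
    then show ?thesis using psi_ratio_1 by (simp add: sums_iff w_def c_def add.commute)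
  qed
  have "(\<lambda>N. \<Prod>p<N. if prime p then \<Sum>k. of_real (psi_ratio (p ^ k)) * (of_nat p powr (- s)) ^ k else 1)
           \<longlonglongrightarrow> dirichlet psi_ratio s"
  proof (rule dirichlet_euler)
    show "psi_ratio (n * p ^ k) = psi_ratio n * psi_ratio (p ^ k)" if "prime p" "n > 0" "\<not> p dvd n" for p n k
    proof (cases "k = 0")
      case False
      then show ?thesis using that by (simp add: psi_ratio_mult_prime_power psi_ratio_prime_power)
    qed (use psi_ratio_1 in simp)
  qed (use assms psi_ratio_bounds psi_ratio_1 in auto)
  then show ?thesis by (simp add: local cong: if_cong)
qed

text \<open>The local factor of \<open>dirichlet psi_ratio s * zeta (s + 1) / zeta s\<close>: with w
  = p^(-s), the product of \<open>1 - w\<close>, \<open>1 + p / (p + 1) * (w / (1 - w))\<close> and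
  \<open>1 / (1 - w / p)\<close> exceeds 1 by this fraction. Its size p^(-2 - Re s) is what moves
  the line of convergence to \<open>Re s = - 1\<close>.\<close>

definition Q_factor :: "nat \<Rightarrow> complex \<Rightarrow> complex" where
  "Q_factor p s = (if prime p then 1 + of_nat p powr (- s) / ((of_nat p + 1) * (of_nat p - of_nat p powr (- s))) else 1)"

definition Q_product :: "complex \<Rightarrow> complex" where
  "Q_product s = prodinf (\<lambda>p. Q_factor p s)"

text \<open>Here \<open>norm w \<le> p powr (1 - \<delta>)\<close>, so \<open>norm (p - w)\<close>
  is at least \<open>p * (1 - 2 powr (- \<delta>))\<close> because \<open>p \<ge> 2\<close>. The
  bound is uniform in the half-plane, as the Weierstrass test requires.\<close>

lemma Q_factor_bound:
  assumes \<delta>: "\<delta> > 0" and s: "Re s \<ge> \<delta> - 1"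
  shows "norm (Q_factor p s - 1) \<le> 1 / (1 - 2 powr (- \<delta>)) * real p powr (- 1 - \<delta>)"
proof (cases "prime p")
  case True
  then have p: "real p \<ge> 2" using prime_ge_2_nat by force
  define w where "w = (of_nat p :: complex) powr (- s)"
  have "norm w \<le> real p powr (1 - \<delta>)"
    using p s by (auto simp: w_def norm_of_nat_powr intro!: powr_mono)
  have q: "real p powr (1 - \<delta>) = real p * real p powr (- \<delta>)"
    using p powr_add[of "real p" 1 "- \<delta>"] by simp
  have "real p powr (- \<delta>) \<le> 2 powr (- \<delta>)"
    using p \<delta> by (intro powr_mono2') auto
  then have "real p * (1 - 2 powr (- \<delta>)) \<le> real p * (1 - real p powr (- \<delta>))"
    by (intro mult_left_mono) auto
  also have "\<dots> \<le> real p - norm w" using \<open>norm w \<le> _\<close> by (simp add: q algebra_simps)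
  also have "\<dots> \<le> norm (of_nat p - w)" using norm_triangle_ineq2[of "of_nat p" w] by simp
  finally have d: "real p * (1 - 2 powr (- \<delta>)) \<le> norm (of_nat p - w)" .
  have "2 powr (- \<delta>) < 1" using \<delta> powr_less_mono[of "- \<delta>" 0 2] by simp
  then have d0: "0 < 1 - 2 powr (- \<delta>)" by simp
  have "norm (Q_factor p s - 1) = norm w / ((real p + 1) * norm (of_nat p - w))"
    using True norm_of_nat[of "Suc p", where 'a = complex] by (simp add: Q_factor_def w_def norm_divide norm_mult add.commute)
  also have "\<dots> \<le> real p powr (1 - \<delta>) / (real p * (real p * (1 - 2 powr (- \<delta>))))"
    using d d0 p \<open>norm w \<le> _\<close> by (intro frac_le mult_mono mult_pos_pos) auto
  also have "real p powr (1 - \<delta>) = real p powr (- 1 - \<delta>) * real p * real p"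
  proof -
    have "real p powr (1 - \<delta>) = real p powr (- 1 - \<delta> + 1 + 1)" by simp
    also have "\<dots> = real p powr (- 1 - \<delta>) * real p * real p"
      unfolding powr_add using p by simp
    finally show ?thesis .
  qed
  also have "real p powr (- 1 - \<delta>) * real p * real p / (real p * (real p * (1 - 2 powr (- \<delta>)))) = 1 / (1 - 2 powr (- \<delta>)) * real p powr (- 1 - \<delta>)"
    using p by simp
  finally show ?thesis .
next
  case False
  have "2 powr (- \<delta>) < 1" using \<delta> powr_less_mono[of "- \<delta>" 0 2] by simp
  with False show ?thesis by (simp add: Q_factor_def)
qed

lemma summable_Q_bound: "\<delta> > 0 \<Longrightarrow> summable (\<lambda>p. 1 / (1 - 2 powr (- \<delta>)) * real p powr (- 1 - \<delta>))"
  by (intro summable_mult) (simp add: summable_real_powr_iff)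

lemma Q_factor_denom_nonzero:
  assumes "prime p" "Re s > - 1"
  shows "of_nat p - (of_nat p :: complex) powr (- s) \<noteq> 0" "of_nat p + 1 - (of_nat p :: complex) powr (- s) \<noteq> 0"
proof -
  have p: "real p > 1" using assms prime_gt_1_nat by simp
  have "norm ((of_nat p :: complex) powr (- s)) < real p powr 1"
    using p assms powr_less_mono[of "- Re s" 1 "real p"] by (simp add: norm_of_nat_powr)
  then have n: "norm ((of_nat p :: complex) powr (- s)) < real p" using p by simp
  show "of_nat p - (of_nat p :: complex) powr (- s) \<noteq> 0"
    using n by (metis eq_iff_diff_eq_0 less_irrefl norm_of_nat)
  have "norm (of_nat p + 1 :: complex) = real p + 1" using norm_of_nat[of "Suc p", where 'a = complex] by (simp add: add.commute)
  then show "of_nat p + 1 - (of_nat p :: complex) powr (- s) \<noteq> 0"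
    using n by (metis eq_iff_diff_eq_0 add.commute less_add_one less_asym)
qed

lemma holomorphic_Q_factor: "Q_factor p holomorphic_on {s. Re s > - 1}"
proof (cases "prime p")
  case True
  have "of_nat p + 1 \<noteq> (0 :: complex)" using of_nat_neq_0[of p, where 'a = complex] by (simp add: add.commute)
  then show ?thesis unfolding Q_factor_def[abs_def]
    using True Q_factor_denom_nonzero[OF True] prime_gt_0_nat[OF True]
    by (auto intro!: holomorphic_intros)
qed (simp add: Q_factor_def[abs_def])

lemma convergent_Q_product:
  assumes "Re s > - 1"
  shows "convergent_prod (\<lambda>p. Q_factor p s)"
proof -
  have "summable (\<lambda>p. norm (Q_factor p s - 1))"
  proof (rule summable_comparison_test'[OF summable_Q_bound, of "Re s + 1" 0])
    show "norm (norm (Q_factor p s - 1)) \<le> 1 / (1 - 2 powr - (Re s + 1)) * real p powr (- 1 - (Re s + 1))" for p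
      using Q_factor_bound[of "Re s + 1" s p] assms by simp
  qed (use assms in simp)
  then show ?thesis
    by (intro abs_convergent_prod_imp_convergent_prod) (simp add: abs_convergent_prod_conv_summable)
qed

lemma Q_product_tendsto: "Re s > - 1 \<Longrightarrow> (\<lambda>N. \<Prod>p<N. Q_factor p s) \<longlonglongrightarrow> Q_product s"
  unfolding Q_product_def LIMSEQ_lessThan_iff_atMost by (intro convergent_prod_LIMSEQ convergent_Q_product)

lemma one_plus_divide_eq:
  fixes P w :: complex
  assumes "P + 1 \<noteq> 0" "P - w \<noteq> 0"
  shows "1 + w / ((P + 1) * (P - w)) = P * (P + 1 - w) / ((P + 1) * (P - w))"
proof -
  have "(P + 1) * (P - w) + w = P * (P + 1 - w)" by (simp add: algebra_simps)
  moreover have "(P + 1) * (P - w) \<noteq> 0" using assms by simp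
  ultimately show ?thesis by (metis add_divide_distrib divide_self)
qed

text \<open>In the form \<open>p * (p + 1 - w) / ((p + 1) * (p - w))\<close> each factor at a prime
  is nonzero since \<open>norm w < p\<close>, and a convergent product of nonzero factors does not
  vanish.\<close>

lemma Q_product_nonzero:
  assumes "Re s > - 1"
  shows "Q_product s \<noteq> 0"
  unfolding Q_product_def
proof (rule prodinf_nonzero[OF convergent_Q_product[OF assms]])
  fix p
  show "Q_factor p s \<noteq> 0"
  proof (cases "prime p")
    case True
    define w where "w = (of_nat p :: complex) powr (- s)"
    have nz: "of_nat p + 1 \<noteq> (0 :: complex)" using of_nat_neq_0[of p, where 'a = complex] by (simp add: add.commute)
    have nz2: "of_nat p - w \<noteq> 0" "of_nat p + 1 - w \<noteq> 0" "of_nat p \<noteq> (0 :: complex)"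
      using Q_factor_denom_nonzero[OF True assms] prime_gt_0_nat[OF True] by (auto simp: w_def)
    have "Q_factor p s = of_nat p * (of_nat p + 1 - w) / ((of_nat p + 1) * (of_nat p - w))"
      using True one_plus_divide_eq[OF nz nz2(1)] by (simp add: Q_factor_def w_def[symmetric])
    then show ?thesis using nz nz2 by simp
  qed (simp add: Q_factor_def)
qed

lemma holomorphic_Q_product: "Q_product holomorphic_on {s. Re s > - 1}"
proof (rule holomorphic_uniform_sequence[OF open_halfspace_Re_gt])
  let ?P = "\<lambda>N s. \<Prod>p<N. Q_factor p s"
  show "(\<lambda>s. \<Prod>p<N. Q_factor p s) holomorphic_on {s. Re s > - 1}" for N
    by (intro holomorphic_intros holomorphic_Q_factor)
  fix x :: complex assume "x \<in> {s. Re s > - 1}"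
  then have x: "Re x > - 1" by simp
  \<comment> \<open>Half the distance of \<open>x\<close> from the boundary line: the closed disc of
    this radius stays where \<open>Q_factor_bound\<close> is uniform.\<close>
  define \<delta> where "\<delta> = (Re x + 1) / 2"
  have \<delta>: "\<delta> > 0" using x by (simp add: \<delta>_def)
  have sub: "Re z \<ge> \<delta> - 1" if "z \<in> cball x \<delta>" for z
  proof -
    have "\<bar>Re (x - z)\<bar> \<le> \<delta>" using that abs_Re_le_cmod[of "x - z"] by (simp add: dist_norm)
    then show ?thesis by (simp add: \<delta>_def field_simps abs_if split: if_splits)
  qed
  have sub': "cball x \<delta> \<subseteq> {s. Re s > - 1}" using sub \<delta> by force
  have "uniformly_convergent_on (cball x \<delta>) ?P"
  proof (rule uniformly_convergent_on_prod')
    show "continuous_on (cball x \<delta>) (Q_factor p)" for p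
      using holomorphic_on_imp_continuous_on[OF holomorphic_Q_factor] sub' by (rule continuous_on_subset)
    show "uniformly_convergent_on (cball x \<delta>) (\<lambda>N s. \<Sum>p<N. norm (Q_factor p s - 1))"
      by (rule Weierstrass_m_test'[OF _ summable_Q_bound[OF \<delta>]]) (use Q_factor_bound[OF \<delta>] sub in auto)
  qed auto
  then obtain l where l: "uniform_limit (cball x \<delta>) ?P l sequentially"
    by (auto simp: uniformly_convergent_on_def)
  have "l s = Q_product s" if "s \<in> cball x \<delta>" for s
    using tendsto_uniform_limitI[OF l that] Q_product_tendsto[of s] sub' that LIMSEQ_unique by blast
  then have "uniform_limit (cball x \<delta>) ?P Q_product sequentially"
    using l uniform_limit_cong'[of "cball x \<delta>" "\<lambda>N s. \<Prod>p<N. Q_factor p s" "\<lambda>N s. \<Prod>p<N. Q_factor p s" l Q_product] by auto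
  then show "\<exists>d>0. cball x d \<subseteq> {s. Re s > - 1} \<and> uniform_limit (cball x d) ?P Q_product sequentially"
    using \<delta> sub' by blast
qed

text \<open>The Euler products on both sides agree prime by prime, already at the level of partial
  products.\<close>

theorem dirichlet_psi_ratio_eq:
  assumes "Re s > 1"
  shows "dirichlet psi_ratio s * zeta (s + 1) = zeta s * Q_product s"
proof (rule LIMSEQ_unique)
  let ?F = "\<lambda>p. if prime p then 1 + of_real (real p / (real p + 1)) * (of_nat p powr (- s) / (1 - of_nat p powr (- s))) else (1 :: complex)"
  let ?Z1 = "\<lambda>p. if prime p then 1 / (1 - of_nat p powr (- (s + 1))) else (1 :: complex)"
  let ?Z = "\<lambda>p. if prime p then 1 / (1 - of_nat p powr (- s)) else (1 :: complex)"
  show "(\<lambda>N. (\<Prod>p<N. ?F p) * (\<Prod>p<N. ?Z1 p)) \<longlonglongrightarrow> dirichlet psi_ratio s * zeta (s + 1)"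
    by (intro tendsto_mult psi_dirichlet_euler zeta_euler) (use assms in auto)
  have eq: "?F p * ?Z1 p = ?Z p * Q_factor p s" for p
  proof (cases "prime p")
    case True
    define w where "w = (of_nat p :: complex) powr (- s)"
    define P where "P = (of_nat p :: complex)"
    have nz: "P + 1 \<noteq> 0" using of_nat_neq_0[of p, where 'a = complex] by (simp add: P_def add.commute)
    have nz2: "P - w \<noteq> 0" "P \<noteq> 0"
      using Q_factor_denom_nonzero[OF True, of s] assms prime_gt_0_nat[OF True] by (auto simp: w_def P_def)
    have nz3: "1 - w \<noteq> 0" using norm_prime_powr_less_1[OF True, of s] assms by (auto simp: w_def)
    have w1: "of_nat p powr (- (s + 1)) = w / P"
    proof -
      have "- (s + 1) = - s - 1" by simp
      then have "of_nat p powr (- (s + 1)) = (of_nat p :: complex) powr (- s - 1)" by (rule arg_cong)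
      then show ?thesis using nz2 by (simp add: powr_diff w_def P_def)
    qed
    have c: "of_real (real p / (real p + 1)) = P / (P + 1)" by (simp add: P_def)
    have "(1 + P / (P + 1) * (w / (1 - w))) * (1 / (1 - w / P)) = 1 / (1 - w) * (1 + w / ((P + 1) * (P - w)))"
    proof -
      have "1 + P / (P + 1) * (w / (1 - w)) = (P + 1 - w) / ((P + 1) * (1 - w))"
      proof -
        have "(P + 1) * (1 - w) + P * w = P + 1 - w" by (simp add: algebra_simps)
        moreover have "(P + 1) * (1 - w) \<noteq> 0" using nz nz3 by simp
        ultimately show ?thesis by (metis add_divide_distrib divide_self times_divide_times_eq)
      qed
      moreover have "1 / (1 - w / P) = P / (P - w)" using nz2 by (simp add: field_simps)
      moreover have "1 + w / ((P + 1) * (P - w)) = P * (P + 1 - w) / ((P + 1) * (P - w))"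
        by (rule one_plus_divide_eq[OF nz nz2(1)])
      ultimately show ?thesis using nz nz2 nz3 by (simp only: times_divide_times_eq) (simp add: mult_ac)
    qed
    then show ?thesis unfolding Q_factor_def using True
      by (simp only: if_True w1 c, simp only: w_def[symmetric], simp only: P_def[symmetric])
  qed (simp add: Q_factor_def)
  have "(\<lambda>N. (\<Prod>p<N. ?Z p) * (\<Prod>p<N. Q_factor p s)) \<longlonglongrightarrow> zeta s * Q_product s"
    by (intro tendsto_mult zeta_euler Q_product_tendsto) (use assms in auto)
  then show "(\<lambda>N. (\<Prod>p<N. ?F p) * (\<Prod>p<N. ?Z1 p)) \<longlonglongrightarrow> zeta s * Q_product s"
    unfolding prod.distrib[symmetric] eq .
qed

section \<open>The value of the product at 1\<close>

lemma zeta_real: "x > 1 \<Longrightarrow> zeta (of_real x) = of_real (\<Sum>n. real (Suc n) powr (- x))"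
  using dirichlet_real(2)[of "\<lambda>_. 1" x] zeta_conv_dirichlet[of "of_real x"] by simp

lemma of_nat_powr_neg_nat: "p > 0 \<Longrightarrow> (of_nat p :: complex) powr (- of_nat k) = of_real (1 / real p ^ k)"
  by (simp add: powr_minus divide_inverse)

lemma Q_product_1: "Q_product 1 = zeta 4 * of_real h_one"
proof (rule LIMSEQ_unique)
  define H where "H p = (if prime p then 1 + 1 / (real p ^ 2 * (real p + 1)) - 1 / (real p ^ 3 * (real p + 1)) else 1)" for p
  have "summable (\<lambda>p. norm (H p - 1))"
  proof (rule summable_comparison_test'[of "\<lambda>p. 1 / real p ^ 2" 0])
    show "summable (\<lambda>p. 1 / real p ^ 2)" using inverse_power_summable[of 2, where 'a = real] by (simp add: divide_inverse)
    show "norm (norm (H p - 1)) \<le> 1 / real p ^ 2" for p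
    proof (cases "prime p")
      case True
      then have p: "real p \<ge> 1" using prime_ge_1_nat by simp
      have "real p ^ 2 \<le> real p ^ 3" using p by (intro power_increasing) auto
      then have "1 / (real p ^ 3 * (real p + 1)) \<le> 1 / (real p ^ 2 * (real p + 1))"
        using p by (intro divide_left_mono mult_right_mono mult_pos_pos) auto
      moreover have "1 / (real p ^ 2 * (real p + 1)) \<le> 1 / real p ^ 2"
        using p by (intro divide_left_mono mult_pos_pos) (auto simp: mult_le_cancel_left1)
      moreover have "1 / (real p ^ 3 * (real p + 1)) \<ge> 0" by simp
      ultimately have "0 \<le> 1 / (real p ^ 2 * (real p + 1)) - 1 / (real p ^ 3 * (real p + 1))"
        "1 / (real p ^ 2 * (real p + 1)) - 1 / (real p ^ 3 * (real p + 1)) \<le> 1 / real p ^ 2" by linarith+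
      then show ?thesis using True by (simp add: H_def)
    qed (simp add: H_def)
  qed
  then have "convergent_prod H"
    by (intro abs_convergent_prod_imp_convergent_prod) (simp add: abs_convergent_prod_conv_summable)
  then have "(\<lambda>N. \<Prod>p<N. H p) \<longlonglongrightarrow> prodinf H"
    unfolding LIMSEQ_lessThan_iff_atMost by (rule convergent_prod_LIMSEQ)
  moreover have "prodinf H = h_one" unfolding h_one_def H_def ..
  ultimately have H: "(\<lambda>N. \<Prod>p<N. H p) \<longlonglongrightarrow> h_one" by simp
  let ?Z = "\<lambda>p. if prime p then 1 / (1 - of_nat p powr (- 4)) else (1 :: complex)"
  have "(\<lambda>N. (\<Prod>p<N. ?Z p) * of_real (\<Prod>p<N. H p)) \<longlonglongrightarrow> zeta 4 * of_real h_one"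
    by (intro tendsto_mult tendsto_of_real H zeta_euler) simp
  moreover have "?Z p * of_real (H p) = Q_factor p 1" for p
  proof (cases "prime p")
    case True
    then have p: "real p > 1" using prime_gt_1_nat by simp
    define P where "P = real p"
    have P: "P > 1" using p by (simp add: P_def)
    have P2: "P ^ 2 > 1" "P ^ 4 > 1" using P by (auto intro: one_less_power)
    have w4: "(of_nat p :: complex) powr (- 4) = of_real (1 / P ^ 4)"
      using of_nat_powr_neg_nat[of p 4] p by (simp add: P_def)
    have w1: "(of_nat p :: complex) powr (- 1) = of_real (1 / P)"
      using of_nat_powr_neg_nat[of p 1] p by (simp add: P_def)
    let ?q = "1 + (1 / P) / ((P + 1) * (P - 1 / P))" and ?d = "(P + 1) * (P ^ 2 - 1)" and ?e = "P ^ 3 * (P + 1)"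
    have "?q = 1 + 1 / ?d"
      using P P2 by (simp add: field_simps power2_eq_square)
    also have "\<dots> = P * (P ^ 2 + P - 1) / ?d"
    proof -
      have "?d + 1 = P * (P ^ 2 + P - 1)" by (simp add: algebra_simps power2_eq_square)
      moreover have "P ^ 2 - 1 \<noteq> 0" using P2 by linarith
      then have "?d \<noteq> 0" using P by simp
      ultimately show ?thesis by (metis add_divide_distrib divide_self)
    qed
    \<comment> \<open>Extending by \<open>P ^ 2 + 1\<close> turns \<open>P ^ 2 - 1\<close> into
      \<open>P ^ 4 - 1\<close>, from which the Euler factor of \<open>zeta 4\<close> splits
      off.\<close>
    also have "\<dots> = P * (P ^ 2 + P - 1) * (P ^ 2 + 1) / (?d * (P ^ 2 + 1))"
      using add_pos_nonneg[of 1 "P ^ 2"] by (subst nonzero_mult_divide_mult_cancel_right) auto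
    also have "(P ^ 2 - 1) * (P ^ 2 + 1) = P ^ 4 - 1" by (simp add: algebra_simps power_add[symmetric])
    then have "?d * (P ^ 2 + 1) = (P + 1) * (P ^ 4 - 1)" by (simp add: mult.assoc)
    also have "P * (P ^ 2 + P - 1) * (P ^ 2 + 1) = P * (?e + P - 1)"
      by (simp add: algebra_simps eval_nat_numeral)
    also have "P * (?e + P - 1) / ((P + 1) * (P ^ 4 - 1)) = (1 / (1 - 1 / P ^ 4)) * ((?e + P - 1) / ?e)"
    proof -
      have "1 / (1 - 1 / P ^ 4) = P ^ 4 / (P ^ 4 - 1)" using P P2 by (simp add: field_simps)
      moreover have "P ^ 4 = P * P ^ 3" by (simp add: eval_nat_numeral)
      moreover have "P ^ 3 \<noteq> 0" using P by simp
      ultimately show ?thesis by simp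
    qed
    also have "(?e + P - 1) / ?e = 1 + 1 / (P ^ 2 * (P + 1)) - 1 / ?e"
    proof -
      have "1 / (P ^ 2 * (P + 1)) = P / ?e" using P by (simp add: eval_nat_numeral)
      moreover have "?e \<noteq> 0" using P by simp
      ultimately show ?thesis by (simp add: add_divide_distrib diff_divide_distrib)
    qed
    finally have real_eq: "?q = (1 / (1 - 1 / P ^ 4)) * (1 + 1 / (P ^ 2 * (P + 1)) - 1 / ?e)" .
    have "Q_factor p 1 = of_real (?q)"
      using True by (simp add: Q_factor_def w1) (simp add: P_def)
    also have "\<dots> = ?Z p * of_real (H p)"
      unfolding real_eq using True by (simp add: w4 H_def P_def)
    finally show ?thesis by simp
  qed (simp add: H_def Q_factor_def)
  ultimately show "(\<lambda>N. \<Prod>p<N. Q_factor p 1) \<longlonglongrightarrow> zeta 4 * of_real h_one"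
    unfolding of_real_prod prod.distrib[symmetric] by simp
qed (rule Q_product_tendsto, simp)

subsection \<open>Nonvanishing of zeta to the right of the line with real part 1\<close>

text \<open>Since \<open>norm (1 - w) \<ge> 1 / 2\<close> at every prime, the Euler factors differ
  from 1 by a summable amount, and an absolutely convergent product of nonzero factors is
  nonzero.\<close>

lemma zeta_nonzero:
  assumes "Re s > 1"
  shows "zeta s \<noteq> 0"
proof -
  define f where "f p = (if prime p then 1 / (1 - of_nat p powr (- s)) else (1 :: complex))" for p
  have nz: "f p \<noteq> 0" for p
    using norm_prime_powr_less_1[of p s] assms by (auto simp: f_def)
  have "summable (\<lambda>p. norm (f p - 1))"
  proof (rule summable_comparison_test'[of "\<lambda>p. 2 * real p powr (- Re s)" 0])
    show "summable (\<lambda>p. 2 * real p powr (- Re s))"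
      using assms by (intro summable_mult) (simp add: summable_real_powr_iff)
    show "norm (norm (f p - 1)) \<le> 2 * real p powr (- Re s)" for p
    proof (cases "prime p")
      case True
      then have p: "real p \<ge> 2" using prime_ge_2_nat by force
      define w where "w = (of_nat p :: complex) powr (- s)"
      have w: "norm w = real p powr (- Re s)" using p by (simp add: w_def norm_of_nat_powr)
      have "real p powr (- Re s) \<le> 2 powr (- Re s)" using p assms by (intro powr_mono2') auto
      also have "\<dots> \<le> 2 powr (- 1)" using assms by (intro powr_mono) auto
      finally have "norm w \<le> 1 / 2" by (simp add: w powr_minus)
      then have "norm (1 - w) \<ge> 1 / 2" using norm_triangle_ineq2[of 1 w] by simp
      moreover from this have "1 - w \<noteq> 0" by auto
      then have "w / (1 - w) = 1 / (1 - w) - 1" using diff_divide_distrib[of 1 "1 - w" "1 - w"] by simp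
      then have "f p - 1 = w / (1 - w)" using True by (simp only: f_def w_def[symmetric] if_True)
      ultimately have "norm (f p - 1) \<le> norm w / (1 / 2)"
        by (simp only: norm_divide) (intro divide_left_mono; auto intro: mult_pos_pos)
      then show ?thesis by (simp add: w)
    qed (simp add: f_def)
  qed
  then have cp: "convergent_prod f"
    by (intro abs_convergent_prod_imp_convergent_prod) (simp add: abs_convergent_prod_conv_summable)
  have "(\<lambda>N. \<Prod>p<N. f p) \<longlonglongrightarrow> prodinf f"
    unfolding LIMSEQ_lessThan_iff_atMost by (rule convergent_prod_LIMSEQ[OF cp])
  moreover have "(\<lambda>N. \<Prod>p<N. f p) \<longlonglongrightarrow> zeta s"
    using zeta_euler[OF assms] unfolding f_def .
  ultimately have "zeta s = prodinf f" by (rule LIMSEQ_unique[rotated])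
  with prodinf_nonzero[OF cp nz] show ?thesis by simp
qed

text \<open>Taking logarithms, the claim becomes \<open>3 + 4 cos \<phi> + cos 2\<phi> = 2 (1 + cos \<phi>)\<^sup>2 \<ge> 0\<close>.\<close>

lemma mertens_local:
  fixes z :: complex
  assumes x: "0 < x" "x < 1" and z: "norm z = 1"
  shows "norm ((1 - of_real x) ^ 3 * (1 - of_real x * z) ^ 4 * (1 - of_real x * z ^ 2)) \<le> 1"
proof -
  let ?t = "\<lambda>n. 3 * Re (- ((of_real x * 1) ^ n) / of_nat n) + 4 * Re (- ((of_real x * z) ^ n) / of_nat n) + Re (- ((of_real x * z ^ 2) ^ n) / of_nat n)"
  have ln1: "(\<lambda>n. Re (- ((of_real x * u) ^ n) / of_nat n)) sums Re (Ln (1 - of_real x * u))" if "norm u = 1" for u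
    using Ln_series'[of "- (of_real x * u)"] x that by (intro sums_Re) (simp add: norm_mult)
  have nz: "1 - of_real x * u \<noteq> 0" if "norm u = 1" for u :: complex
  proof
    assume "1 - of_real x * u = 0"
    then have "norm (of_real x * u) = norm (1 :: complex)" by simp
    with x that show False by (simp add: norm_mult)
  qed
  define L where "L = 3 * Re (Ln (1 - of_real x * 1)) + 4 * Re (Ln (1 - of_real x * z)) + Re (Ln (1 - of_real x * z ^ 2))"
  have z2: "norm (z ^ 2) = 1" using z by (simp add: norm_power)
  have "(\<lambda>n. ?t n) sums L"
    unfolding L_def by (intro sums_add sums_mult ln1) (use z z2 in auto)
  moreover have "?t n \<le> 0" for n
  proof -
    define c where "c = Re (z ^ n)"
    have "norm (z ^ n) = 1" using z by (simp add: norm_power)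
    then have "(Re (z ^ n))\<^sup>2 + (Im (z ^ n))\<^sup>2 = 1" by (metis cmod_power2 one_power2)
    then have "Re ((z ^ n)\<^sup>2) = 2 * c\<^sup>2 - 1" by (simp add: Re_power2 c_def)
    then have c2: "Re ((z ^ 2) ^ n) = 2 * c\<^sup>2 - 1" by (simp add: power_mult[symmetric] mult.commute)
    \<comment> \<open>At \<open>n = 0\<close> division by 0 makes both \<open>y\<close> and the term
      of the logarithmic series 0.\<close>
    define y where "y = x ^ n / real n"
    have y: "y \<ge> 0" using x by (simp add: y_def)
    have t: "Re (- ((of_real x * u) ^ n) / of_nat n) = - y * Re (u ^ n)" for u
    proof -
      have "- ((of_real x * u) ^ n) / of_nat n = of_real (- y) * u ^ n"
        by (simp add: power_mult_distrib y_def)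
      then show ?thesis by (simp only: Re_complex_of_real times_complex.sel Im_complex_of_real)
    qed
    have "?t n
        = - y * (2 * (1 + c)\<^sup>2)"
      unfolding t c2 c_def[symmetric] by (simp add: power2_eq_square algebra_simps)
    also have "\<dots> \<le> 0" using y by (simp add: mult_nonneg_nonneg)
    finally show ?thesis .
  qed
  ultimately have "L \<le> 0" by (rule sums_le[OF _ _ sums_zero, rotated])
  have e: "norm (1 - of_real x * u) = exp (Re (Ln (1 - of_real x * u)))" if "norm u = 1" for u
    using nz[OF that] by (metis exp_Ln norm_exp_eq_Re)
  have "norm ((1 - of_real x) ^ 3 * (1 - of_real x * z) ^ 4 * (1 - of_real x * z ^ 2)) =
     exp (Re (Ln (1 - of_real x * 1))) ^ 3 * exp (Re (Ln (1 - of_real x * z))) ^ 4 * exp (Re (Ln (1 - of_real x * z ^ 2)))"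
    using e[of 1] e[OF z] e[OF z2] by (simp add: norm_mult norm_power)
  also have "\<dots> = exp L" by (simp add: L_def exp_add exp_of_nat_mult[symmetric])
  finally show ?thesis using \<open>L \<le> 0\<close> by simp
qed

text \<open>Each Euler factor of this product is the reciprocal of the expression in
  \<open>mertens_local\<close>, with \<open>x = p powr (- \<sigma>)\<close> and z = p^(-it).\<close>

lemma mertens_inequality:
  assumes "\<sigma> > 1"
  shows "norm (zeta (of_real \<sigma>) ^ 3 * zeta (Complex \<sigma> t) ^ 4 * zeta (Complex \<sigma> (2 * t))) \<ge> 1"
proof (rule LIMSEQ_le_const)
  let ?Z = "\<lambda>s p. if prime p then 1 / (1 - of_nat p powr (- s)) else (1 :: complex)"
  let ?P = "\<lambda>N. norm ((\<Prod>p<N. ?Z (of_real \<sigma>) p) ^ 3 * (\<Prod>p<N. ?Z (Complex \<sigma> t) p) ^ 4 * (\<Prod>p<N. ?Z (Complex \<sigma> (2 * t)) p))"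
  show "(\<lambda>N. ?P N)
     \<longlonglongrightarrow> norm (zeta (of_real \<sigma>) ^ 3 * zeta (Complex \<sigma> t) ^ 4 * zeta (Complex \<sigma> (2 * t)))"
    by (intro tendsto_intros zeta_euler) (use assms in auto)
  have loc: "norm (?Z (of_real \<sigma>) p ^ 3 * ?Z (Complex \<sigma> t) p ^ 4 * ?Z (Complex \<sigma> (2 * t)) p) \<ge> 1" for p
  proof (cases "prime p")
    case True
    then have p: "p > 1" using prime_gt_1_nat by simp
    define x where "x = real p powr (- \<sigma>)"
    define z where "z = (of_nat p :: complex) powr (- Complex 0 t)"
    have x: "0 < x" "x < 1" using p assms powr_less_mono[of "- \<sigma>" 0 "real p"] by (auto simp: x_def)
    have z: "norm z = 1" using p by (simp add: z_def norm_of_nat_powr)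
    have p0: "of_nat p \<noteq> (0 :: complex)" using p by simp
    have xp: "(of_nat p :: complex) powr (- of_real \<sigma>) = of_real x"
      using powr_of_real[of "real p" "- \<sigma>"] by (simp add: x_def)
    have "- Complex \<sigma> t = - of_real \<sigma> + - Complex 0 t" "- Complex \<sigma> (2 * t) = - of_real \<sigma> + (- Complex 0 t + - Complex 0 t)"
      by (simp_all add: complex_eq_iff)
    then have pw: "(of_nat p :: complex) powr (- Complex \<sigma> t) = of_real x * z"
       "(of_nat p :: complex) powr (- Complex \<sigma> (2 * t)) = of_real x * z ^ 2"
      using p0 by (simp_all only: powr_add xp z_def power2_eq_square)
    define W where "W = (1 - of_real x) ^ 3 * (1 - of_real x * z) ^ 4 * (1 - of_real x * z ^ 2)"
    have "norm (of_real x * u) < 1" if "norm u = 1" for u :: complex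
      using x that by (simp add: norm_mult)
    from this[of 1] this[of z] this[of "z ^ 2"] have "W \<noteq> 0"
      using z by (auto simp: W_def norm_power)
    moreover have "norm W \<le> 1" unfolding W_def by (rule mertens_local[OF x z])
    ultimately have "1 \<le> norm (1 / W)" by (simp add: norm_divide)
    also have "1 / W = ?Z (of_real \<sigma>) p ^ 3 * ?Z (Complex \<sigma> t) p ^ 4 * ?Z (Complex \<sigma> (2 * t)) p"
      using True by (simp add: W_def xp pw power_divide)
    finally show ?thesis .
  qed simp
  have "1 \<le> ?P N" for N
    unfolding prod_power_distrib prod.distrib[symmetric] prod_norm[symmetric]
    by (rule prod_ge_1) (rule loc)
  then show "\<exists>N. \<forall>n\<ge>N. 1 \<le> ?P n"
    by blast
qed

text \<open>On the line, a zero at 1 + it with t nonzero would give the product in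
  \<open>mertens_inequality\<close> a zero of order at least 4 against the triple pole of the first
  factor, while the factor at 1 + 2it stays bounded. The product would then tend to 0 as
  \<open>\<sigma>\<close> decreases to 1.\<close>

theorem zeta_entire_nonzero:
  assumes "Re s \<ge> 1"
  shows "zeta_entire s \<noteq> 0"
proof (cases "Re s > 1")
  case True
  then show ?thesis using zeta_nonzero[OF True] by (auto simp: zeta_conv_entire split: if_splits)
next
  case False
  define t where "t = Im s"
  have s: "s = Complex 1 t" using False assms by (simp add: complex_eq_iff t_def)
  show ?thesis
  proof (cases "t = 0")
    case True
    then have "s = 1" by (simp add: s complex_eq_iff)
    then show ?thesis by (simp add: zeta_entire_1)
  next
    case t: False
    show ?thesis
    proof
      assume 0: "zeta_entire s = 0"
      have cont: "isCont zeta_entire u" for u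
        using holomorphic_on_imp_continuous_on[OF holomorphic_zeta_entire[of UNIV]] by (simp add: continuous_on_eq_continuous_at)
      have line: "((\<lambda>\<sigma>. Complex \<sigma> y) \<longlongrightarrow> Complex 1 y) (at_right 1)" for y
        by (intro tendsto_Complex tendsto_intros)
      have lim1: "((\<lambda>\<sigma>. zeta_entire (of_real \<sigma>)) \<longlongrightarrow> zeta_entire (of_real 1)) (at_right 1)"
        by (intro isCont_tendsto_compose[OF cont] tendsto_intros)
      have lim2: "((\<lambda>\<sigma>. zeta_entire (Complex \<sigma> (2 * t))) \<longlongrightarrow> zeta_entire (Complex 1 (2 * t))) (at_right 1)"
        by (intro isCont_tendsto_compose[OF cont] line)
      have "(zeta_entire has_field_derivative deriv zeta_entire s) (at s)"
        using holomorphic_derivI[OF holomorphic_zeta_entire[of UNIV]] by simp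
      then have "((\<lambda>u. (zeta_entire u - zeta_entire s) / (u - s)) \<longlongrightarrow> deriv zeta_entire s) (at s)"
        by (simp add: has_field_derivative_iff)
      moreover have "filterlim (\<lambda>\<sigma>. Complex \<sigma> t) (at s) (at_right 1)"
        unfolding filterlim_at s by (intro conjI line) (auto simp: eventually_at_filter)
      ultimately have "((\<lambda>\<sigma>. (zeta_entire (Complex \<sigma> t) - zeta_entire s) / (Complex \<sigma> t - s)) \<longlongrightarrow> deriv zeta_entire s) (at_right 1)"
        by (rule filterlim_compose)
      moreover have "Complex \<sigma> t - s = of_real (\<sigma> - 1)" for \<sigma> by (simp add: s complex_eq_iff)
      ultimately have lim3: "((\<lambda>\<sigma>. zeta_entire (Complex \<sigma> t) / of_real (\<sigma> - 1)) \<longlongrightarrow> deriv zeta_entire s) (at_right 1)"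
        using 0 by simp
      \<comment> \<open>The Mertens product in terms of \<open>zeta_entire\<close>. Dividing each of
        the four values near the zero by \<open>\<sigma> - 1\<close> costs
        \<open>(\<sigma> - 1) ^ 4\<close>; the triple pole uses up three of these factors, and the
        one left forces the limit 0.\<close>
      define R where "R \<sigma> = zeta_entire (of_real \<sigma>) ^ 3 * (zeta_entire (Complex \<sigma> t) / of_real (\<sigma> - 1)) ^ 4 * of_real (\<sigma> - 1)
         / (Complex \<sigma> t - 1) ^ 4 * (zeta_entire (Complex \<sigma> (2 * t)) / (Complex \<sigma> (2 * t) - 1))" for \<sigma>
      have nz: "Complex 1 y - 1 \<noteq> 0" if "y \<noteq> 0" for y using that by (simp add: complex_eq_iff)
      have "(R \<longlongrightarrow> zeta_entire (of_real 1) ^ 3 * deriv zeta_entire s ^ 4 * of_real (1 - 1) / (Complex 1 t - 1) ^ 4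
          * (zeta_entire (Complex 1 (2 * t)) / (Complex 1 (2 * t) - 1))) (at_right 1)"
        unfolding R_def using t by (intro tendsto_intros lim1 lim2 lim3 line) (use nz[of t] nz[of "2 * t"] in auto)
      then have "((\<lambda>\<sigma>. norm (R \<sigma>)) \<longlongrightarrow> 0) (at_right 1)"
        by (intro tendsto_norm_zero) simp
      then have "\<forall>\<^sub>F \<sigma> in at_right 1. norm (R \<sigma>) < 1" by (rule order_tendstoD(2)) simp
      moreover have "\<forall>\<^sub>F \<sigma>::real in at_right 1. norm (R \<sigma>) \<ge> 1"
        unfolding eventually_at_right_field
      proof (intro exI[of _ 2] conjI allI impI)
        fix \<sigma> :: real assume \<sigma>: "1 < \<sigma>"
        have "R \<sigma> = zeta (of_real \<sigma>) ^ 3 * zeta (Complex \<sigma> t) ^ 4 * zeta (Complex \<sigma> (2 * t))"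
        proof -
          have d: "Complex \<sigma> t - 1 \<noteq> 0" "Complex \<sigma> (2 * t) - 1 \<noteq> 0" "complex_of_real \<sigma> - 1 \<noteq> 0"
            using \<sigma> by (auto simp: complex_eq_iff)
          have "complex_of_real (\<sigma> - 1) ^ 4 = of_real (\<sigma> - 1) ^ 3 * of_real (\<sigma> - 1)" by (simp add: eval_nat_numeral)
          then show ?thesis using d by (simp add: R_def zeta_conv_entire power_divide)
        qed
        then show "1 \<le> norm (R \<sigma>)" using mertens_inequality[OF \<sigma>, of t] by simp
      qed simp
      ultimately have "\<forall>\<^sub>F \<sigma>::real in at_right 1. False" by eventually_elim simp
      then show False by (simp add: trivial_limit_at_right_real)
    qed
  qed
qed

subsection \<open>Existence of a nontrivial zero\<close>

text \<open>The map \<open>w \<mapsto> w / (2 * A - w)\<close> sends the half-plane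
  \<open>Re w < A\<close> into the unit disc and fixes 0, so the Schwarz lemma applies after
  rescaling. At radius \<open>R / 2\<close> it gives
  \<open>norm (f z) \<le> norm (2 * A - f z) / 2\<close>, hence the constant 2.\<close>

lemma borel_caratheodory:
  assumes hol: "f holomorphic_on ball 0 R" and f0: "f 0 = 0" and A: "A > 0"
    and Re: "\<And>z. norm z < R \<Longrightarrow> Re (f z) < A" and z: "norm z \<le> R / 2" "R > 0"
  shows "norm (f z) \<le> 2 * A"
proof -
  have less: "norm (f w) < norm (2 * of_real A - f w)" if "norm w < R" for w
  proof -
    have "(norm (f w))\<^sup>2 < (norm (2 * of_real A - f w))\<^sup>2"
      unfolding cmod_power2 using Re[OF that] A by (simp add: power2_eq_square algebra_simps)
    then show ?thesis by (simp add: power2_less_imp_less)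
  qed
  define \<phi> where "\<phi> w = f (of_real R * w) / (2 * of_real A - f (of_real R * w))" for w
  have in_ball: "norm (of_real R * w) < R" if "norm w < 1" for w :: complex
    using that z(2) by (simp add: norm_mult)
  have nz: "2 * of_real A - f w \<noteq> 0" if "norm w < R" for w
    using less[OF that] by auto
  have "(f \<circ> (\<lambda>w. of_real R * w)) holomorphic_on ball 0 1"
    by (rule holomorphic_on_compose_gen[OF _ hol]) (use in_ball in \<open>auto intro!: holomorphic_intros\<close>)
  then have "\<phi> holomorphic_on ball 0 1"
    unfolding \<phi>_def[abs_def] o_def using nz in_ball by (auto intro!: holomorphic_intros)
  moreover have "\<phi> 0 = 0" by (simp add: \<phi>_def f0)
  moreover have "norm (\<phi> w) < 1" if "norm w < 1" for w
    using less[OF in_ball[OF that]] nz[OF in_ball[OF that]] by (simp add: \<phi>_def norm_divide)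
  moreover have z1: "norm (z / of_real R) < 1" using z by (simp add: norm_divide field_simps)
  ultimately have "norm (\<phi> (z / of_real R)) \<le> norm (z / of_real R)"
    by (rule Schwarz_Lemma(1))
  also have "\<dots> \<le> 1 / 2" using z by (simp add: norm_divide field_simps)
  finally have "norm (f z) / norm (2 * of_real A - f z) \<le> 1 / 2"
    using z by (simp add: \<phi>_def norm_divide)
  moreover have "norm z < R" using z by simp
  ultimately have "norm (f z) \<le> norm (2 * of_real A - f z) / 2"
    using nz[of z] by (simp add: field_simps)
  also have "\<dots> \<le> (2 * A + norm (f z)) / 2"
    using norm_triangle_ineq4[of "2 * of_real A" "f z"] A by (simp add: norm_mult)
  finally show ?thesis by simp
qed

text \<open>This bounds the order of \<open>xi\<close> by 3/2. The exponent comes from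
  \<open>norm_theta_mellin_le\<close>, and the polynomial factors are absorbed through
  \<open>(3 * R)\<^sup>2 \<le> exp (6 * R)\<close>.\<close>

lemma norm_xi_le:
  assumes "norm s \<le> R" "R \<ge> 1"
  shows "norm (xi s) \<le> exp (12 * (R * sqrt R))"
proof -
  let ?e = "exp (6 * (R * sqrt R))"
  have bnd: "norm (theta_mellin u) \<le> 2 * ?e" if "Re u \<le> R" for u
  proof -
    have "sqrt (3 * R) \<le> 2 * sqrt R"
      using assms by (intro real_le_lsqrt) (auto simp: power_mult_distrib)
    then have "3 * R * sqrt (3 * R) \<le> 3 * R * (2 * sqrt R)" using assms by (intro mult_left_mono) auto
    then have "2 * exp (3 * R * sqrt (3 * R)) \<le> 2 * ?e" by simp
    moreover have "norm (theta_mellin u) \<le> 2 * exp (3 * R * sqrt (3 * R))"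
      by (rule norm_theta_mellin_le) (use that assms in auto)
    ultimately show ?thesis by (rule order_trans[rotated])
  qed
  have Re: "\<bar>Re s\<bar> \<le> R" using abs_Re_le_cmod[of s] assms by simp
  have "norm (s - 1) \<le> R + 1" using norm_triangle_ineq4[of s 1] assms by simp
  then have "norm (s * (s - 1)) \<le> R * (R + 1)"
    unfolding norm_mult using assms by (intro mult_mono) auto
  moreover have "norm (theta_mellin (s / 2) + theta_mellin ((1 - s) / 2)) \<le> 2 * ?e + 2 * ?e"
    using Re assms by (intro order_trans[OF norm_triangle_ineq] add_mono bnd) auto
  ultimately have "norm (s * (s - 1) * (theta_mellin (s / 2) + theta_mellin ((1 - s) / 2))) \<le> R * (R + 1) * (2 * ?e + 2 * ?e)"
    unfolding norm_mult[of "s * (s - 1)"] using assms by (intro mult_mono) auto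
  then have "norm (xi s) \<le> 1 + R * (R + 1) * (2 * ?e + 2 * ?e)"
    unfolding xi_def by (intro order_trans[OF norm_triangle_ineq]) simp
  also have "\<dots> \<le> 1 * ?e + R * (R + 1) * (2 * ?e + 2 * ?e)"
    using assms by (intro add_right_mono) simp
  also have "\<dots> = (1 + 4 * (R * (R + 1))) * ?e" by (simp add: algebra_simps)
  also have "\<dots> \<le> (3 * R)\<^sup>2 * ?e"
  proof (rule mult_right_mono)
    have "R * 1 \<le> R * R" "1 \<le> R * R" using assms by (auto intro: mult_left_mono simp: mult_ge1_I)
    then show "1 + 4 * (R * (R + 1)) \<le> (3 * R)\<^sup>2" by (simp add: power2_eq_square algebra_simps)
  qed simp
  also have "3 * R \<le> exp (3 * R)" using exp_ge_add_one_self[of "3 * R"] by linarith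
  then have "(3 * R)\<^sup>2 * ?e \<le> exp (3 * R) ^ 2 * ?e"
    using assms by (intro mult_right_mono power_mono) auto
  also have "\<dots> = exp (6 * R + 6 * (R * sqrt R))" by (simp add: exp_of_nat_mult[symmetric] exp_add)
  also have "\<dots> \<le> exp (12 * (R * sqrt R))"
    using assms mult_left_mono[of 1 "sqrt R" R] by simp
  finally show ?thesis .
qed

lemma theta_moment_1_pos: "theta_moment 1 > 0"
proof -
  have "(\<integral>x. exp (- 2 * pi) * indicator {1..2::real} x \<partial>lborel) \<le> (\<integral>x. theta_weight x * exp (1 * lnp x) \<partial>lborel)"
  proof (rule integral_mono)
    show "exp (- 2 * pi) * indicator {1..2} x \<le> theta_weight x * exp (1 * lnp x)" for x :: real
    proof (cases "x \<in> {1..2}")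
      case True
      have "exp (- 2 * pi) \<le> (\<Sum>n\<in>{0}. exp (- pi * (real (Suc n))\<^sup>2 * x))"
        using True mult_left_mono[of x 2 pi] by simp
      also have "\<dots> \<le> theta_tail x"
        unfolding theta_tail_def using True by (intro sum_le_suminf summable_theta_tail) auto
      finally show ?thesis using True exp_lnp[of x 1] by (simp add: theta_weight_def)
    next
      case False
      then have "exp (- 2 * pi) * indicator {1..2} x = 0" by simp
      then show ?thesis using theta_weight_nonneg[of x] by (simp only:) simp
    qed
  qed (use integrable_theta_weight[of 1] in auto)
  moreover have "(\<integral>x. exp (- 2 * pi) * indicator {1..2::real} x \<partial>lborel) = exp (- 2 * pi)" by simp
  moreover have "exp (- 2 * pi) > 0" by simp
  ultimately show ?thesis unfolding theta_moment_def by linarith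
qed

text \<open>Since \<open>xi 0 = 1\<close>, this shows that \<open>xi\<close> is not constant;
  positivity of the theta integral separates the two values.\<close>

lemma xi_2: "xi 2 \<noteq> 1"
proof -
  have "xi 2 = 1 + of_real (2 * (theta_moment 1 + theta_moment (- 1 / 2)))"
    unfolding xi_def using theta_mellin_of_real[of 1] theta_mellin_of_real[of "- 1 / 2"] by simp
  moreover have "theta_moment 1 + theta_moment (- 1 / 2) > 0"
    using theta_moment_1_pos theta_moment_nonneg[of "- 1 / 2"] by linarith
  ultimately show ?thesis by (auto simp flip: of_real_add of_real_mult simp del: of_real_add of_real_mult)
qed

text \<open>The exponent 3/2 is below 2, so Liouville's theorem leaves a quadratic polynomial, and
  comparison with \<open>r ^ 2\<close> along the positive reals removes its leading
  coefficient.\<close>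

lemma entire_growth_linear:
  assumes hol: "f holomorphic_on UNIV" and f0: "f 0 = 0" and K: "K \<ge> 0"
    and growth: "\<And>z. norm z \<ge> 1 \<Longrightarrow> norm (f z) \<le> K * (norm z * sqrt (norm z))"
  obtains b where "\<And>z. f z = b * z"
proof -
  define b where "b = deriv f 0"
  define c where "c = (deriv ^^ 2) f 0 / 2"
  have poly: "f z = b * z + c * z ^ 2" for z
  proof -
    have "f z = (\<Sum>k\<le>2. (deriv ^^ k) f 0 / fact k * z ^ k)"
    proof (rule Liouville_polynomial[OF hol, of 1 K 2])
      fix z :: complex assume z: "1 \<le> norm z"
      have "sqrt (norm z) \<le> norm z" using z by (intro real_le_lsqrt) (auto simp: power2_eq_square mult_le_cancel_left1)
      then have "K * (norm z * sqrt (norm z)) \<le> K * (norm z * norm z)"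
        using K z by (intro mult_left_mono) auto
      with growth[OF z] show "norm (f z) \<le> K * norm z ^ 2" by (simp add: power2_eq_square)
    qed
    also have "\<dots> = b * z + c * z ^ 2"
      by (simp add: eval_nat_numeral b_def c_def f0)
    finally show ?thesis .
  qed
  have "c = 0"
  proof -
    have le: "norm c \<le> K / sqrt r + norm b / r" if r: "r \<ge> 1" for r :: real
    proof -
      have n: "norm (complex_of_real r) = r" using r by simp
      have "norm (c * of_real r ^ 2) \<le> norm (f (of_real r)) + norm (b * of_real r)"
        using norm_triangle_ineq4[of "f (of_real r)" "b * of_real r"] by (simp add: poly)
      also have "\<dots> \<le> K * (r * sqrt r) + norm b * r"
        using growth[of "of_real r"] r by (simp add: norm_mult)
      finally have "norm c * r ^ 2 \<le> K * (r * sqrt r) + norm b * r" using r by (simp add: norm_mult norm_power)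
      then have "norm c \<le> (K * (r * sqrt r) + norm b * r) / r ^ 2" using r by (simp add: field_simps)
      also have "\<dots> = K * (sqrt r / r) + norm b / r" using r by (simp add: power2_eq_square add_divide_distrib)
      also have "sqrt r / r = 1 / sqrt r" using r by (simp add: field_simps)
      finally show ?thesis by simp
    qed
    have "((\<lambda>r. K / sqrt r + norm b / r) \<longlongrightarrow> 0) at_top" by real_asymp
    moreover have "\<forall>\<^sub>F r in at_top. norm c \<le> K / sqrt r + norm b / r"
      using eventually_ge_at_top[of 1] by eventually_elim (rule le)
    ultimately have "norm c \<le> 0" by (rule tendsto_lowerbound) simp
    then show ?thesis by simp
  qed
  with poly show thesis by (intro that[of b]) simp
qed

text \<open>A zero-free \<open>xi\<close> would be \<open>exp\<close> of a polynomial of degree at most 1 by its growth, hence constant by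
  its symmetry.\<close>

theorem xi_has_zero: "\<exists>s. xi s = 0"
proof (rule ccontr)
  assume "\<not> (\<exists>s. xi s = 0)"
  then obtain g where g: "g holomorphic_on UNIV" "\<And>z. xi z = exp (g z)"
    using contractible_imp_holomorphic_log[OF holomorphic_xi] convex_imp_contractible[OF convex_UNIV] by (metis UNIV_I)
  define f where "f z = g z - g 0" for z
  have f: "f holomorphic_on UNIV" "f 0 = 0"
    using g(1) by (auto simp: f_def[abs_def] intro!: holomorphic_intros)
  define A where "A = \<bar>Re (g 0)\<bar> + 1"
  have A: "A \<ge> 1" by (simp add: A_def)
  \<comment> \<open>On the disc of radius \<open>2 * r\<close> the bound \<open>norm_xi_le\<close>
    gives \<open>12 * (2 * r * sqrt (2 * r))\<close>, which
    \<open>sqrt (2 * r) \<le> 2 * sqrt r\<close> turns into \<open>48 * r * sqrt r\<close>;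
    \<open>borel_caratheodory\<close> doubles its sum with \<open>A\<close>.\<close>
  define K where "K = 2 * (48 + A)"
  have growth: "norm (f z) \<le> K * (norm z * sqrt (norm z))" if z: "norm z \<ge> 1" for z
  proof -
    define r where "r = norm z"
    have r: "r \<ge> 1" using z by (simp add: r_def)
    have "norm (f z) \<le> 2 * (12 * (2 * r * sqrt (2 * r)) + A)"
    proof (rule borel_caratheodory[of f "2 * r"])
      show "f holomorphic_on ball 0 (2 * r)" using f(1) by (rule holomorphic_on_subset) simp
      show "0 < 12 * (2 * r * sqrt (2 * r)) + A" using r A by (intro add_nonneg_pos) auto
      fix w :: complex assume "norm w < 2 * r"
      then have "exp (Re (g w)) \<le> exp (12 * (2 * r * sqrt (2 * r)))"
        using norm_xi_le[of w "2 * r"] r by (simp add: g(2))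
      then show "Re (f w) < 12 * (2 * r * sqrt (2 * r)) + A" by (simp add: f_def A_def)
    qed (use f r in \<open>auto simp: r_def\<close>)
    also have "sqrt (2 * r) \<le> 2 * sqrt r"
      using r by (intro real_le_lsqrt) (auto simp: power_mult_distrib)
    then have "2 * (12 * (2 * r * sqrt (2 * r)) + A) \<le> 2 * (12 * (2 * r * (2 * sqrt r)) + A)"
      using r by (intro mult_left_mono add_right_mono) auto
    also have "\<dots> \<le> 2 * (12 * (2 * r * (2 * sqrt r)) + A * (r * sqrt r))"
      using r A mult_mono[of 1 r 1 "sqrt r"] by (intro mult_left_mono add_left_mono) auto
    also have "\<dots> = K * (r * sqrt r)" by (simp add: K_def algebra_simps)
    finally show ?thesis by (simp add: r_def)
  qed
  obtain b where b: "\<And>z. f z = b * z"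
    using entire_growth_linear[OF f, of K] growth A by (auto simp: K_def)
  have xi_eq: "xi z = exp (g 0) * exp (b * z)" for z
    using b[of z] by (simp add: g(2) f_def exp_add[symmetric] algebra_simps)
  have e0: "exp (g 0) = 1" using xi_eq[of 0] by (simp add: xi_def)
  have per: "exp (b * (1 - z)) = exp (b * z)" for z using xi_reflect[of z] by (simp add: xi_eq)
  \<comment> \<open>The symmetry at 0 alone suffices: \<open>exp b = 1\<close> already forces
    \<open>xi 2 = 1\<close>.\<close>
  have "exp b = 1" using per[of 0] by simp
  then have "exp (b * 2) = 1" unfolding mult_2_right exp_add by simp
  then show False using xi_2 by (simp add: xi_eq e0)
qed

subsection \<open>The supremum of the real parts of the zeros\<close>

text \<open>The zeros of \<open>rGamma (s / 2 + 1)\<close> are the trivial zeros -2, -4, and so on,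
  all outside this half-plane.\<close>

lemma zeta_entire_eq_0_iff:
  assumes "Re s > - 2"
  shows "zeta_entire s = 0 \<longleftrightarrow> xi s = 0"
proof -
  have "s / 2 + 1 \<notin> \<int>\<^sub>\<le>\<^sub>0"
  proof
    assume "s / 2 + 1 \<in> \<int>\<^sub>\<le>\<^sub>0"
    then obtain n where "s / 2 + 1 = - of_nat n" by (elim nonpos_Ints_cases')
    then have "Re (s / 2 + 1) = Re (- of_nat n)" by (rule arg_cong)
    with assms show False by simp
  qed
  then show ?thesis by (simp add: zeta_entire_def rGamma_eq_zero_iff)
qed

text \<open>For \<open>Re s \<le> 0\<close> the reflection moves the point to the half-plane where
  zeta is known not to vanish.\<close>

lemma xi_nonzero:
  assumes "Re s \<ge> 1 \<or> Re s \<le> 0"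
  shows "xi s \<noteq> 0"
proof -
  have 1: "xi u \<noteq> 0" if "Re u \<ge> 1" for u
    using zeta_entire_nonzero[OF that] zeta_entire_eq_0_iff[of u] that by simp
  show ?thesis using assms 1[of s] 1[of "1 - s"] xi_reflect[of s] by auto
qed

lemma xi_zero_imp_nontrivial:
  assumes "xi s = 0"
  shows "s \<in> nontrivial_zeta_zeros"
proof -
  have "0 < Re s" "Re s < 1" using xi_nonzero[of s] assms by (auto simp: not_le[symmetric])
  moreover from this have "zeta_entire s = 0" using zeta_entire_eq_0_iff[of s] assms by simp
  ultimately show ?thesis
    by (auto simp: nontrivial_zeta_zeros_def trivial_zeta_zeros_def zeta_conv_entire)
qed

lemma nontrivial_zero_entire:
  assumes "s \<in> nontrivial_zeta_zeros"
  shows "zeta_entire s = 0" "Re s < 1"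
proof -
  show 0: "zeta_entire s = 0"
    using assms by (auto simp: nontrivial_zeta_zeros_def zeta_conv_entire split: if_splits)
  show "Re s < 1" using zeta_entire_nonzero[of s] 0 by (auto simp: not_le[symmetric])
qed

lemma bdd_above_nontrivial_zeros: "bdd_above (Re ` nontrivial_zeta_zeros)"
  using nontrivial_zero_entire(2) by (intro bdd_aboveI[of _ 1]) (auto intro: less_imp_le)

lemma Re_le_zeta_Theta: "s \<in> nontrivial_zeta_zeros \<Longrightarrow> Re s \<le> zeta_Theta"
  unfolding zeta_Theta_def by (intro cSup_upper bdd_above_nontrivial_zeros imageI)

text \<open>One of the mirror images \<open>s\<close> and \<open>1 - s\<close> has real part at
  least 1/2. The bound keeps \<open>zeta_Theta - 1 - \<delta>\<close> above -1 when
  \<open>\<delta> < 1 / 2\<close>.\<close>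

lemma zeta_Theta_ge_half: "zeta_Theta \<ge> 1 / 2"
proof -
  obtain s where s: "xi s = 0" using xi_has_zero by blast
  then have "xi (1 - s) = 0" by (simp add: xi_reflect)
  then have "s \<in> nontrivial_zeta_zeros" "1 - s \<in> nontrivial_zeta_zeros"
    using s xi_zero_imp_nontrivial by auto
  then have "Re s \<le> zeta_Theta" "Re (1 - s) \<le> zeta_Theta" by (auto dest: Re_le_zeta_Theta)
  then show ?thesis by simp
qed

lemma nontrivial_zero_near_Theta:
  assumes "c < zeta_Theta"
  obtains s where "s \<in> nontrivial_zeta_zeros" "c < Re s"
proof -
  have "nontrivial_zeta_zeros \<noteq> {}" using xi_has_zero xi_zero_imp_nontrivial by blast
  then show thesis
    using assms less_cSup_iff[of "Re ` nontrivial_zeta_zeros" c] bdd_above_nontrivial_zeros that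
    by (auto simp: zeta_Theta_def)
qed

section \<open>Absence of zeros on the positive real axis and on the shifted set of zeros\<close>

lemma theta_moment_less:
  assumes "c \<le> 1"
  shows "theta_moment c \<le> 1"
proof -
  have e1: "exp (- 1 :: real) \<le> 1 / 2" using exp_ge_add_one_self[of "1 :: real"] by (simp add: exp_minus field_simps)
  have "theta_moment c \<le> (\<integral>x. 2 * (indicator {1..} x * exp (- x)) \<partial>lborel)"
    unfolding theta_moment_def
  proof (rule integral_mono)
    show "theta_weight x * exp (c * lnp x) \<le> 2 * (indicator {1..} x * exp (- x))" for x
    proof (cases "x \<ge> 1")
      case True
      have "exp (c * lnp x) \<le> x"
        using True assms powr_mono[of c 1 x] by (simp add: exp_lnp)
      then have "theta_weight x * exp (c * lnp x) \<le> theta_weight x * x"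
        using theta_weight_nonneg by (intro mult_left_mono)
      also have "\<dots> = theta_tail x" using True by (simp add: theta_weight_def)
      also have "\<dots> \<le> 2 * exp (- pi * x)" by (rule theta_tail_le[OF True])
      also have "\<dots> \<le> 2 * exp (- x)" using True pi_gt3 mult_right_mono[of 1 pi x] by simp
      finally show ?thesis using True by simp
    qed (simp add: theta_weight_def)
  qed (use integrable_theta_weight exp_tail_integral in \<open>auto simp: has_bochner_integral_iff\<close>)
  also have "\<dots> = 2 * exp (- 1)" using exp_tail_integral by (simp add: has_bochner_integral_iff)
  finally show ?thesis using e1 by linarith
qed

text \<open>Between 0 and 1 both theta moments are at most 1 and
  \<open>x * (1 - x) \<le> 1 / 4\<close>, so \<open>xi\<close> is at least 1/2 there; from 1 on the
  general nonvanishing applies.\<close>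

lemma zeta_entire_real_nonzero:
  assumes "x > 0"
  shows "zeta_entire (of_real x) \<noteq> 0"
proof (cases "x < 1")
  case True
  have "xi (of_real x) = of_real (1 - x * (1 - x) * (theta_moment (x / 2) + theta_moment ((1 - x) / 2)))"
    unfolding xi_def using theta_mellin_of_real[of "x / 2"] theta_mellin_of_real[of "(1 - x) / 2"]
    by (simp add: algebra_simps)
  moreover have "x * (1 - x) * (theta_moment (x / 2) + theta_moment ((1 - x) / 2)) \<le> x * (1 - x) * 2"
    using True assms theta_moment_less[of "x / 2"] theta_moment_less[of "(1 - x) / 2"]
    by (intro mult_left_mono mult_nonneg_nonneg) auto
  moreover have "x * (1 - x) * 2 < 1"
  proof -
    have "0 \<le> (2 * x - 1)\<^sup>2" by simp
    then have "4 * (x * (1 - x)) \<le> 1" by (simp add: power2_eq_square algebra_simps)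
    then show ?thesis by simp
  qed
  ultimately have "xi (of_real x) \<noteq> 0" by (simp only: of_real_eq_0_iff)
  then show ?thesis using zeta_entire_eq_0_iff[of "of_real x"] assms by simp
next
  case False
  then show ?thesis by (intro zeta_entire_nonzero) simp
qed

text \<open>The real part of \<open>s - 1\<close> lies strictly between -1 and 0: \<open>xi\<close>
  has no zero left of the line \<open>Re s = 0\<close>, and the trivial zeros begin only at
  -2.\<close>

lemma zeta_entire_zero_shift:
  assumes "s \<in> nontrivial_zeta_zeros" "Re s > 0"
  shows "zeta_entire (s - 1) \<noteq> 0"
proof -
  have "xi (s - 1) \<noteq> 0" using nontrivial_zero_entire(2)[OF assms(1)] by (intro xi_nonzero) simp
  then show ?thesis using zeta_entire_eq_0_iff[of "s - 1"] assms(2) by simp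
qed

subsection \<open>The Mellin transform of the error term\<close>

lemma laplace_of_real: "laplace M \<phi> f (of_real x) = of_real (\<integral>t. f t * exp (- x * \<phi> t) \<partial>M)"
proof -
  have "complex_of_real (f t) * exp (- of_real x * of_real (\<phi> t)) = of_real (f t * exp (- x * \<phi> t))" for t
    by (simp add: exp_of_real[symmetric])
  then show ?thesis unfolding laplace_def by (simp only: integral_complex_of_real)
qed

text \<open>A Beta integral, by induction on \<open>k\<close>. In \<open>(1 - l / x) ^ Suc k = (1 -
  l / x) ^ k - l / x * (1 - l / x) ^ k\<close> the extra \<open>1 / x\<close> raises
  \<open>s\<close> by 1. Of the linear factors s, s + 1, ..., s + k + 1 one denominator lacks the
  last and the other the first.\<close>

lemma riesz_weight_integral:
  fixes l s :: real
  assumes "l > 0" "s > 0"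
  shows "has_bochner_integral lborel (\<lambda>x. indicator {l..} x * ((1 - l / x) ^ k * x powr (- s - 1)))
           (fact k * l powr (- s) / pochhammer s (Suc k))"
  using assms(2)
proof (induction k arbitrary: s)
  case 0
  then show ?case using power_integral_atLeast[of s l] assms by simp
next
  case (Suc k)
  have s1: "s + 1 > 0" using Suc.prems by simp
  have "has_bochner_integral lborel (\<lambda>x. indicator {l..} x * ((1 - l / x) ^ k * x powr (- s - 1)) -
      l * (indicator {l..} x * ((1 - l / x) ^ k * x powr (- (s + 1) - 1))))
     (fact k * l powr (- s) / pochhammer s (Suc k) - l * (fact k * l powr (- (s + 1)) / pochhammer (s + 1) (Suc k)))"
    by (intro has_bochner_integral_diff has_bochner_integral_mult_right Suc.IH Suc.prems s1)
  also have "(\<lambda>x. indicator {l..} x * ((1 - l / x) ^ k * x powr (- s - 1)) -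
      l * (indicator {l..} x * ((1 - l / x) ^ k * x powr (- (s + 1) - 1)))) =
      (\<lambda>x. indicator {l..} x * ((1 - l / x) ^ Suc k * x powr (- s - 1)))"
  proof
    fix x
    show "indicator {l..} x * ((1 - l / x) ^ k * x powr (- s - 1)) - l * (indicator {l..} x * ((1 - l / x) ^ k * x powr (- (s + 1) - 1))) =
      indicator {l..} x * ((1 - l / x) ^ Suc k * x powr (- s - 1))"
    proof (cases "x \<ge> l")
      case True
      then have x: "x > 0" using assms by simp
      have "x powr (- (s + 1) - 1) = x powr (- s - 1 - 1)" by (simp add: algebra_simps)
      also have "\<dots> = x powr (- s - 1) / x" using x by (subst powr_diff) simp
      finally show ?thesis using True by (simp add: algebra_simps)
    qed simp
  qed
  also have "fact k * l powr (- s) / pochhammer s (Suc k) - l * (fact k * l powr (- (s + 1)) / pochhammer (s + 1) (Suc k)) =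
     fact (Suc k) * l powr (- s) / pochhammer s (Suc (Suc k))"
  proof -
    define P where "P = pochhammer s (Suc (Suc k))"
    have P: "P > 0" unfolding P_def using Suc.prems by (intro pochhammer_pos)
    have "P = s * pochhammer (s + 1) (Suc k)" unfolding P_def by (rule pochhammer_rec)
    then have 1: "1 / pochhammer (s + 1) (Suc k) = s / P" using Suc.prems P by (simp add: field_simps)
    define t where "t = s + of_nat (Suc k)"
    have "t > 0" using Suc.prems by (simp add: t_def)
    moreover have "P = pochhammer s (Suc k) * t" unfolding P_def t_def by (rule pochhammer_Suc)
    ultimately have 2: "1 / pochhammer s (Suc k) = (s + of_nat (Suc k)) / P" unfolding t_def[symmetric] by simp
    have "- (s + 1) = - s - 1" by simp
    then have "l powr (- (s + 1)) = l powr (- s - 1)" by (rule arg_cong)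
    then have 3: "l * l powr (- (s + 1)) = l powr (- s)" using assms by (simp add: powr_diff)
    have "fact k * l powr (- s) / pochhammer s (Suc k) - l * (fact k * l powr (- (s + 1)) / pochhammer (s + 1) (Suc k)) =
       fact k * l powr (- s) * (1 / pochhammer s (Suc k)) - fact k * (l * l powr (- (s + 1))) * (1 / pochhammer (s + 1) (Suc k))"
      by simp
    also have "\<dots> = fact k * l powr (- s) * ((s + of_nat (Suc k)) / P - s / P)"
      unfolding 1 2 3 by (simp add: right_diff_distrib)
    also have "(s + of_nat (Suc k)) / P - s / P = of_nat (Suc k) / P" by (simp flip: diff_divide_distrib)
    finally show ?thesis by (simp add: P_def)
  qed
  finally show ?case .
qed

text \<open>The indicator encodes the condition \<open>l \<le> x\<close> for
  \<open>l = Suc n\<close>, so the range of summation no longer depends on \<open>x\<close> and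
  \<open>S\<close> can be integrated termwise.\<close>

definition riesz_term :: "nat \<Rightarrow> nat \<Rightarrow> real \<Rightarrow> real" where
  "riesz_term k n x = psi_ratio (Suc n) * (indicator {real (Suc n)..} x * (1 - real (Suc n) / x) ^ k) / fact k"

lemma riesz_term_nonneg: "riesz_term k n x \<ge> 0"
  unfolding riesz_term_def using psi_ratio_bounds
  by (auto simp: indicator_def divide_le_eq_1 intro!: divide_nonneg_pos mult_nonneg_nonneg zero_le_power)

lemma riesz_sums: "(\<lambda>n. riesz_term k n x) sums S k x"
proof -
  define A where "A = {l. 1 \<le> l \<and> real l \<le> x}"
  have finA: "finite A" by (rule finite_subset[of _ "{..nat \<lfloor>x\<rfloor>}"]) (auto simp: A_def le_nat_floor)
  have "(\<lambda>n. riesz_term k n x) sums (\<Sum>n\<in>(\<lambda>l. l - 1) ` A. riesz_term k n x)"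
  proof (rule sums_finite)
    fix n assume "n \<notin> (\<lambda>l. l - 1) ` A"
    then have "Suc n \<notin> A" by (metis diff_Suc_1 image_eqI)
    then show "riesz_term k n x = 0" by (auto simp: A_def riesz_term_def indicator_def)
  qed (use finA in auto)
  also have "(\<Sum>n\<in>(\<lambda>l. l - 1) ` A. riesz_term k n x) = (\<Sum>l\<in>A. riesz_term k (l - 1) x)"
    by (subst sum.reindex) (auto simp: inj_on_def A_def)
  also have "\<dots> = (\<Sum>l\<in>A. 1 / fact k * (real l / of_int (dedekind_psi l) * (1 - real l / x) ^ k))"
    by (rule sum.cong) (auto simp: A_def riesz_term_def psi_ratio_def)
  also have "\<dots> = S k x" unfolding S_def A_def by (simp add: sum_distrib_left)
  finally show ?thesis .
qed

lemma measurable_S [measurable]: "S k \<in> borel_measurable borel"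
proof -
  have "S k = (\<lambda>x. \<Sum>n. riesz_term k n x)" using riesz_sums sums_unique by blast
  moreover have "(\<lambda>x. \<Sum>n. riesz_term k n x) \<in> borel_measurable borel"
    unfolding riesz_term_def by measurable
  ultimately show ?thesis by simp
qed

lemma S_nonneg: "S k x \<ge> 0"
  using sums_le[OF _ sums_zero riesz_sums] riesz_term_nonneg by auto

lemma S_mellin:
  assumes "s > 1"
  shows "has_bochner_integral lborel (\<lambda>x. S k x * x powr (- s - 1))
           ((\<Sum>n. psi_ratio (Suc n) * real (Suc n) powr (- s)) / pochhammer s (Suc k))"
proof (rule has_bochner_integral_nn_integral)
  let ?D = "\<Sum>n. psi_ratio (Suc n) * real (Suc n) powr (- s)"
  have s0: "s > 0" using assms by simp
  define P where "P = pochhammer s (Suc k)"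
  have P: "P > 0" unfolding P_def using s0 by (rule pochhammer_pos)
  have sm: "summable (\<lambda>n. psi_ratio (Suc n) * real (Suc n) powr (- s))"
    using dirichlet_real(1)[of psi_ratio s] psi_ratio_bounds assms by simp
  have "(\<integral>\<^sup>+x. ennreal (S k x * x powr (- s - 1)) \<partial>lborel) = (\<integral>\<^sup>+x. (\<Sum>n. ennreal (riesz_term k n x * x powr (- s - 1))) \<partial>lborel)"
    by (intro nn_integral_cong suminf_ennreal_eq[symmetric] sums_mult2 riesz_sums mult_nonneg_nonneg riesz_term_nonneg) auto
  also have "\<dots> = (\<Sum>n. \<integral>\<^sup>+x. ennreal (riesz_term k n x * x powr (- s - 1)) \<partial>lborel)"
    by (rule nn_integral_suminf) (unfold riesz_term_def, measurable)
  also have "\<dots> = (\<Sum>n. ennreal (psi_ratio (Suc n) * real (Suc n) powr (- s) / P))"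
  proof (rule arg_cong[of _ _ suminf], rule ext)
    fix n
    have "has_bochner_integral lborel (\<lambda>x. psi_ratio (Suc n) / fact k * (indicator {real (Suc n)..} x * ((1 - real (Suc n) / x) ^ k * x powr (- s - 1))))
      (psi_ratio (Suc n) / fact k * (fact k * real (Suc n) powr (- s) / P))"
      unfolding P_def by (intro has_bochner_integral_mult_right riesz_weight_integral s0) simp
    also have "(\<lambda>x. psi_ratio (Suc n) / fact k * (indicator {real (Suc n)..} x * ((1 - real (Suc n) / x) ^ k * x powr (- s - 1)))) =
       (\<lambda>x. riesz_term k n x * x powr (- s - 1))"
      by (simp add: riesz_term_def mult_ac)
    also have "psi_ratio (Suc n) / fact k * (fact k * real (Suc n) powr (- s) / P) = psi_ratio (Suc n) * real (Suc n) powr (- s) / P"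
      by simp
    finally show "(\<integral>\<^sup>+x. ennreal (riesz_term k n x * x powr (- s - 1)) \<partial>lborel) = ennreal (psi_ratio (Suc n) * real (Suc n) powr (- s) / P)"
      using riesz_term_nonneg by (subst nn_integral_eq_integral) (auto simp: has_bochner_integral_iff)
  qed
  also have "\<dots> = ennreal (?D / P)"
    using sm psi_ratio_bounds P by (intro suminf_ennreal_eq sums_divide summable_sums) auto
  finally show "(\<integral>\<^sup>+x. ennreal (S k x * x powr (- s - 1)) \<partial>lborel) =
      ennreal (?D / pochhammer s (Suc k))"
    by (simp only: P_def)
  show "0 \<le> ?D / pochhammer s (Suc k)"
    using sm psi_ratio_bounds P unfolding P_def[symmetric] by (intro divide_nonneg_pos suminf_nonneg) auto
qed (use S_nonneg in auto)

definition main_coeff :: "nat \<Rightarrow> real" where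
  "main_coeff k = Re (zeta 4) * h_one / (fact (k + 1) * Re (zeta 2))"

lemma E_eq: "E k x = S k x - main_coeff k * x"
  by (simp add: E_def main_coeff_def)

lemma measurable_E [measurable]: "E k \<in> borel_measurable borel"
  unfolding E_eq[abs_def] by measurable

text \<open>If the oscillation fails for the sign \<open>\<tau>\<close>, this function is
  nonnegative for large \<open>x\<close>. The division by \<open>x\<close> makes its
  \<open>laplace\<close> transform along \<open>lnp\<close> the Mellin transform with kernel x^(-s -
  1).\<close>

definition gap :: "nat \<Rightarrow> real \<Rightarrow> real \<Rightarrow> real \<Rightarrow> real" where
  "gap k \<tau> c x = indicator {1..} x * (x powr c - \<tau> * E k x) / x"

lemma measurable_gap [measurable]: "gap k \<tau> c \<in> borel_measurable borel"
  unfolding gap_def by measurable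

lemma gap_mellin:
  assumes "s > 1" "c < s"
  shows "has_bochner_integral lborel (\<lambda>x. gap k \<tau> c x * exp (- s * lnp x))
     (1 / (s - c) - \<tau> * ((\<Sum>n. psi_ratio (Suc n) * real (Suc n) powr (- s)) / pochhammer s (Suc k) - main_coeff k / (s - 1)))"
proof -
  have "has_bochner_integral lborel (\<lambda>x. indicator {1..} x * x powr (- (s - c) - 1) - \<tau> * (S k x * x powr (- s - 1) -
        main_coeff k * (indicator {1..} x * x powr (- (s - 1) - 1))))
     (1 powr (- (s - c)) / (s - c) - \<tau> * ((\<Sum>n. psi_ratio (Suc n) * real (Suc n) powr (- s)) / pochhammer s (Suc k) -
        main_coeff k * (1 powr (- (s - 1)) / (s - 1))))"
    using assms by (intro has_bochner_integral_diff has_bochner_integral_mult_right power_integral_atLeast S_mellin) auto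
  also have "(\<lambda>x. indicator {1..} x * x powr (- (s - c) - 1) - \<tau> * (S k x * x powr (- s - 1) -
        main_coeff k * (indicator {1..} x * x powr (- (s - 1) - 1)))) = (\<lambda>x. gap k \<tau> c x * exp (- s * lnp x))"
  proof
    fix x
    show "indicator {1..} x * x powr (- (s - c) - 1) - \<tau> * (S k x * x powr (- s - 1) -
        main_coeff k * (indicator {1..} x * x powr (- (s - 1) - 1))) = gap k \<tau> c x * exp (- s * lnp x)"
    proof (cases "x \<ge> 1")
      case True
      have e: "exp (- s * lnp x) = x powr (- s)" by (rule exp_lnp[OF True])
      have "- (s - c) - 1 = c + - s - 1" by simp
      then have 1: "x powr (- (s - c) - 1) = x powr c * x powr (- s) / x"
        using True powr_add[of x c "- s"] powr_diff[of x "c + - s" 1] by simp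
      have 2: "x powr (- s - 1) = x powr (- s) / x" using True by (simp add: powr_diff)
      have 3: "x powr (- (s - 1) - 1) = x powr (- s)" by simp
      show ?thesis unfolding gap_def e 1 2 3 E_eq using True by (simp add: field_simps)
    next
      case False
      \<comment> \<open>Below 1 the sum \<open>S\<close> is empty, so cutting the transform off at 1
        loses nothing of it.\<close>
      have "riesz_term k n x = 0" for n using False by (simp add: riesz_term_def indicator_def)
      then have "S k x = 0" using sums_unique[OF riesz_sums[of k x]] by simp
      then show ?thesis using False by (simp add: gap_def)
    qed
  qed
  finally show ?thesis by simp
qed

text \<open>The poles of \<open>dirichlet psi_ratio s / (s (s + 1) \<dots> (s + k))\<close> and of the main term at 1 cancel.\<close>

definition residue_part :: "nat \<Rightarrow> complex \<Rightarrow> complex" where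
  "residue_part k s = zeta_entire s * Q_product s / (zeta_entire (s + 1) * pochhammer (s + 1) k)"

lemma zeta_entire_conv_zeta: "s \<noteq> 1 \<Longrightarrow> zeta_entire s = (s - 1) * zeta s"
  by (simp add: zeta_conv_entire)

text \<open>The residue of the Mellin transform of \<open>S\<close> at 1 is the coefficient of the
  main term: \<open>pochhammer 2 k\<close> is \<open>fact (k + 1)\<close>, and at 1 the numerator is
  \<open>Q_product 1\<close>.\<close>

lemma residue_part_1: "residue_part k 1 = of_real (main_coeff k)"
proof -
  have z: "zeta 4 = of_real (Re (zeta 4))" "zeta 2 = of_real (Re (zeta 2))"
    using zeta_real[of 4] zeta_real[of 2] by simp_all
  have "pochhammer (1 :: complex) (Suc k) = 1 * pochhammer (1 + 1) k" by (rule pochhammer_rec)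
  then have "pochhammer (1 + 1 :: complex) k = fact (k + 1)" by (simp add: pochhammer_fact)
  then have "residue_part k 1 = zeta 4 * of_real h_one / (zeta 2 * fact (k + 1))"
    by (simp add: residue_part_def zeta_entire_1 Q_product_1 zeta_entire_conv_zeta)
  also have "\<dots> = of_real (main_coeff k)"
    unfolding main_coeff_def by (subst z(1), subst z(2)) (simp add: mult.commute)
  finally show ?thesis .
qed

text \<open>The pole of \<open>zeta (s + 1)\<close> at 0 cancels the factor \<open>s\<close> of
  \<open>pochhammer s (Suc k)\<close>, which is why \<open>residue_part\<close> contains only
  \<open>pochhammer (s + 1) k\<close>. The factor \<open>s - 1\<close> left in the denominator is
  the pole of \<open>zeta s\<close>.\<close>

lemma psi_dirichlet_residue_part:
  assumes "x > 1"
  shows "complex_of_real ((\<Sum>n. psi_ratio (Suc n) * real (Suc n) powr (- x)) / pochhammer x (Suc k)) =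
    residue_part k (of_real x) / (of_real x - 1)"
proof -
  define D where "D = (\<Sum>n. psi_ratio (Suc n) * real (Suc n) powr (- x))"
  define X where "X = complex_of_real x"
  have X: "X \<noteq> 0" "X \<noteq> 1" "Re X > 1" using assms by (auto simp: X_def)
  have D: "dirichlet psi_ratio X = of_real D"
    using dirichlet_real(2)[of psi_ratio x] psi_ratio_bounds assms by (simp add: D_def X_def)
  have z0: "zeta (X + 1) \<noteq> 0" using X by (intro zeta_nonzero) auto
  have "of_real D = zeta X * Q_product X / zeta (X + 1)"
    using dirichlet_psi_ratio_eq[of X] X z0 by (simp add: D field_simps)
  moreover have "zeta_entire (X + 1) = X * zeta (X + 1)" "zeta_entire X = (X - 1) * zeta X"
    using X zeta_entire_conv_zeta[of "X + 1"] zeta_entire_conv_zeta[of X] by simp_all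
  moreover have "complex_of_real (pochhammer x (Suc k)) = X * pochhammer (X + 1) k"
    by (simp add: pochhammer_rec X_def flip: pochhammer_of_real)
  ultimately show ?thesis
    unfolding D_def[symmetric] X_def[symmetric] using X by (simp add: residue_part_def)
qed

subsection \<open>Oscillation\<close>

lemma pochhammer_shift_nonzero:
  assumes "Re s > - 1"
  shows "pochhammer (s + 1) k \<noteq> (0 :: complex)"
proof
  assume "pochhammer (s + 1) k = 0"
  then obtain i where "s + 1 = - of_nat i" by (auto simp: pochhammer_eq_0_iff)
  then have "Re (s + 1) = Re (- of_nat i)" by (rule arg_cong)
  with assms show False by simp
qed

lemma holomorphic_zeta_entire_shift: "(\<lambda>s. zeta_entire (s + 1)) holomorphic_on A"
proof -
  have "(\<lambda>s::complex. s + 1) holomorphic_on A" by (intro holomorphic_intros)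
  then have "(zeta_entire \<circ> (\<lambda>s. s + 1)) holomorphic_on A"
    by (rule holomorphic_on_compose[OF _ holomorphic_zeta_entire])
  then show ?thesis by (simp add: o_def)
qed

lemma holomorphic_pochhammer_shift: "(\<lambda>s::complex. pochhammer (s + 1) k) holomorphic_on A"
  unfolding pochhammer_prod by (intro holomorphic_intros)

theorem error_term_exceeds:
  assumes \<delta>: "0 < \<delta>" "\<delta> < 1 / 2" and \<tau>: "\<tau> = 1 \<or> \<tau> = - 1"
  shows "\<exists>\<^sub>F x in at_top. \<tau> * E k x > x powr (zeta_Theta - 1 - \<delta>)"
proof (rule ccontr)
  define c where "c = zeta_Theta - 1 - \<delta>"
  assume "\<not> (\<exists>\<^sub>F x in at_top. \<tau> * E k x > x powr (zeta_Theta - 1 - \<delta>))"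
  then have "\<forall>\<^sub>F x in at_top. \<tau> * E k x \<le> x powr c"
    by (simp add: frequently_def not_less c_def)
  then have "\<forall>\<^sub>F x in at_top. \<tau> * E k x \<le> x powr c \<and> x \<ge> 1"
    using eventually_ge_at_top by (rule eventually_conj)
  then obtain x0 where x0: "\<And>x. x \<ge> x0 \<Longrightarrow> \<tau> * E k x \<le> x powr c \<and> x \<ge> 1"
    unfolding eventually_at_top_linorder by blast
  then have x01: "x0 \<ge> 1" by auto
  obtain \<rho> where \<rho>: "\<rho> \<in> nontrivial_zeta_zeros" "c + 1 < Re \<rho>"
    by (rule nontrivial_zero_near_Theta[of "c + 1"]) (use \<delta> in \<open>auto simp: c_def\<close>)
  \<comment> \<open>To the right of -1 the product Q is available and the Pochhammer factor has no
    zero.\<close>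
  have c: "c > - 1" using zeta_Theta_ge_half \<delta> by (simp add: c_def)
  have c1: "c < 1" using \<rho>(2) nontrivial_zero_entire(2)[OF \<rho>(1)] by simp
  define f where "f = gap k \<tau> c"
  \<comment> \<open>The sign is known only from \<open>x0\<close> on. The remaining piece
    \<open>f2\<close> lives on a bounded interval, so its transform converges everywhere and does
    not affect the continuation.\<close>
  define f1 where "f1 x = indicator {x0..} x * f x" for x
  define f2 where "f2 x = indicator {..<x0} x * f x" for x
  have [measurable]: "f \<in> borel_measurable borel" "f1 \<in> borel_measurable borel" "f2 \<in> borel_measurable borel"
    unfolding f1_def f2_def f_def by measurable
  have f_int: "integrable lborel (\<lambda>x. f x * exp (- s * lnp x))" if "s > 1" for s
    using gap_mellin[OF that, of c k \<tau>] that c1 by (simp add: f_def has_bochner_integral_iff)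
  have f1_int: "integrable lborel (\<lambda>x. f1 x * exp (- s * lnp x))" if "s > 1" for s
    by (rule Bochner_Integration.integrable_bound[OF f_int[OF that]]) (auto simp: f1_def indicator_def)
  \<comment> \<open>Below \<open>x0\<close> a change of exponent costs only a bounded factor, so
    integrability is inherited from the exponent 2, where it is already known for
    \<open>f\<close>.\<close>
  have f2_int: "integrable lborel (\<lambda>x. f2 x * exp (- s * lnp x))" for s
  proof (rule Bochner_Integration.integrable_bound)
    show "integrable lborel (\<lambda>x. exp (\<bar>2 - s\<bar> * ln x0) * (f x * exp (- 2 * lnp x)))"
      by (intro integrable_mult_right f_int) simp
    show "AE x in lborel. norm (f2 x * exp (- s * lnp x)) \<le> norm (exp (\<bar>2 - s\<bar> * ln x0) * (f x * exp (- 2 * lnp x)))"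
    proof (rule AE_I2)
      fix x
      show "norm (f2 x * exp (- s * lnp x)) \<le> norm (exp (\<bar>2 - s\<bar> * ln x0) * (f x * exp (- 2 * lnp x)))"
      proof (cases "x < x0")
        case True
        have "lnp x \<le> ln x0" using True x01 by (auto simp: lnp_def max_def)
        then have "(2 - s) * lnp x \<le> \<bar>2 - s\<bar> * ln x0" using lnp_nonneg[of x] by (intro mult_mono) auto
        then have "exp (- s * lnp x) \<le> exp (\<bar>2 - s\<bar> * ln x0 + - 2 * lnp x)" by (simp add: algebra_simps)
        then have "\<bar>f x\<bar> * exp (- s * lnp x) \<le> \<bar>f x\<bar> * (exp (\<bar>2 - s\<bar> * ln x0) * exp (- 2 * lnp x))"
          unfolding exp_add by (intro mult_left_mono) auto
        then show ?thesis using True by (simp add: f2_def abs_mult mult_ac)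
      qed (simp add: f2_def)
    qed
  qed measurable
  have f1_nonneg: "f1 x \<ge> 0" for x
    using x0[of x] by (auto simp: f1_def f_def gap_def indicator_def)
  define L1 where "L1 = laplace lborel lnp f1"
  define L2 where "L2 = laplace lborel lnp f2"
  have L2_hol: "L2 holomorphic_on {s. Re s > c}"
    unfolding L2_def by (rule holomorphic_laplace) (use f2_int lnp_nonneg in auto)
  have L_real: "L1 (of_real x) + L2 (of_real x) =
      1 / (of_real x - of_real c) - of_real \<tau> * ((residue_part k (of_real x) - of_real (main_coeff k)) / (of_real x - 1))" if x: "x > 1" for x
  proof -
    have "L1 (of_real x) + L2 (of_real x) = of_real ((\<integral>t. f1 t * exp (- x * lnp t) \<partial>lborel) + (\<integral>t. f2 t * exp (- x * lnp t) \<partial>lborel))"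
      by (simp only: L1_def L2_def laplace_of_real of_real_add)
    also have "(\<integral>t. f1 t * exp (- x * lnp t) \<partial>lborel) + (\<integral>t. f2 t * exp (- x * lnp t) \<partial>lborel) = (\<integral>t. f1 t * exp (- x * lnp t) + f2 t * exp (- x * lnp t) \<partial>lborel)"
      by (rule Bochner_Integration.integral_add[symmetric, OF f1_int[OF x] f2_int])
    also have "(\<lambda>t. f1 t * exp (- x * lnp t) + f2 t * exp (- x * lnp t)) = (\<lambda>t. gap k \<tau> c t * exp (- x * lnp t))"
      by (auto simp: f1_def f2_def f_def indicator_def)
    also have "(\<integral>t. gap k \<tau> c t * exp (- x * lnp t) \<partial>lborel) = 1 / (x - c) -
        \<tau> * ((\<Sum>n. psi_ratio (Suc n) * real (Suc n) powr (- x)) / pochhammer x (Suc k) - main_coeff k / (x - 1))"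
      using gap_mellin[OF x, of c k \<tau>] x c1 by (simp add: has_bochner_integral_iff)
    finally show ?thesis
      unfolding of_real_diff[of "1 / (x - c)"] of_real_mult of_real_diff[of "_ / pochhammer x (Suc k)"] psi_dirichlet_residue_part[OF x]
      by (simp add: diff_divide_distrib)
  qed
  have f1_int': "integrable lborel (\<lambda>x. f1 x * exp (- s * lnp x))" if "s > c" for s
  proof -
    \<comment> \<open>The shifted zeros, where \<open>residue_part\<close> may have poles, are left
      out; the real ray from \<open>c\<close> on remains inside.\<close>
    define U where "U = {s. Re s > c} \<inter> {s. zeta_entire (s + 1) \<noteq> 0}"
    \<comment> \<open>The difference quotient of \<open>residue_part k\<close> at 1: subtracting the
      main term makes the singularity there removable, and the derivative fills it.\<close>
    define R where "R s = (if s = 1 then deriv (residue_part k) 1 else (residue_part k s - residue_part k 1) / (s - 1))" for s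
    define H where "H s = 1 / (s - of_real c) - of_real \<tau> * R s - L2 s" for s
    have openU: "open U"
    proof -
      have "continuous_on UNIV (\<lambda>s. zeta_entire (s + 1))"
        by (rule holomorphic_on_imp_continuous_on[OF holomorphic_zeta_entire_shift])
      then have "open {s. zeta_entire (s + 1) \<noteq> 0}" by (intro open_Collect_neq continuous_on_const)
      then show ?thesis unfolding U_def by (intro open_Int open_halfspace_Re_gt)
    qed
    have "residue_part k holomorphic_on U"
      unfolding residue_part_def[abs_def]
    proof (intro holomorphic_on_divide holomorphic_on_mult holomorphic_zeta_entire_shift holomorphic_pochhammer_shift holomorphic_zeta_entire)
      show "Q_product holomorphic_on U"
        by (rule holomorphic_on_subset[OF holomorphic_Q_product]) (use c in \<open>auto simp: U_def\<close>)
      show "zeta_entire (s + 1) * pochhammer (s + 1) k \<noteq> 0" if "s \<in> U" for s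
        using that c pochhammer_shift_nonzero[of s k] by (auto simp: U_def)
    qed
    then have R_hol: "R holomorphic_on U" unfolding R_def by (rule pole_lemma_open[OF _ openU])
    show ?thesis
    proof (rule landau_laplace[where ?c1.0 = 1 and a = c and H = H and U = U])
      show "H holomorphic_on U" unfolding H_def
        by (intro holomorphic_intros R_hol holomorphic_on_subset[OF L2_hol]) (auto simp: U_def)
      show "complex_of_real x \<in> U" if "x > c" for x
        using that zeta_entire_real_nonzero[of "x + 1"] c by (auto simp: U_def)
      show "H (of_real x) = laplace lborel lnp f1 (of_real x)" if "x > 1" for x
        using L_real[OF that] that by (simp add: H_def R_def residue_part_1 L1_def[symmetric] algebra_simps)
    qed (use openU f1_int f1_nonneg lnp_nonneg that in auto)
  qed
  \<comment> \<open>Convergence of the integral itself makes the transform holomorphic on the full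
    half-plane, including the points that \<open>U\<close> leaves out.\<close>
  then have L1_hol: "L1 holomorphic_on {s. Re s > c}"
    unfolding L1_def by (intro holomorphic_laplace) (use lnp_nonneg in auto)
  \<comment> \<open>The formula for \<open>L1 + L2\<close> multiplied by all denominators that might
    vanish at \<open>\<rho> - 1\<close>. In this form it is holomorphic on the half-plane, so its
    vanishing extends from the real axis.\<close>
  define W where "W s = (L1 s + L2 s - 1 / (s - of_real c)) * ((s - 1) * (zeta_entire (s + 1) * pochhammer (s + 1) k)) +
      of_real \<tau> * (zeta_entire s * Q_product s - of_real (main_coeff k) * (zeta_entire (s + 1) * pochhammer (s + 1) k))" for s
  have "W (\<rho> - 1) = 0"
  proof (rule holomorphic_halfplane_eq_0[of W c 1])
    have Qh: "Q_product holomorphic_on {s. Re s > c}"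
      by (rule holomorphic_on_subset[OF holomorphic_Q_product]) (use c in auto)
    show "W holomorphic_on {s. Re s > c}"
      unfolding W_def[abs_def] by (intro holomorphic_intros L1_hol L2_hol holomorphic_zeta_entire_shift holomorphic_pochhammer_shift Qh holomorphic_zeta_entire) auto
    show "W (of_real x) = 0" if x: "x > 1" for x
    proof -
      define X where "X = complex_of_real x"
      define B where "B = zeta_entire (X + 1) * pochhammer (X + 1) k"
      let ?T = "L1 X + L2 X - 1 / (X - of_real c)"
      have B: "B \<noteq> 0" using zeta_entire_nonzero[of "X + 1"] pochhammer_shift_nonzero[of X k] x by (simp add: B_def X_def)
      have X1: "X - 1 \<noteq> 0" using x by (simp add: X_def)
      have "residue_part k X * B = zeta_entire X * Q_product X" using B by (simp add: residue_part_def B_def)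
      moreover have "?T = - of_real \<tau> * ((residue_part k X - of_real (main_coeff k)) / (X - 1))"
        using L_real[OF x] by (simp add: X_def)
      then have "?T * ((X - 1) * B) =
          - of_real \<tau> * ((residue_part k X - of_real (main_coeff k)) / (X - 1)) * ((X - 1) * B)" by (rule arg_cong)
      then have "?T * ((X - 1) * B) = - of_real \<tau> * ((residue_part k X - of_real (main_coeff k)) * B)"
        using X1 by simp
      ultimately show ?thesis
        by (simp add: W_def X_def[symmetric] B_def[symmetric] left_diff_distrib)
    qed
  qed (use \<rho> in simp)
  \<comment> \<open>At \<open>\<rho> - 1\<close> every term of \<open>W\<close> containing
    \<open>zeta_entire (s + 1)\<close> disappears, and up to sign only the numerator of
    \<open>residue_part\<close> is left.\<close>
  moreover have "zeta_entire (\<rho> - 1 + 1) = 0" using nontrivial_zero_entire(1)[OF \<rho>(1)] by simp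
  ultimately have "zeta_entire (\<rho> - 1) * Q_product (\<rho> - 1) = 0" using \<tau> by (auto simp: W_def)
  moreover have "zeta_entire (\<rho> - 1) \<noteq> 0" using zeta_entire_zero_shift[OF \<rho>(1)] \<rho>(2) c by simp
  moreover have "Q_product (\<rho> - 1) \<noteq> 0" using \<rho>(2) c by (intro Q_product_nonzero) simp
  ultimately show False by simp
qed

theorem theorem3:
  fixes k :: nat and \<epsilon> :: real
  assumes "\<epsilon> > 0"
  shows "(\<exists>\<^sub>F x in at_top. E k x > x powr (zeta_Theta - 1 - \<epsilon>)) \<and>
         (\<exists>\<^sub>F x in at_top. E k x < - (x powr (zeta_Theta - 1 - \<epsilon>)))"
proof -
  \<comment> \<open>A smaller exponent loss gives a stronger bound for \<open>x \<ge> 1\<close>, and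
    \<open>error_term_exceeds\<close> asks for a loss below 1/2.\<close>
  define \<delta> where "\<delta> = min \<epsilon> (1 / 4)"
  have \<delta>: "0 < \<delta>" "\<delta> < 1 / 2" "\<delta> \<le> \<epsilon>" using assms by (auto simp: \<delta>_def)
  have le: "x powr (zeta_Theta - 1 - \<epsilon>) \<le> x powr (zeta_Theta - 1 - \<delta>)" if "x \<ge> 1" for x :: real
    using that \<delta> by (intro powr_mono) auto
  have "\<exists>\<^sub>F x in at_top. \<tau> * E k x > x powr (zeta_Theta - 1 - \<epsilon>)" if "\<tau> = 1 \<or> \<tau> = - 1" for \<tau>
  proof (rule frequently_rev_mp[OF error_term_exceeds[OF \<delta>(1,2) that, of k]])
    show "\<forall>\<^sub>F x in at_top. x powr (zeta_Theta - 1 - \<delta>) < \<tau> * E k x \<longrightarrow> x powr (zeta_Theta - 1 - \<epsilon>) < \<tau> * E k x"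
      using eventually_ge_at_top[of 1] by eventually_elim (use le in force)
  qed
  from this[of 1] this[of "- 1"] show ?thesis by (simp add: less_minus_iff)
qed

end
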